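(* Let $\mathfrak{A}$ be a $(k,p,q)$-differential subalgebra of some $C^*$-algebra that contains a self-adjoint bounded approximate identity. Then $\mathfrak{A}$ has the Wiener property $(W)$.
   Context: A $(k,p,q)$-differential subalgebra of a $C^*$-algebra $\mathfrak{B}$ (with norm $\|\cdot\|_{\mathfrak{B}}$) is a $*$-subalgebra $\mathfrak{A}\subseteq\mathfrak{B}$ equipped with its own norm $\|\cdot\|_{\mathfrak{A}}$ making it a Banach $*$-algebra on which the involution is continuous, where $k\in\mathbb{Z}$, $k\geq 2$, and $p,q>0$ are reals with $p+q=k$, such that for some constant $C>0$, $\|a^k\|_{\mathfrak{A}}\leq C\|a\|_{\mathfrak{A}}^p\|a\|_{\mathfrak{B}}^q$ for all $a\in\mathfrak{A}$. A Banach $*$-algebra $\mathfrak{A}$ has the Wiener property $(W)$ if for every proper closed two-sided ideal $I\subseteq\mathfrak{A}$ there is a topologically irreducible $*$-representation $\Pi:\mathfrak{A}\to\mathbb{B}(\mathcal{H})$ on a Hilbert space with $I\subseteq\ker\Pi$. *)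

theory Defs
  imports Complex_Main
begin

definition complete_wrt :: "'x set \<Rightarrow> ('x \<Rightarrow> 'x \<Rightarrow> real) \<Rightarrow> bool" where
  "complete_wrt S d \<longleftrightarrow>
     (\<forall>f. (\<forall>m. f m \<in> S) \<longrightarrow>
          (\<forall>\<epsilon>>0. \<exists>N. \<forall>m\<ge>N. \<forall>n\<ge>N. d (f m) (f n) < \<epsilon>) \<longrightarrow>
          (\<exists>x\<in>S. (\<lambda>m. d (f m) x) \<longlonglongrightarrow> 0))"

definition closed_in_wrt :: "'x set \<Rightarrow> 'x set \<Rightarrow> ('x \<Rightarrow> 'x \<Rightarrow> real) \<Rightarrow> bool" where
  "closed_in_wrt S T d \<longleftrightarrow>
     (\<forall>f x. (\<forall>m. f m \<in> S) \<longrightarrow> x \<in> T \<longrightarrow> (\<lambda>m. d (f m) x) \<longlonglongrightarrow> 0 \<longrightarrow> x \<in> S)"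

definition complex_algebra :: "(complex \<Rightarrow> 'b::ring \<Rightarrow> 'b) \<Rightarrow> bool" where
  "complex_algebra sm \<longleftrightarrow>
     (\<forall>c x y. sm c (x + y) = sm c x + sm c y) \<and>
     (\<forall>c d x. sm (c + d) x = sm c x + sm d x) \<and>
     (\<forall>c d x. sm c (sm d x) = sm (c * d) x) \<and>
     (\<forall>x. sm 1 x = x) \<and>
     (\<forall>c x y. sm c (x * y) = sm c x * y) \<and>
     (\<forall>c x y. sm c (x * y) = x * sm c y)"

definition is_norm_on :: "'b::ring set \<Rightarrow> (complex \<Rightarrow> 'b \<Rightarrow> 'b) \<Rightarrow> ('b \<Rightarrow> real) \<Rightarrow> bool" where
  "is_norm_on S sm n \<longleftrightarrow>
     (\<forall>x\<in>S. n x \<ge> 0) \<and> (\<forall>x\<in>S. n x = 0 \<longleftrightarrow> x = 0) \<and>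
     (\<forall>x\<in>S. \<forall>y\<in>S. n (x + y) \<le> n x + n y) \<and>
     (\<forall>c. \<forall>x\<in>S. n (sm c x) = cmod c * n x)"

definition involution_on :: "'b::ring set \<Rightarrow> (complex \<Rightarrow> 'b \<Rightarrow> 'b) \<Rightarrow> ('b \<Rightarrow> 'b) \<Rightarrow> bool" where
  "involution_on S sm st \<longleftrightarrow>
     (\<forall>x\<in>S. \<forall>y\<in>S. st (x + y) = st x + st y) \<and>
     (\<forall>c. \<forall>x\<in>S. st (sm c x) = sm (cnj c) (st x)) \<and>
     (\<forall>x\<in>S. \<forall>y\<in>S. st (x * y) = st y * st x) \<and>
     (\<forall>x\<in>S. st (st x) = x)"

definition cstar_algebra :: "(complex \<Rightarrow> 'b::ring \<Rightarrow> 'b) \<Rightarrow> ('b \<Rightarrow> 'b) \<Rightarrow> ('b \<Rightarrow> real) \<Rightarrow> bool" where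
  "cstar_algebra sm st nB \<longleftrightarrow>
     complex_algebra sm \<and>
     is_norm_on UNIV sm nB \<and>
     (\<forall>x y. nB (x * y) \<le> nB x * nB y) \<and>
     complete_wrt UNIV (\<lambda>x y. nB (x - y)) \<and>
     involution_on UNIV sm st \<and>
     (\<forall>x. nB (st x * x) = nB x ^ 2)"

definition star_subalgebra :: "'b::ring set \<Rightarrow> (complex \<Rightarrow> 'b \<Rightarrow> 'b) \<Rightarrow> ('b \<Rightarrow> 'b) \<Rightarrow> bool" where
  "star_subalgebra A sm st \<longleftrightarrow>
     0 \<in> A \<and> (\<forall>x\<in>A. \<forall>y\<in>A. x + y \<in> A \<and> x * y \<in> A) \<and>
     (\<forall>c. \<forall>x\<in>A. sm c x \<in> A) \<and> (\<forall>x\<in>A. st x \<in> A)"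

definition banach_star_algebra ::
  "'b::ring set \<Rightarrow> (complex \<Rightarrow> 'b \<Rightarrow> 'b) \<Rightarrow> ('b \<Rightarrow> 'b) \<Rightarrow> ('b \<Rightarrow> real) \<Rightarrow> bool" where
  "banach_star_algebra A sm st nA \<longleftrightarrow>
     star_subalgebra A sm st \<and>
     is_norm_on A sm nA \<and>
     (\<forall>x\<in>A. \<forall>y\<in>A. nA (x * y) \<le> nA x * nA y) \<and>
     complete_wrt A (\<lambda>x y. nA (x - y)) \<and>
     (\<exists>C. \<forall>x\<in>A. nA (st x) \<le> C * nA x)"

text \<open>Positive powers in a possibly non-unital ring: mpow a n = a^(n+1).\<close>
fun mpow :: "'b::ring \<Rightarrow> nat \<Rightarrow> 'b" where
  "mpow a 0 = a"
| "mpow a (Suc n) = a * mpow a n"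

definition differential_subalgebra ::
  "nat \<Rightarrow> real \<Rightarrow> real \<Rightarrow> 'b::ring set \<Rightarrow> (complex \<Rightarrow> 'b \<Rightarrow> 'b) \<Rightarrow> ('b \<Rightarrow> 'b)
     \<Rightarrow> ('b \<Rightarrow> real) \<Rightarrow> ('b \<Rightarrow> real) \<Rightarrow> bool" where
  "differential_subalgebra k p q A sm st nA nB \<longleftrightarrow>
     cstar_algebra sm st nB \<and>
     banach_star_algebra A sm st nA \<and>
     k \<ge> 2 \<and> p > 0 \<and> q > 0 \<and> p + q = real k \<and>
     (\<exists>C>0. \<forall>a\<in>A. nA (mpow a (k - 1)) \<le> C * nA a powr p * nB a powr q)"

definition sa_bounded_approx_identity ::
  "'b::ring set \<Rightarrow> ('b \<Rightarrow> 'b) \<Rightarrow> ('b \<Rightarrow> real) \<Rightarrow> 'i set \<Rightarrow> ('i \<Rightarrow> 'i \<Rightarrow> bool) \<Rightarrow> ('i \<Rightarrow> 'b) \<Rightarrow> bool" where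
  "sa_bounded_approx_identity A st nA D le e \<longleftrightarrow>
     D \<noteq> {} \<and>
     (\<forall>i\<in>D. le i i) \<and>
     (\<forall>i\<in>D. \<forall>j\<in>D. \<forall>l\<in>D. le i j \<longrightarrow> le j l \<longrightarrow> le i l) \<and>
     (\<forall>i\<in>D. \<forall>j\<in>D. \<exists>l\<in>D. le i l \<and> le j l) \<and>
     (\<forall>i\<in>D. e i \<in> A \<and> st (e i) = e i) \<and>
     (\<exists>M. \<forall>i\<in>D. nA (e i) \<le> M) \<and>
     (\<forall>a\<in>A. \<forall>\<epsilon>>0. \<exists>i0\<in>D. \<forall>i\<in>D. le i0 i \<longrightarrow>
         nA (e i * a - a) < \<epsilon> \<and> nA (a * e i - a) < \<epsilon>)"

definition closed_ideal :: "'b::ring set \<Rightarrow> 'b set \<Rightarrow> (complex \<Rightarrow> 'b \<Rightarrow> 'b) \<Rightarrow> ('b \<Rightarrow> real) \<Rightarrow> bool" where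
  "closed_ideal I A sm nA \<longleftrightarrow>
     I \<subseteq> A \<and> 0 \<in> I \<and>
     (\<forall>x\<in>I. \<forall>y\<in>I. x + y \<in> I) \<and> (\<forall>c. \<forall>x\<in>I. sm c x \<in> I) \<and>
     (\<forall>a\<in>A. \<forall>x\<in>I. a * x \<in> I \<and> x * a \<in> I) \<and>
     closed_in_wrt I A (\<lambda>x y. nA (x - y))"

definition hnorm :: "('h \<Rightarrow> 'h \<Rightarrow> complex) \<Rightarrow> 'h \<Rightarrow> real" where
  "hnorm ip x = sqrt (Re (ip x x))"

definition hdist :: "('h \<Rightarrow> 'h \<Rightarrow> 'h) \<Rightarrow> (complex \<Rightarrow> 'h \<Rightarrow> 'h) \<Rightarrow> ('h \<Rightarrow> 'h \<Rightarrow> complex) \<Rightarrow> 'h \<Rightarrow> 'h \<Rightarrow> real" where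
  "hdist ad hs ip x y = hnorm ip (ad x (hs (-1) y))"

definition hilbert_space ::
  "'h set \<Rightarrow> ('h \<Rightarrow> 'h \<Rightarrow> 'h) \<Rightarrow> 'h \<Rightarrow> (complex \<Rightarrow> 'h \<Rightarrow> 'h) \<Rightarrow> ('h \<Rightarrow> 'h \<Rightarrow> complex) \<Rightarrow> bool" where
  "hilbert_space H ad z hs ip \<longleftrightarrow>
     z \<in> H \<and> (\<forall>x\<in>H. \<forall>y\<in>H. ad x y \<in> H) \<and> (\<forall>c. \<forall>x\<in>H. hs c x \<in> H) \<and>
     (\<forall>x\<in>H. \<forall>y\<in>H. \<forall>w\<in>H. ad (ad x y) w = ad x (ad y w)) \<and>
     (\<forall>x\<in>H. \<forall>y\<in>H. ad x y = ad y x) \<and>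
     (\<forall>x\<in>H. ad z x = x) \<and>
     (\<forall>x\<in>H. ad x (hs (-1) x) = z) \<and>
     (\<forall>c. \<forall>x\<in>H. \<forall>y\<in>H. hs c (ad x y) = ad (hs c x) (hs c y)) \<and>
     (\<forall>c d. \<forall>x\<in>H. hs (c + d) x = ad (hs c x) (hs d x)) \<and>
     (\<forall>c d. \<forall>x\<in>H. hs c (hs d x) = hs (c * d) x) \<and>
     (\<forall>x\<in>H. hs 1 x = x) \<and>
     (\<forall>x\<in>H. \<forall>y\<in>H. ip x y = cnj (ip y x)) \<and>
     (\<forall>x\<in>H. \<forall>y\<in>H. \<forall>w\<in>H. ip (ad x y) w = ip x w + ip y w) \<and>
     (\<forall>c. \<forall>x\<in>H. \<forall>y\<in>H. ip (hs c x) y = c * ip x y) \<and>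
     (\<forall>x\<in>H. Im (ip x x) = 0 \<and> Re (ip x x) \<ge> 0) \<and>
     (\<forall>x\<in>H. ip x x = 0 \<longrightarrow> x = z) \<and>
     complete_wrt H (hdist ad hs ip)"

definition star_representation ::
  "'b::ring set \<Rightarrow> (complex \<Rightarrow> 'b \<Rightarrow> 'b) \<Rightarrow> ('b \<Rightarrow> 'b) \<Rightarrow>
   'h set \<Rightarrow> ('h \<Rightarrow> 'h \<Rightarrow> 'h) \<Rightarrow> 'h \<Rightarrow> (complex \<Rightarrow> 'h \<Rightarrow> 'h) \<Rightarrow> ('h \<Rightarrow> 'h \<Rightarrow> complex) \<Rightarrow>
   ('b \<Rightarrow> 'h \<Rightarrow> 'h) \<Rightarrow> bool" where
  "star_representation A sm st H ad z hs ip Pi \<longleftrightarrow>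
     hilbert_space H ad z hs ip \<and>
     (\<forall>a\<in>A. \<forall>x\<in>H. Pi a x \<in> H) \<and>
     (\<forall>a\<in>A. \<forall>x\<in>H. \<forall>y\<in>H. Pi a (ad x y) = ad (Pi a x) (Pi a y)) \<and>
     (\<forall>a\<in>A. \<forall>c. \<forall>x\<in>H. Pi a (hs c x) = hs c (Pi a x)) \<and>
     (\<forall>a\<in>A. \<exists>M. \<forall>x\<in>H. hnorm ip (Pi a x) \<le> M * hnorm ip x) \<and>
     (\<forall>a\<in>A. \<forall>b\<in>A. \<forall>x\<in>H. Pi (a + b) x = ad (Pi a x) (Pi b x)) \<and>
     (\<forall>a\<in>A. \<forall>c. \<forall>x\<in>H. Pi (sm c a) x = hs c (Pi a x)) \<and>
     (\<forall>a\<in>A. \<forall>b\<in>A. \<forall>x\<in>H. Pi (a * b) x = Pi a (Pi b x)) \<and>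
     (\<forall>a\<in>A. \<forall>x\<in>H. \<forall>y\<in>H. ip (Pi (st a) x) y = ip x (Pi a y))"

definition closed_subspace ::
  "'h set \<Rightarrow> 'h set \<Rightarrow> ('h \<Rightarrow> 'h \<Rightarrow> 'h) \<Rightarrow> 'h \<Rightarrow> (complex \<Rightarrow> 'h \<Rightarrow> 'h) \<Rightarrow> ('h \<Rightarrow> 'h \<Rightarrow> complex) \<Rightarrow> bool" where
  "closed_subspace K H ad z hs ip \<longleftrightarrow>
     K \<subseteq> H \<and> z \<in> K \<and> (\<forall>x\<in>K. \<forall>y\<in>K. ad x y \<in> K) \<and> (\<forall>c. \<forall>x\<in>K. hs c x \<in> K) \<and>
     closed_in_wrt K H (hdist ad hs ip)"

definition top_irreducible_rep ::
  "'b::ring set \<Rightarrow> (complex \<Rightarrow> 'b \<Rightarrow> 'b) \<Rightarrow> ('b \<Rightarrow> 'b) \<Rightarrow>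
   'h set \<Rightarrow> ('h \<Rightarrow> 'h \<Rightarrow> 'h) \<Rightarrow> 'h \<Rightarrow> (complex \<Rightarrow> 'h \<Rightarrow> 'h) \<Rightarrow> ('h \<Rightarrow> 'h \<Rightarrow> complex) \<Rightarrow>
   ('b \<Rightarrow> 'h \<Rightarrow> 'h) \<Rightarrow> bool" where
  "top_irreducible_rep A sm st H ad z hs ip Pi \<longleftrightarrow>
     star_representation A sm st H ad z hs ip Pi \<and>
     (\<exists>a\<in>A. \<exists>x\<in>H. Pi a x \<noteq> z) \<and>
     (\<forall>K. closed_subspace K H ad z hs ip \<longrightarrow> (\<forall>a\<in>A. \<forall>x\<in>K. Pi a x \<in> K) \<longrightarrow>
          K = {z} \<or> K = H)"

definition wiener_property ::
  "'b::ring set \<Rightarrow> (complex \<Rightarrow> 'b \<Rightarrow> 'b) \<Rightarrow> ('b \<Rightarrow> 'b) \<Rightarrow> ('b \<Rightarrow> real) \<Rightarrow> bool" where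
  "wiener_property A sm st nA \<longleftrightarrow>
     (\<forall>I. closed_ideal I A sm nA \<longrightarrow> I \<noteq> A \<longrightarrow>
        (\<exists>(H :: 'b set set) ad z hs ip Pi.
            top_irreducible_rep A sm st H ad z hs ip Pi \<and>
            (\<forall>x\<in>I. \<forall>v\<in>H. Pi x v = z)))"

end

theory Submission
  imports
    Defs
    "HOL-Library.Function_Algebras"
    "HOL-Computational_Algebra.Formal_Power_Series"
    "HOL-Real_Asymp.Real_Asymp"
    "HOL-Analysis.Summation_Tests"
begin

text \<open>Let \<open>I\<close> be a proper closed ideal and let \<open>S\<close> be the unitization of \<open>A\<close> with the \<open>C\<^sup>*\<close>-norm \<open>N\<close> of \<open>B\<close>. The differential
  inequality makes the powers of any \<open>x\<close> with \<open>N x \<le> 1\<close> grow at most like \<open>exp (E n^\<beta>)\<close> for some \<open>\<beta> < 1\<close>. Hence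
  the spectral radius in \<open>S\<close> is at most \<open>N\<close>, and \<open>S\<close> contains the inverses and square roots that
  the theory of positive elements needs, although it is not complete in \<open>N\<close>. The subexponential growth
  also allows \<open>f = \<Sum>n. c n * w^n\<close> for the unitary Cayley transform \<open>w\<close> of a member \<open>e\<close> of the approximate
  identity, where \<open>c\<close> are Fourier coefficients of a measure carried by a small neighbourhood of the point
  corresponding to \<open>e = 1\<close>; and \<open>f b\<close> tends to a nonzero multiple of \<open>b\<close> along the approximate identity. If
  \<open>f b \<notin> I\<close>, some \<open>v \<in> A\<close> close to \<open>1\<close> on the support of \<open>f\<close> satisfies \<open>N (v + t + y) \<ge> c + t\<close> for all \<open>t \<ge> 0\<close>
  and \<open>y \<in> I\<close>, with \<open>c > 0\<close>. So there is an extreme state vanishing on \<open>I\<close> but not on \<open>v\<close>, and its GNS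
  representation is the required one.\<close>

section \<open>Pre-C*-algebras closed under square roots\<close>

text \<open>The obstacle is that \<open>I\<close> is closed in the norm of \<open>A\<close>, but its
  closure in \<open>N\<close> could a priori contain all of \<open>A\<close>; the representations
  built here are bounded by \<open>N\<close>, so they kill that closure along with \<open>I\<close>.
  Nor does properness of \<open>I\<close> help in the unitization: the character sending
  \<open>c + a\<close> to \<open>c\<close> always kills \<open>I\<close> and is zero on
  \<open>A\<close>. A state must therefore be detected on some \<open>v\<close> in \<open>A\<close>.
  Asking for the lower bound at all \<open>t\<close>, and not just at \<open>t = 0\<close>, makes
  the resulting functional unital, hence positive. The exponent \<open>\<beta>\<close> is
  \<open>ln s / ln k\<close>: a bound of the norm of \<open>x^k\<close> by the \<open>s\<close>-th
  power of the norm of \<open>x\<close>, with \<open>s < k\<close>, is iterated along the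
  base-\<open>k\<close> digits of \<open>n\<close>. The weights \<open>exp (E n^\<beta>)\<close>
  with \<open>\<beta> < 1\<close> are non-quasianalytic, so sequences exist that beat them and still
  are Fourier coefficients of a measure on a short arc. At \<open>\<beta> = 1\<close> such a decay
  would force analyticity and no localization would be possible.\<close>

locale star_scalars =
  fixes S :: "'u::ring_1 set" and \<iota> :: "complex \<Rightarrow> 'u" and star :: "'u \<Rightarrow> 'u"
  assumes add_closed [simp, intro]: "x \<in> S \<Longrightarrow> y \<in> S \<Longrightarrow> x + y \<in> S"
    and mult_closed [simp, intro]: "x \<in> S \<Longrightarrow> y \<in> S \<Longrightarrow> x * y \<in> S"
    and iota_closed [simp, intro]: "\<iota> c \<in> S"
    and star_closed [simp, intro]: "x \<in> S \<Longrightarrow> star x \<in> S"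
    and iota_add: "\<iota> (c + d) = \<iota> c + \<iota> d"
    and iota_mult: "\<iota> (c * d) = \<iota> c * \<iota> d"
    and iota_one [simp]: "\<iota> 1 = 1"
    and iota_comm: "x \<in> S \<Longrightarrow> x * \<iota> c = \<iota> c * x"
    and star_add [simp]: "x \<in> S \<Longrightarrow> y \<in> S \<Longrightarrow> star (x + y) = star x + star y"
    and star_mult [simp]: "x \<in> S \<Longrightarrow> y \<in> S \<Longrightarrow> star (x * y) = star y * star x"
    and star_star [simp]: "x \<in> S \<Longrightarrow> star (star x) = x"
    and star_iota [simp]: "star (\<iota> c) = \<iota> (cnj c)"
begin

definition R :: "real \<Rightarrow> 'u" where "R t = \<iota> (of_real t)"

lemma R_closed [simp, intro]: "R t \<in> S"
  by (simp add: R_def)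

lemma iota_zero [simp]: "\<iota> 0 = 0"
  using iota_add[of 0 0] by simp

lemma iota_minus: "\<iota> (- c) = - \<iota> c"
  using iota_add[of c "- c"] by (simp add: eq_neg_iff_add_eq_0 add.commute)

lemma iota_diff: "\<iota> (c - d) = \<iota> c - \<iota> d"
  using iota_add[of c "- d"] by (simp add: iota_minus)

lemma one_closed [simp, intro]: "1 \<in> S"
  by (metis iota_closed iota_one)

lemma zero_closed [simp, intro]: "0 \<in> S"
  by (metis iota_closed iota_zero)

lemma uminus_closed [simp, intro]: "x \<in> S \<Longrightarrow> - x \<in> S"
  using mult_closed[of "\<iota> (- 1)" x] iota_closed[of "- 1"] by (simp only: iota_minus) simp

lemma diff_closed [simp, intro]: "x \<in> S \<Longrightarrow> y \<in> S \<Longrightarrow> x - y \<in> S"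
  using add_closed[of x "- y"] by simp

lemma power_closed [simp, intro]: "x \<in> S \<Longrightarrow> x ^ n \<in> S"
  by (induction n) auto

lemma sum_closed [intro]: "(\<And>i. i \<in> B \<Longrightarrow> f i \<in> S) \<Longrightarrow> sum f B \<in> S"
  by (induction B rule: infinite_finite_induct) auto

lemma star_one [simp]: "star 1 = 1"
  using star_iota[of 1] by simp

lemma star_zero [simp]: "star 0 = 0"
  using star_iota[of 0] by simp

lemma star_uminus [simp]: "x \<in> S \<Longrightarrow> star (- x) = - star x"
  using star_mult[of "\<iota> (- 1)" x] star_iota[of "- 1"] by (simp add: iota_minus del: star_iota)

lemma star_diff [simp]: "x \<in> S \<Longrightarrow> y \<in> S \<Longrightarrow> star (x - y) = star x - star y"
  using star_add[of x "- y"] by simp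

lemma star_power: "x \<in> S \<Longrightarrow> star (x ^ n) = star x ^ n"
  by (induction n) (auto simp: power_commutes)

lemma iota_left_comm: "x \<in> S \<Longrightarrow> x * (\<iota> c * y) = \<iota> c * (x * y)"
  by (metis iota_comm mult.assoc)

lemma iota_left_mult: "\<iota> c * (\<iota> d * x) = \<iota> (c * d) * x"
  by (simp add: iota_mult mult.assoc)

lemma iota_iota: "\<iota> c * \<iota> d = \<iota> (c * d)"
  by (simp add: iota_mult)

lemmas iota_simps = iota_left_mult iota_iota

lemma iota_cancel: "c \<noteq> 0 \<Longrightarrow> \<iota> (inverse c) * (\<iota> c * x) = x"
  by (simp add: iota_left_mult)

lemma R_add: "R (a + b) = R a + R b"
  by (simp add: R_def iota_add)

lemma R_diff: "R (a - b) = R a - R b"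
  by (simp add: R_def iota_diff)

lemma R_minus: "R (- a) = - R a"
  by (simp add: R_def iota_minus)

lemma R_zero [simp]: "R 0 = 0" and R_one [simp]: "R 1 = 1"
  by (simp_all add: R_def)

lemma R_mult: "R (a * b) = R a * R b"
  by (simp add: R_def iota_mult)

lemma R_R: "R a * R b = R (a * b)" "R a * (R b * x) = R (a * b) * x"
  by (simp_all add: R_mult mult.assoc)

lemma star_R [simp]: "star (R t) = R t"
  by (simp add: R_def)

lemma central:
  assumes "x \<in> S"
  shows "x * \<iota> c = \<iota> c * x" "x * (\<iota> c * y) = \<iota> c * (x * y)"
    and "x * R t = R t * x" "x * (R t * y) = R t * (x * y)"
  using assms by (simp_all add: R_def iota_comm iota_left_comm)

definition sa :: "'u \<Rightarrow> bool" where
  "sa x \<longleftrightarrow> x \<in> S \<and> star x = x"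

lemma sa_closed: "sa x \<Longrightarrow> x \<in> S"
  by (simp add: sa_def)

lemma sa_add [intro]: "sa x \<Longrightarrow> sa y \<Longrightarrow> sa (x + y)"
  and sa_diff [intro]: "sa x \<Longrightarrow> sa y \<Longrightarrow> sa (x - y)"
  and sa_R [simp, intro]: "sa (R t)"
  and sa_one [simp, intro]: "sa 1"
  and sa_scale [intro]: "sa x \<Longrightarrow> sa (R t * x)"
  and sa_sq [intro]: "sa x \<Longrightarrow> sa (x * x)"
  and sa_star_mult [intro]: "z \<in> S \<Longrightarrow> sa (star z * z)"
  and sa_mult_star [intro]: "z \<in> S \<Longrightarrow> sa (z * star z)"
  by (auto simp: sa_def central)

lemma sa_mult: "sa x \<Longrightarrow> sa y \<Longrightarrow> x * y = y * x \<Longrightarrow> sa (x * y)"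
  by (auto simp: sa_def)

lemma sa_inverse:
  assumes "sa w" "v \<in> S" "v * w = 1" "w * v = 1"
  shows "sa v"
proof -
  have "star v * w = 1"
    using assms star_mult[of w v] by (simp add: sa_def)
  then have "star v = v"
    using assms by (metis mult.assoc mult_1_left mult_1_right)
  with assms show ?thesis by (simp add: sa_def)
qed

end

text \<open>The last two axioms stand in for completeness of \<open>N\<close> and are the whole
  functional calculus of this theory. The clause on commuting elements in \<open>square_root\<close>
  makes roots of commuting elements commute, so that a product of two commuting positive elements
  can be written as a square.\<close>

locale spectral_cstar = star_scalars S \<iota> star
  for S :: "'u::ring_1 set" and \<iota> :: "complex \<Rightarrow> 'u" and star :: "'u \<Rightarrow> 'u" +
  fixes N :: "'u \<Rightarrow> real"
  assumes N_nonneg [simp]: "x \<in> S \<Longrightarrow> 0 \<le> N x"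
    and N_triangle: "x \<in> S \<Longrightarrow> y \<in> S \<Longrightarrow> N (x + y) \<le> N x + N y"
    and N_mult: "x \<in> S \<Longrightarrow> y \<in> S \<Longrightarrow> N (x * y) \<le> N x * N y"
    and N_iota [simp]: "N (\<iota> c) = cmod c"
    and N_cstar: "x \<in> S \<Longrightarrow> N (star x * x) = N x ^ 2"
    and invertible: "x \<in> S \<Longrightarrow> N x < 1 \<Longrightarrow> \<exists>v\<in>S. v * (1 - x) = 1 \<and> (1 - x) * v = 1"
    and square_root: "x \<in> S \<Longrightarrow> star x = x \<Longrightarrow> N x < 1 \<Longrightarrow>
       \<exists>s\<in>S. star s = s \<and> s * s = 1 - x \<and> (\<forall>z\<in>S. z * x = x * z \<longrightarrow> z * s = s * z)"
begin

lemma N_scale: assumes "x \<in> S" shows "N (\<iota> c * x) = cmod c * N x"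
proof (cases "c = 0")
  case True
  then show ?thesis using N_iota[of 0] by simp
next
  case False
  have "N x = N (\<iota> (inverse c) * (\<iota> c * x))" using False by (simp add: iota_cancel)
  also have "\<dots> \<le> cmod (inverse c) * N (\<iota> c * x)"
    using N_mult[of "\<iota> (inverse c)" "\<iota> c * x"] assms by simp
  finally have "cmod c * N x \<le> N (\<iota> c * x)"
    using False by (simp add: norm_inverse norm_divide divide_simps mult.commute)
  moreover have "N (\<iota> c * x) \<le> cmod c * N x"
    using N_mult[of "\<iota> c" x] assms by simp
  ultimately show ?thesis by simp
qed

lemma N_R [simp]: "N (R t) = \<bar>t\<bar>"
  by (simp add: R_def)

lemma N_scaleR: "x \<in> S \<Longrightarrow> N (R t * x) = \<bar>t\<bar> * N x"
  by (simp add: R_def N_scale)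

lemma N_one [simp]: "N 1 = 1"
  using N_iota[of 1] by simp

lemma N_uminus [simp]: "x \<in> S \<Longrightarrow> N (- x) = N x"
  using N_scale[of x "-1"] by (simp add: iota_minus)

lemma N_diff: "x \<in> S \<Longrightarrow> y \<in> S \<Longrightarrow> N (x - y) \<le> N x + N y"
  using N_triangle[of x "- y"] by simp

lemma N_star_le: assumes "x \<in> S" shows "N x \<le> N (star x)"
proof (cases "N x = 0")
  case True then show ?thesis using assms by simp
next
  case False
  have "N x * N x \<le> N (star x) * N x"
    using N_cstar[OF assms] N_mult[of "star x" x] assms by (simp add: power2_eq_square)
  then show ?thesis using False N_nonneg[OF assms] by (simp add: mult_le_cancel_right)
qed

lemma N_star [simp]: "x \<in> S \<Longrightarrow> N (star x) = N x"
  using N_star_le[of x] N_star_le[of "star x"] by simp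

lemma N_sq: "sa x \<Longrightarrow> N (x * x) = N x ^ 2"
  using N_cstar by (metis sa_def)

text \<open>For a self-adjoint element of a C*-algebra this says that the spectrum lies in
  \<open>[0, 2 t]\<close>. Stating it through the norm avoids spectra and turns
  \<open>pos_add\<close> into a triangle inequality, because the radii \<open>t\<close> add
  up.\<close>

definition pos :: "'u \<Rightarrow> bool" where
  "pos h \<longleftrightarrow> sa h \<and> (\<exists>t\<ge>0. N (R t - h) \<le> t)"

lemma pos_sa: "pos h \<Longrightarrow> sa h"
  by (simp add: pos_def)

lemma pos_closedS: "pos h \<Longrightarrow> h \<in> S"
  by (simp add: pos_def sa_def)

lemma posI: "sa h \<Longrightarrow> t \<ge> 0 \<Longrightarrow> N (R t - h) \<le> t \<Longrightarrow> pos h"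
  by (auto simp: pos_def)

lemma pos_add [intro]: assumes "pos g" "pos h" shows "pos (g + h)"
proof -
  from assms obtain t u where t: "t \<ge> 0" "N (R t - g) \<le> t" and u: "u \<ge> 0" "N (R u - h) \<le> u"
    by (auto simp: pos_def)
  have eq: "R (t + u) - (g + h) = (R t - g) + (R u - h)" by (simp add: R_add)
  have "N (R (t + u) - (g + h)) \<le> N (R t - g) + N (R u - h)"
    unfolding eq using assms by (intro N_triangle) (auto simp: pos_closedS)
  then have "N (R (t + u) - (g + h)) \<le> t + u" using t u by simp
  then show ?thesis using assms t u by (intro posI[of _ "t + u"]) (auto dest: pos_sa)
qed

lemma pos_scale: assumes "pos h" "r \<ge> 0" shows "pos (R r * h)"
proof -
  from assms obtain t where t: "t \<ge> 0" "N (R t - h) \<le> t" by (auto simp: pos_def)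
  have "R (r * t) - R r * h = R r * (R t - h)" by (simp add: R_mult algebra_simps)
  then have "N (R (r * t) - R r * h) = r * N (R t - h)"
    using assms by (simp add: N_scaleR pos_closedS)
  also have "\<dots> \<le> r * t" using t assms by (simp add: mult_left_mono)
  finally show ?thesis using assms t by (intro posI[of _ "r * t"]) (auto dest: pos_sa)
qed

lemma pos_R [simp, intro]: "r \<ge> 0 \<Longrightarrow> pos (R r)"
  by (rule posI[of _ r]) (use N_iota[of 0] in auto)

lemma pos_R_minus: "sa h \<Longrightarrow> N h \<le> m \<Longrightarrow> pos (R m - h)"
  using N_nonneg[OF sa_closed, of h] by (intro posI[of _ m]) (auto dest: sa_closed)

lemma pos_R_plus: "sa h \<Longrightarrow> N h \<le> m \<Longrightarrow> pos (R m + h)"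
  using N_nonneg[OF sa_closed, of h] by (intro posI[of _ m]) (auto dest: sa_closed)

lemma pos_inverse:
  assumes "sa w" "\<eta> > 0" "pos (w - R \<eta>)"
  shows "\<exists>v\<in>S. v * w = 1 \<and> w * v = 1 \<and> N v \<le> 1 / \<eta>"
proof -
  from assms obtain t where t: "t \<ge> 0" "N (R t - (w - R \<eta>)) \<le> t" by (auto simp: pos_def)
  define T where "T = t + \<eta>"
  have T: "T > 0" using t assms by (simp add: T_def)
  have w: "w \<in> S" using assms sa_closed by simp
  define y where "y = R (1 / T) * (R T - w)"
  have yS: "y \<in> S" using w by (simp add: y_def)
  have eq: "R T - w = R t - (w - R \<eta>)" by (simp add: T_def R_add)
  have "N y = 1 / T * N (R t - (w - R \<eta>))"
    using T w by (simp only: y_def eq) (subst N_scaleR; simp)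
  then have Ny: "N y \<le> t / T" using t T by (simp add: divide_right_mono)
  have y1: "1 - y = R (1 / T) * w"
    using T by (simp add: y_def right_diff_distrib R_R)
  have "N y < 1" using Ny T assms(2) by (simp add: T_def) (smt (verit) divide_less_eq_1)
  from invertible[OF yS this] obtain v where v: "v \<in> S" "v * (1 - y) = 1" "(1 - y) * v = 1" by auto
  \<comment> \<open>The norm bound comes from this fixed-point equation: it gives
    \<open>N v * (1 - t / T) \<le> 1\<close>, and \<open>1 - t / T = \<eta> / T\<close>.\<close>
  have "v = 1 + y * v" using v(3) by (simp add: algebra_simps)
  then have "N v \<le> 1 + N y * N v"
    using N_triangle[of 1 "y * v"] N_mult[of y v] v yS by simp
  also have "\<dots> \<le> 1 + t / T * N v" using mult_right_mono[OF Ny N_nonneg[OF v(1)]] by simp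
  finally have Nv: "N v \<le> T / \<eta>" using T assms(2) by (simp add: field_simps T_def)
  define v' where "v' = R (1 / T) * v"
  have "v' * w = 1" using v(2) y1 by (simp add: v'_def central[OF v(1)] mult.assoc)
  moreover have "w * v' = 1" using v(3) y1 by (simp add: v'_def central[OF w] mult.assoc)
  moreover have "N v' \<le> 1 / \<eta>"
    using Nv T v(1) by (simp add: v'_def N_scaleR field_simps)
  moreover have "v' \<in> S" using v by (simp add: v'_def)
  ultimately show ?thesis by blast
qed

text \<open>The gap \<open>\<eta>\<close> keeps the rescaled element \<open>y\<close> strictly
  inside the unit ball, as the axiom \<open>square_root\<close> demands; \<open>pos_limit\<close>
  later removes such gaps.\<close>

lemma pos_square_root:
  assumes "pos w" "\<eta> > 0"
  shows "\<exists>u. sa u \<and> u * u = w + R \<eta> \<and> (\<forall>z\<in>S. z * w = w * z \<longrightarrow> z * u = u * z)"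
proof -
  from assms obtain t where t: "t \<ge> 0" "N (R t - w) \<le> t" by (auto simp: pos_def)
  define T where "T = t + \<eta>"
  have T: "T > 0" using t assms by (simp add: T_def)
  have w: "sa w" "w \<in> S" using assms pos_sa sa_closed by auto
  define y where "y = R (1 / T) * (R t - w)"
  have yS: "y \<in> S" "sa y" using w by (auto simp: y_def)
  have "N y = 1 / T * N (R t - w)"
    using T w by (simp only: y_def) (subst N_scaleR; simp)
  then have Ny: "N y \<le> t / T" using t T by (simp add: divide_right_mono)
  have y1: "1 - y = R (1 / T) * (w + R \<eta>)"
  proof -
    have "R (1 / T) * R T = 1" using T by (simp add: R_R)
    then have "1 - y = R (1 / T) * R T - R (1 / T) * (R t - w)" by (simp add: y_def)
    also have "\<dots> = R (1 / T) * (w + R \<eta>)"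
      by (simp add: T_def R_add algebra_simps)
    finally show ?thesis .
  qed
  have "N y < 1" using Ny T assms(2) by (simp add: T_def) (smt (verit) divide_less_eq_1)
  moreover have "star y = y" using yS by (simp add: sa_def)
  ultimately obtain s where s: "s \<in> S" "star s = s" "s * s = 1 - y"
    "\<And>z. z \<in> S \<Longrightarrow> z * y = y * z \<Longrightarrow> z * s = s * z"
    using square_root[OF yS(1)] by blast
  define u where "u = R (sqrt T) * s"
  have "sa u" using s by (simp add: u_def sa_def central[OF s(1)])
  moreover have "u * u = w + R \<eta>"
  proof -
    have "u * u = R (sqrt T * sqrt T) * (s * s)"
      by (simp add: u_def central[OF s(1)] iota_simps R_R mult.assoc)
    also have "\<dots> = w + R \<eta>" using T w
      by (simp only: s y1 R_R) simp
    finally show ?thesis .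
  qed
  moreover have "z * u = u * z" if z: "z \<in> S" "z * w = w * z" for z
  proof -
    have "z * y = y * z" using z(2)
      by (simp add: y_def central[OF z(1)] iota_simps R_R mult.assoc right_diff_distrib left_diff_distrib)
    from s(4)[OF z(1) this] show ?thesis
      by (simp add: u_def central[OF z(1)] mult.assoc)
  qed
  ultimately show ?thesis by blast
qed

text \<open>With \<open>s\<close> a square root of \<open>1 - h * h\<close> commuting with
  \<open>h\<close>, the element \<open>u = h + i s\<close> satisfies \<open>star u * u = 1\<close>
  and has \<open>s\<close> as its imaginary part, so \<open>s\<close> has norm at most 1.\<close>

lemma sq_contractive:
  assumes "sa h" "N h < 1" shows "N (1 - h * h) \<le> 1"
proof -
  have h: "h \<in> S" "star h = h" using assms by (auto simp: sa_def)
  have "N (h * h) < 1" using N_sq[OF assms(1)] assms h by (simp add: power_less_one_iff abs_square_less_1)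
  moreover have "h * h \<in> S" "star (h * h) = h * h" using h by auto
  ultimately obtain s where s: "s \<in> S" "star s = s" "s * s = 1 - h * h"
    "\<And>z. z \<in> S \<Longrightarrow> z * (h * h) = h * h * z \<Longrightarrow> z * s = s * z"
    using square_root[of "h * h"] by blast
  have hs: "h * s = s * h" using s(4)[OF h(1)] by (simp add: mult.assoc)
  define u where "u = h + \<iota> \<i> * s"
  have uS: "u \<in> S" using h(1) s(1) by (simp add: u_def)
  have su: "star u = h - \<iota> \<i> * s" using h s(1,2) by (simp add: u_def iota_minus central[OF s(1)])
  have "star u * u = h * h + s * s"
    unfolding su unfolding u_def using hs by (simp add: distrib_left distrib_right left_diff_distrib central[OF h(1)] central[OF s(1)] iota_simps R_R iota_minus mult.assoc)
  then have "star u * u = 1" using s(3) by simp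
  then have Nu: "N u = 1" using N_cstar[OF uS] N_nonneg[OF uS]
    by (metis N_one power2_eq_1_iff neg_0_le_iff_le not_one_le_zero)
  have "u - star u = \<iota> (\<i> + \<i>) * s" unfolding su unfolding u_def iota_add by (simp add: algebra_simps)
  then have "cmod (2 * \<i>) * N s \<le> N u + N (star u)"
    using N_diff[of u "star u"] uS s(1) N_scale[of s "\<i> + \<i>"] by simp
  then have "N s \<le> 1" using Nu uS by (simp add: norm_mult)
  then have "N (s * s) \<le> 1" using N_sq[of s] s(1,2) by (simp add: sa_def power_le_one)
  then show ?thesis using s(3) by simp
qed

lemma sq_R_minus:
  assumes "sa h" "N h ^ 2 \<le> T" shows "N (R T - h * h) \<le> T"
proof (rule field_le_epsilon)
  fix \<epsilon> :: real assume e: "\<epsilon> > 0"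
  have h: "h \<in> S" "star h = h" using assms by (auto simp: sa_def)
  \<comment> \<open>Half of \<open>\<epsilon>\<close> turns the weak bound on \<open>N h\<close>
    into the strict one that \<open>sq_contractive\<close> asks for; the other half pays for
    subtracting it again.\<close>
  define r where "r = sqrt (T + \<epsilon> / 2)"
  have T: "T \<ge> 0" using assms by (meson order_trans zero_le_power2)
  have r: "r > 0" "r * r = T + \<epsilon> / 2" using e T by (auto simp: r_def)
  have "N h ^ 2 < r ^ 2" using assms e r by (simp add: power2_eq_square)
  then have Nh: "N h < r" using r by (simp add: power_less_imp_less_base)
  define g where "g = R (1 / r) * h"
  have "sa g" using assms by (auto simp: g_def)
  moreover have "N g < 1" using Nh r h by (simp add: g_def N_scaleR field_simps)
  ultimately have g: "N (1 - g * g) \<le> 1" by (rule sq_contractive)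
  have gg: "g * g = R (1 / (r * r)) * (h * h)"
    by (simp add: g_def central[OF h(1)] iota_simps R_R mult.assoc)
  have "R (r * r) - h * h = R (r * r) * (1 - g * g)"
    using r(1) by (simp add: gg right_diff_distrib R_R)
  then have "N (R (r * r) - h * h) = r * r * N (1 - g * g)"
    using sa_closed[OF \<open>sa g\<close>] by (simp add: N_scaleR)
  also have "\<dots> \<le> r * r" using g by (simp add: mult_left_le)
  finally have "N (R (r * r) - h * h) \<le> r * r" .
  moreover have "R T - h * h = (R (r * r) - h * h) - R (\<epsilon> / 2)"
    unfolding r(2) R_add by simp
  moreover have "N (R (r * r) - h * h - R (\<epsilon> / 2)) \<le> N (R (r * r) - h * h) + \<epsilon> / 2"
    using N_diff[of "R (r * r) - h * h" "R (\<epsilon> / 2)"] h e by simp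
  ultimately show "N (R T - h * h) \<le> T + \<epsilon>"
    using r(2) by (simp only:)
qed

lemma pos_sq [intro]: "sa h \<Longrightarrow> pos (h * h)"
  by (rule posI[of _ "N h ^ 2"]) (auto intro: sq_R_minus)

text \<open>The radius in the definition of \<open>pos\<close> may depend on \<open>\<eta>\<close>,
  so no limit can be taken directly. Writing \<open>h + \<epsilon>\<close> as a square brings in
  \<open>sq_R_minus\<close>, whose radius is explicit, and in the limit the radius
  \<open>N h\<close> works.\<close>

lemma pos_limit:
  assumes "sa h" "\<And>\<eta>. \<eta> > 0 \<Longrightarrow> pos (h + R \<eta>)" shows "pos h"
proof -
  have h: "h \<in> S" using assms sa_closed by simp
  have "N (R (N h) - h) \<le> N h"
  proof (rule field_le_epsilon)
    fix \<epsilon> :: real assume e: "\<epsilon> > 0"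
    have e2: "\<epsilon> / 2 > 0" using e by simp
    obtain u where u: "sa u" "u * u = (h + R (\<epsilon> / 2)) + R (\<epsilon> / 2)"
      using pos_square_root[OF assms(2)[OF e2] e2] by blast
    then have uu: "u * u = h + R \<epsilon>" by (simp add: add.assoc flip: R_add)
    have "N (u * u) \<le> N h + \<epsilon>" using N_triangle[of h "R \<epsilon>"] h e by (simp add: uu)
    then have "N (R (N h + \<epsilon>) - u * u) \<le> N h + \<epsilon>"
      using u(1) N_sq[OF u(1)] by (intro sq_R_minus) simp_all
    moreover have "R (N h + \<epsilon>) - u * u = R (N h) - h" by (simp add: uu R_add)
    ultimately show "N (R (N h) - h) \<le> N h + \<epsilon>" by simp
  qed
  then show ?thesis using assms h by (intro posI[of _ "N h"]) auto
qed

text \<open>If \<open>u\<close> is the root of \<open>s + \<eta> - z * z\<close>, then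
  \<open>z + i u\<close> and \<open>z - i u\<close> both have norm \<open>sqrt (s + \<eta>)\<close>
  by the C*-identity, and \<open>z\<close> is their mean.\<close>

lemma pos_bound_norm:
  assumes "sa z" "s \<ge> 0" "pos (R s - z * z)" shows "N z ^ 2 \<le> s"
proof (rule field_le_epsilon)
  fix \<eta> :: real assume e: "\<eta> > 0"
  have z: "z \<in> S" "star z = z" using assms by (auto simp: sa_def)
  obtain u where u: "sa u" "u * u = (R s - z * z) + R \<eta>"
    "\<And>x. x \<in> S \<Longrightarrow> x * (R s - z * z) = (R s - z * z) * x \<Longrightarrow> x * u = u * x"
    using pos_square_root[OF assms(3) e] by blast
  have uS: "u \<in> S" "star u = u" using u by (auto simp: sa_def)
  have zu: "z * u = u * z"
    using z by (intro u(3)) (simp_all add: right_diff_distrib left_diff_distrib central[OF z(1)] mult.assoc)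
  have key: "N x ^ 2 = s + \<eta>" if "x = z + \<iota> c * u" "c = \<i> \<or> c = - \<i>" for x c
  proof -
    have "star x * x = z * z + u * u"
      using that(2) z uS zu
      by (auto simp: that(1) distrib_left distrib_right central[OF z(1)] central[OF uS(1)] iota_simps R_R iota_minus mult.assoc)
    also have "\<dots> = R (s + \<eta>)" using u by (simp add: R_add)
    finally show ?thesis using N_cstar[of x] that z uS assms e
      by (simp)
  qed
  define x where "x = z + \<iota> \<i> * u"
  define y where "y = z + \<iota> (- \<i>) * u"
  have "N x = sqrt (s + \<eta>)" "N y = sqrt (s + \<eta>)"
    using key[OF x_def] key[OF y_def] z uS N_nonneg[of x] N_nonneg[of y] x_def y_def
    by (metis add_closed iota_closed mult_closed real_sqrt_unique)+
  moreover have "x + y = R 2 * z"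
    using R_add[of 1 1] by (simp add: x_def y_def iota_minus mult_2)
  then have "2 * N z \<le> N x + N y"
    using N_triangle[of x y] z uS N_scaleR[of z 2] by (simp add: x_def y_def)
  ultimately have "N z \<le> sqrt (s + \<eta>)" by simp
  then have "N z ^ 2 \<le> (sqrt (s + \<eta>)) ^ 2" using z by (intro power_mono) auto
  then show "N z ^ 2 \<le> s + \<eta>" using assms e by simp
qed

text \<open>Formally \<open>w * (m - v) = m * w - 1\<close> is a product of commuting positive
  elements. Their roots \<open>u\<close> and \<open>s\<close> commute, and the product is the square
  of \<open>u * s\<close>.\<close>

lemma pos_inverse_lower:
  assumes w: "sa w" "\<eta> > 0" "pos (w - R \<eta>)" and v: "v \<in> S" "v * w = 1" "w * v = 1"
    and m: "N v \<le> m" "m > 0"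
  shows "pos (w - R (1 / m))"
proof (rule pos_limit)
  show "sa (w - R (1 / m))" using w by auto
  have wS: "w \<in> S" using w sa_closed by simp
  have sv: "sa v" using sa_inverse w v by blast
  fix \<delta> :: real assume d: "\<delta> > 0"
  \<comment> \<open>Working with \<open>m + \<epsilon>\<close> leaves an error
    \<open>\<epsilon> / m * w\<close>. It is at most \<open>\<epsilon> / m * (N w + 1)\<close>,
    which this choice makes equal to \<open>\<delta>\<close>.\<close>
  define \<epsilon> where "\<epsilon> = \<delta> * m / (N w + 1)"
  have Nw: "N w + 1 > 0" using N_nonneg[OF wS] by linarith
  have e: "\<epsilon> > 0" using d m Nw by (simp add: \<epsilon>_def)
  obtain u where u: "sa u" "u * u = (w - R \<eta>) + R \<eta>"
    "\<And>x. x \<in> S \<Longrightarrow> x * (w - R \<eta>) = (w - R \<eta>) * x \<Longrightarrow> x * u = u * x"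
    using pos_square_root[OF w(3) w(2)] by blast
  obtain s where s: "sa s" "s * s = (R m - v) + R \<epsilon>"
    "\<And>x. x \<in> S \<Longrightarrow> x * (R m - v) = (R m - v) * x \<Longrightarrow> x * s = s * x"
    using pos_square_root[OF pos_R_minus[OF sv m(1)] e] by blast
  have S: "u \<in> S" "s \<in> S" using u s sa_closed by auto
  have "v * u = u * v" using v wS by (intro u(3)) (simp_all add: right_diff_distrib left_diff_distrib central[OF v(1)])
  then have us: "u * s = s * u" using S v by (intro s(3)) (simp_all add: right_diff_distrib left_diff_distrib central[OF S(1)])
  have "pos ((u * s) * (u * s))" using sa_mult[OF u(1) s(1) us] by blast
  also have "(u * s) * (u * s) = (u * u) * (s * s)" by (metis us mult.assoc)
  also have "\<dots> = R (m + \<epsilon>) * w - 1"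
    using v(3) by (simp add: u s distrib_left right_diff_distrib distrib_right R_add central[OF wS])
  finally have "pos (R (1 / m) * (R (m + \<epsilon>) * w - 1))" using m by (intro pos_scale) auto
  moreover have "pos (R (\<epsilon> / m) * (R (N w + 1) - w))"
    using m e w by (intro pos_scale pos_R_minus) auto
  ultimately have "pos (R (1 / m) * (R (m + \<epsilon>) * w - 1) + R (\<epsilon> / m) * (R (N w + 1) - w))" by blast
  moreover have "R (1 / m) * (R (m + \<epsilon>) * w - 1) + R (\<epsilon> / m) * (R (N w + 1) - w)
      = w - R (1 / m) + R \<delta>"
  proof -
    have 1: "R (1 / m) * (R (m + \<epsilon>) * w) = R (1 / m * (m + \<epsilon>)) * w"
      by (simp only: R_R)
    have 2: "1 / m * (m + \<epsilon>) = 1 + \<epsilon> / m" using m by (simp add: field_simps)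
    have 3: "R (\<epsilon> / m) * R (N w + 1) = R \<delta>"
    proof -
      have "\<epsilon> / m * (N w + 1) = \<delta>" using m Nw by (simp add: \<epsilon>_def)
      then show ?thesis by (simp only: R_R)
    qed
    have "R (1 / m) * (R (m + \<epsilon>) * w) = w + R (\<epsilon> / m) * w"
      unfolding 1 2 by (simp add: R_add distrib_right)
    then show ?thesis by (simp only: right_diff_distrib 3) simp
  qed
  ultimately show "pos (w - R (1 / m) + R \<delta>)" by simp
qed

text \<open>If \<open>r\<close> inverts \<open>t - star x * x\<close>, then
  \<open>(1 + x * r * star x) / t\<close> inverts \<open>t - x * star x\<close>, with a norm bound
  that is uniform in \<open>t \<ge> t1 > s\<close>. Positivity of \<open>t - x * star x\<close> is
  clear for large \<open>t\<close> and descends to \<open>t1\<close> in steps of a fixed length;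
  this replaces the comparison of spectra.\<close>

lemma pos_swap:
  assumes x: "x \<in> S" and s: "s > 0" and p: "pos (R s - star x * x)"
  shows "pos (R s - x * star x)"
proof -
  have xs: "star x \<in> S" using x by simp
  have sa1: "sa (R s - x * star x)" for s using x by auto
  have main: "pos (R t1 - x * star x)" if t1: "t1 > s" for t1
  proof -
    define M where "M = (1 + N x ^ 2 / (t1 - s)) / t1"
    have M: "M > 0" using t1 s by (simp add: M_def add_pos_nonneg)
    have inv: "\<exists>v\<in>S. v * (R t - x * star x) = 1 \<and> (R t - x * star x) * v = 1 \<and> N v \<le> M"
      if t: "t \<ge> t1" for t
    proof -
      define w where "w = R t - star x * x"
      have "sa w" using x by (auto simp: w_def)
      moreover have "w - R (t - s) = R s - star x * x" by (simp add: w_def R_diff)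
      ultimately obtain r where r: "r \<in> S" "r * w = 1" "w * r = 1" "N r \<le> 1 / (t - s)"
        using pos_inverse[of w "t - s"] p t t1 by auto
      have t0: "t > 0" using t t1 s by simp
      have rt1: "r * (star x * x) = R t * r - 1" and rt2: "star x * x * r = R t * r - 1"
        using r(2,3) by (simp_all add: w_def algebra_simps central[OF r(1)])
      define v where "v = R (1 / t) * (1 + x * r * star x)"
      have vS: "v \<in> S" using x r by (simp add: v_def)
      have "(1 + x * r * star x) * (R t - x * star x)
          = R t + R t * (x * r * star x) - x * star x - x * (r * (star x * x)) * star x"
        by (simp add: algebra_simps central[OF x] central[OF xs] central[OF r(1)])
      also have "\<dots> = R t" unfolding rt1 by (simp add: algebra_simps central[OF x])
      finally have "v * (R t - x * star x) = 1"
        using t0 by (simp add: v_def mult.assoc R_R)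
      moreover have "(R t - x * star x) * (1 + x * r * star x)
          = R t + R t * (x * r * star x) - x * star x - x * ((star x * x) * r) * star x"
        by (simp add: algebra_simps)
      then have "(R t - x * star x) * (1 + x * r * star x) = R t"
        unfolding rt2 by (simp add: algebra_simps central[OF x])
      then have "(R t - x * star x) * v = 1"
        using t0 x by (simp add: v_def central R_R)
      moreover have "N v \<le> M"
      proof -
        have "N (1 + x * r * star x) \<le> 1 + N (x * r * star x)"
          using N_triangle[of 1 "x * r * star x"] x r by simp
        also have "N (x * r * star x) \<le> N (x * r) * N x"
          using N_mult[of "x * r" "star x"] x r by simp
        also have "\<dots> \<le> N x * N r * N x" using N_mult[of x r] x r by (simp add: mult_right_mono)
        also have "\<dots> = N x ^ 2 * N r" by (simp add: power2_eq_square)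
        also have "\<dots> \<le> N x ^ 2 * (1 / (t - s))" using r by (intro mult_left_mono) auto
        also have "\<dots> \<le> N x ^ 2 * (1 / (t1 - s))" using t t1 by (intro mult_left_mono divide_left_mono) auto
        finally have 1: "N (1 + x * r * star x) \<le> 1 + N x ^ 2 / (t1 - s)" by simp
        have "N v = N (1 + x * r * star x) / t" using t0 x r by (simp add: v_def N_scaleR)
        also have "\<dots> \<le> (1 + N x ^ 2 / (t1 - s)) / t1"
          using 1 t t1 s x r by (intro frac_le) auto
        finally show ?thesis by (simp add: M_def)
      qed
      ultimately show ?thesis using vS by blast
    qed
    \<comment> \<open>Positivity at \<open>t + g\<close> says that the element at
      \<open>t + 2 * g\<close> is at least \<open>g\<close>. As its inverse has norm at most
      \<open>M\<close>, it is even at least \<open>1 / M = 2 * g\<close>, which is positivity at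
      \<open>t\<close>.\<close>
    define g where "g = 1 / (2 * M)"
    have g: "g > 0" using M by (simp add: g_def)
    have down: "pos (R t - x * star x)" if t: "t \<ge> t1" "pos (R (t + g) - x * star x)" for t
    proof -
      define w where "w = R (t + 2 * g) - x * star x"
      obtain v where v: "v \<in> S" "v * w = 1" "w * v = 1" "N v \<le> M"
        using inv[of "t + 2 * g"] t(1) g unfolding w_def by auto
      have "t + 2 * g = (t + g) + g" by simp
      then have "w - R g = R (t + g) - x * star x" by (simp only: w_def R_add) simp
      then have "pos (w - R g)" using t(2) by simp
      moreover have "sa w" by (simp only: w_def sa1)
      ultimately have "pos (w - R (1 / M))" using pos_inverse_lower[OF _ g _ v M] by blast
      moreover have "1 / M = 2 * g" using M by (simp add: g_def)
      ultimately show ?thesis by (simp add: w_def R_add)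
    qed
    have "pos (R (t1 + real n * g) - x * star x) \<Longrightarrow> pos (R t1 - x * star x)" for n
    proof (induction n)
      case (Suc n)
      have "t1 + real (Suc n) * g = (t1 + real n * g) + g" by (simp add: algebra_simps)
      then have "pos (R (t1 + real n * g + g) - x * star x)" using Suc.prems by (simp only:)
      then show ?case using Suc.IH down[of "t1 + real n * g"] g by simp
    qed simp
    moreover obtain n where "N (x * star x) < real n * g"
      using reals_Archimedean3[OF g] by blast
    then have "pos (R (t1 + real n * g) - x * star x)"
      using x t1 s by (intro pos_R_minus) auto
    ultimately show ?thesis by blast
  qed
  show ?thesis
  proof (rule pos_limit[OF sa1])
    fix \<eta> :: real assume "\<eta> > 0"
    then show "pos (R s - x * star x + R \<eta>)" using main[of "s + \<eta>"] by (simp add: R_add algebra_simps)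
  qed
qed

text \<open>This is half the sum of the squares of the self-adjoint elements
  \<open>x + star x\<close> and \<open>i (x - star x)\<close>.\<close>

lemma pos_sum_both:
  assumes "x \<in> S" shows "pos (star x * x + x * star x)"
proof -
  define a where "a = x + star x"
  define b where "b = \<iota> \<i> * (x - star x)"
  have "sa a" using assms by (auto simp: a_def sa_def add.commute)
  moreover have "sa b" using assms by (auto simp: b_def sa_def iota_minus iota_comm algebra_simps)
  ultimately have "pos (R (1 / 2) * (a * a + b * b))" by (intro pos_scale pos_add pos_sq) auto
  also have "b * b = - ((x - star x) * (x - star x))"
    using assms central[of "x - star x"] by (simp add: b_def mult.assoc iota_simps iota_minus)
  also have "a * a + - ((x - star x) * (x - star x)) = (star x * x + x * star x) + (star x * x + x * star x)"
    by (simp add: a_def algebra_simps)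
  also have "\<dots> = R 2 * (star x * x + x * star x)"
    using R_add[of 1 1] by (simp add: mult_2)
  finally show ?thesis by (simp add: R_R)
qed

text \<open>Near the most negative spectral value \<open>-a\<close> of \<open>c\<^sup>* c\<close>, the element \<open>x = c (c\<^sup>* c + a)\<^sup>-\<^sup>1\<close> makes
  \<open>x\<^sup>* x\<close> very negative, whereas \<open>x x\<^sup>*\<close> stays bounded above by \<open>1 / (4 a)\<close>.\<close>
lemma pos_star_mult_step:
  assumes c: "c \<in> S" and a': "a' > 0" "pos (star c * c + R a')"
  shows "pos (star c * c + R (3 / 4 * a'))"
proof -
  define h where "h = star c * c"
  \<comment> \<open>As \<open>a' = 2 / 3 * a\<close>, the hypothesis reads
    \<open>w \<ge> a / 3\<close>. The proof ends with \<open>N v \<le> 2 / a\<close>, that is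
    \<open>w \<ge> a / 2\<close>, which is \<open>h + 3 / 4 * a' \<ge> 0\<close>.\<close>
  define a where "a = 3 / 2 * a'"
  have a: "a > 0" using a' by (simp add: a_def)
  have h: "sa h" "h \<in> S" using c by (auto simp: h_def)
  define w where "w = h + R a"
  have w: "sa w" "w \<in> S" using h by (auto simp: w_def)
  have "a = a' + a / 3" by (simp add: a_def)
  then have "w - R (a / 3) = h + R a'" unfolding w_def by (metis R_add add.assoc add_diff_cancel_right')
  then have wp: "pos (w - R (a / 3))" using a' by (simp add: h_def)
  obtain v where v: "v \<in> S" "v * w = 1" "w * v = 1"
    using pos_inverse[OF w(1) _ wp] a by auto
  have vsa: "sa v" "star v = v" using sa_inverse[OF w(1) v] by (auto simp: sa_def)
  define x where "x = c * v"
  have x: "x \<in> S" using c v by (simp add: x_def)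
  have hv: "h * v = 1 - R a * v" using v(3) by (simp add: w_def algebra_simps)
  have "star x * x = v * (h * v)" using c v vsa by (simp add: x_def h_def mult.assoc)
  also have "\<dots> = v - R a * (v * v)" by (simp add: hv right_diff_distrib central[OF v(1)])
  finally have xx: "star x * x = v - R a * (v * v)" .
  define z where "z = v - R (1 / (2 * a))"
  have z: "sa z" "z \<in> S" using vsa v by (auto simp: z_def)
  \<comment> \<open>Completing the square: \<open>star x * x\<close> equals
    \<open>1 / (4 * a)\<close> minus \<open>a\<close> times \<open>z * z\<close>. A lower bound on
    \<open>star x * x\<close> thus bounds \<open>z * z\<close> from above, hence the norm of
    \<open>z\<close> and of the inverse \<open>v\<close>.\<close>
  have zz: "R a * (z * z) = R a * (v * v) - v + R (1 / (4 * a))"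
  proof -
    have "z * z = v * v - R (1 / (2 * a)) * v - R (1 / (2 * a)) * v + R (1 / (2 * a) * (1 / (2 * a)))"
      by (simp add: z_def algebra_simps central[OF v(1)] R_R)
    moreover have "R (1 / (2 * a)) * v + R (1 / (2 * a)) * v = R (1 / a) * v"
      by (simp flip: distrib_right R_add)
    ultimately have "z * z = v * v - R (1 / a) * v + R (1 / (2 * a) * (1 / (2 * a)))"
      by (simp only: diff_diff_eq)
    then have "R a * (z * z) = R a * (v * v) - R (a * (1 / a)) * v + R (a * (1 / (2 * a) * (1 / (2 * a))))"
      by (simp only: right_diff_distrib distrib_left R_R)
    moreover have "a * (1 / (2 * a) * (1 / (2 * a))) = 1 / (4 * a)" "a * (1 / a) = 1" using a by simp_all
    ultimately show ?thesis by (simp only: R_one mult_1_left)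
  qed
  have q: "1 / (4 * a) > 0" using a by simp
  have "R (1 / (4 * a)) - star x * x = R a * (z * z)" by (simp add: xx zz)
  then have "pos (R (1 / (4 * a)) - star x * x)"
    using a z by (auto intro!: pos_scale)
  from pos_swap[OF x q this] have "pos ((star x * x + x * star x) + (R (1 / (4 * a)) - x * star x))"
    using pos_sum_both[OF x] by blast
  then have "pos (star x * x + R (1 / (4 * a)))" by simp
  then have "pos (R (1 / a) * (star x * x + R (1 / (4 * a))))" using a by (intro pos_scale) auto
  moreover have "R (1 / a) * (star x * x + R (1 / (4 * a))) = R (1 / (2 * a * a)) - z * z"
  proof -
    have "star x * x + R (1 / (4 * a)) = R (1 / (4 * a) + 1 / (4 * a)) - R a * (z * z)"
      by (simp only: zz xx R_add) simp
    moreover have "1 / a * (1 / (4 * a) + 1 / (4 * a)) = 1 / (2 * a * a)"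
      using a by (simp add: field_simps)
    ultimately show ?thesis using a by (simp only: right_diff_distrib R_R) simp
  qed
  ultimately have "pos (R (1 / (2 * a * a)) - z * z)" by simp
  then have "N z ^ 2 \<le> 1 / (2 * a * a)" using z a by (intro pos_bound_norm) auto
  also have "\<dots> \<le> (3 / (2 * a)) ^ 2" using a by (simp add: power2_eq_square divide_simps)
  finally have Nz: "N z \<le> 3 / (2 * a)" by (rule power2_le_imp_le) (use a in simp)
  have "N (z + R (1 / (2 * a))) \<le> N z + 1 / (2 * a)"
    using N_triangle[OF z(2), of "R (1 / (2 * a))"] a by simp
  then have "N v \<le> N z + 1 / (2 * a)" by (simp add: z_def)
  then have "N v \<le> 2 / a" using Nz a by (simp add: field_simps)
  then have "pos (w - R (1 / (2 / a)))"
    using a by (intro pos_inverse_lower[OF w(1) _ wp v]) auto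
  moreover have "w - R (1 / (2 / a)) = h + (R a - R (a / 2))" by (simp add: w_def)
  moreover have "R a - R (a / 2) = R (3 / 4 * a')" by (simp add: a_def flip: R_diff)
  ultimately show ?thesis by (simp add: h_def)
qed

theorem pos_star_mult:
  assumes c: "c \<in> S" shows "pos (star c * c)"
proof (rule pos_limit)
  show "sa (star c * c)" using c by auto
  fix \<eta> :: real assume e: "\<eta> > 0"
  define A where "A = N (star c * c) + 1"
  have A: "A > 0" using c N_nonneg[of "star c * c"] unfolding A_def by (metis N_nonneg add_nonneg_pos mult_closed star_closed zero_less_one)
  have "pos (star c * c + R (A * (3 / 4) ^ n))" for n
  proof (induction n)
    case 0
    show ?case using c pos_R_plus[of "star c * c" A] by (auto simp: A_def add.commute)
  next
    case (Suc n)
    then show ?case using pos_star_mult_step[OF c _ Suc] A by (simp add: mult.left_commute mult.commute)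
  qed
  moreover obtain n where "(3 / 4) ^ n < \<eta> / A"
    using real_arch_pow_inv[of "\<eta> / A" "3 / 4"] e A by auto
  then have "A * (3 / 4) ^ n \<le> \<eta>" using A by (simp add: field_simps)
  then have "pos (R (\<eta> - A * (3 / 4) ^ n))" by auto
  ultimately have "pos (star c * c + R (A * (3 / 4) ^ n) + R (\<eta> - A * (3 / 4) ^ n))" by blast
  then show "pos (star c * c + R \<eta>)" by (simp add: add.assoc flip: R_add)
qed

end

section \<open>Extreme linear functionals\<close>

context star_scalars
begin

definition rlin :: "('u \<Rightarrow> real) \<Rightarrow> bool" where
  "rlin f \<longleftrightarrow> (\<forall>x\<in>S. \<forall>y\<in>S. f (x + y) = f x + f y) \<and> (\<forall>x\<in>S. \<forall>r. f (R r * x) = r * f x)"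

definition sublin :: "('u \<Rightarrow> real) \<Rightarrow> bool" where
  "sublin q \<longleftrightarrow> (\<forall>x\<in>S. \<forall>y\<in>S. q (x + y) \<le> q x + q y) \<and> (\<forall>x\<in>S. \<forall>r\<ge>0. q (R r * x) = r * q x)"

lemma sublin_add: "sublin q \<Longrightarrow> x \<in> S \<Longrightarrow> y \<in> S \<Longrightarrow> q (x + y) \<le> q x + q y"
  and sublin_scale: "sublin q \<Longrightarrow> x \<in> S \<Longrightarrow> r \<ge> 0 \<Longrightarrow> q (R r * x) = r * q x"
  by (auto simp: sublin_def)

lemma sublin_zero: "sublin q \<Longrightarrow> q 0 = 0"
  using sublin_scale[of q 0 0] by simp

lemma sublin_minus: "sublin q \<Longrightarrow> x \<in> S \<Longrightarrow> - q (- x) \<le> q x"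
  using sublin_add[of q x "- x"] sublin_zero[of q] by simp

lemma rlin_minus: "rlin f \<Longrightarrow> x \<in> S \<Longrightarrow> f (- x) = - f x"
proof -
  assume "rlin f" "x \<in> S"
  then have "f (R (- 1) * x) = - 1 * f x" unfolding rlin_def by blast
  then show "f (- x) = - f x" by (simp add: R_minus)
qed

lemma rlin_le_imp_eq:
  assumes "rlin f" "rlin g" "\<And>x. x \<in> S \<Longrightarrow> f x \<le> g x" "x \<in> S"
  shows "f x = g x"
  using assms(3)[of x] assms(3)[of "- x"] rlin_minus[OF assms(1,4)] rlin_minus[OF assms(2,4)] assms(4)
  by simp

text \<open>The largest sublinear functional below \<open>q\<close> with value \<open>- q v\<close> at \<open>- v\<close>: a linear \<open>f \<le> q\<close> lies
  below it iff \<open>f v = q v\<close>.\<close>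
definition shift :: "('u \<Rightarrow> real) \<Rightarrow> 'u \<Rightarrow> 'u \<Rightarrow> real" where
  "shift q v x = (if x \<in> S then INF t\<in>{0..}. q (x + R t * v) - t * q v else 0)"

lemma shift_bound:
  assumes "sublin q" "v \<in> S" "x \<in> S" "t \<ge> 0"
  shows "- q (- x) \<le> q (x + R t * v) - t * q v"
  using sublin_add[OF assms(1), of "x + R t * v" "- x"] sublin_scale[OF assms(1,2,4)] assms by simp

lemma shift_le:
  assumes "sublin q" "v \<in> S" "x \<in> S" "t \<ge> 0"
  shows "shift q v x \<le> q (x + R t * v) - t * q v"
  unfolding shift_def using assms shift_bound[OF assms(1-3)]
  by (auto intro!: cINF_lower bdd_belowI2[of _ "- q (- x)"])

lemma shift_greatest:
  assumes "x \<in> S" "\<And>t. t \<ge> 0 \<Longrightarrow> b \<le> q (x + R t * v) - t * q v"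
  shows "b \<le> shift q v x"
  unfolding shift_def using assms by (auto intro!: cINF_greatest)

lemma shift_le_self: "sublin q \<Longrightarrow> v \<in> S \<Longrightarrow> x \<in> S \<Longrightarrow> shift q v x \<le> q x"
  using shift_le[of q v x 0] by simp

lemma shift_minus: "sublin q \<Longrightarrow> v \<in> S \<Longrightarrow> shift q v (- v) \<le> - q v"
  using shift_le[of q v "- v" 1] sublin_zero[of q] by simp

lemma shift_sublin:
  assumes q: "sublin q" and v: "v \<in> S" shows "sublin (shift q v)"
  unfolding sublin_def
proof (intro conjI ballI allI impI)
  fix x y assume x: "x \<in> S" and y: "y \<in> S"
  have "shift q v (x + y) - shift q v y \<le> q (x + R t * v) - t * q v" if t: "t \<ge> 0" for t
  proof -
    have "shift q v (x + y) - (q (x + R t * v) - t * q v) \<le> shift q v y"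
    proof (rule shift_greatest[OF y])
      fix s :: real assume s: "s \<ge> 0"
      have "shift q v (x + y) \<le> q (x + y + R (t + s) * v) - (t + s) * q v"
        using shift_le[OF q v, of "x + y" "t + s"] x y t s by simp
      also have "x + y + R (t + s) * v = (x + R t * v) + (y + R s * v)"
        by (simp add: R_add algebra_simps)
      finally show "shift q v (x + y) - (q (x + R t * v) - t * q v) \<le> q (y + R s * v) - s * q v"
        using sublin_add[OF q, of "x + R t * v" "y + R s * v"] x y v by (simp add: algebra_simps)
    qed
    then show ?thesis by simp
  qed
  then have "shift q v (x + y) - shift q v y \<le> shift q v x" by (intro shift_greatest[OF x])
  then show "shift q v (x + y) \<le> shift q v x + shift q v y" by simp
next
  fix x and r :: real assume x: "x \<in> S" and r: "r \<ge> 0"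
  have pos: "shift q v (R r * x) \<le> r * shift q v x" if x: "x \<in> S" and r: "r > 0" for x r
  proof -
    have "shift q v (R r * x) / r \<le> shift q v x"
    proof (rule shift_greatest[OF x])
      fix t :: real assume t: "t \<ge> 0"
      have "shift q v (R r * x) \<le> q (R r * x + R (r * t) * v) - r * t * q v"
        using shift_le[OF q v, of "R r * x" "r * t"] x t r by simp
      also have "R r * x + R (r * t) * v = R r * (x + R t * v)"
        by (simp add: distrib_left R_R)
      also have "q (R r * (x + R t * v)) = r * q (x + R t * v)"
        using sublin_scale[OF q] x v r by simp
      finally show "shift q v (R r * x) / r \<le> q (x + R t * v) - t * q v"
        using r by (simp add: field_simps)
    qed
    then show ?thesis using r by (simp add: field_simps)
  qed
  show "shift q v (R r * x) = r * shift q v x"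
  proof (cases "r = 0")
    case True
    have "shift q v 0 \<le> 0" using shift_le_self[OF q v zero_closed] sublin_zero[OF q] by simp
    moreover have "0 \<le> shift q v 0"
      by (rule shift_greatest) (simp_all add: sublin_scale[OF q v])
    ultimately show ?thesis using True by simp
  next
    case False
    then have "shift q v (R (1 / r) * (R r * x)) \<le> 1 / r * shift q v (R r * x)"
      using pos[of "R r * x" "1 / r"] x r by simp
    then have "r * shift q v x \<le> shift q v (R r * x)" using False r by (simp add: R_R field_simps)
    then show ?thesis using pos[OF x, of r] False r by simp
  qed
qed

text \<open>In terms of convex sets: the linear functionals below \<open>q\<close> form a face of
  the set of those below \<open>P\<close>.\<close>

definition face_of :: "('u \<Rightarrow> real) \<Rightarrow> ('u \<Rightarrow> real) \<Rightarrow> bool" where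
  "face_of P q \<longleftrightarrow> (\<forall>f g t. rlin f \<longrightarrow> rlin g \<longrightarrow> 0 < t \<longrightarrow> t < 1 \<longrightarrow>
     (\<forall>x\<in>S. f x \<le> P x) \<longrightarrow> (\<forall>x\<in>S. g x \<le> P x) \<longrightarrow> (\<forall>x\<in>S. t * f x + (1 - t) * g x \<le> q x) \<longrightarrow>
     (\<forall>x\<in>S. f x \<le> q x \<and> g x \<le> q x))"

text \<open>Passing to \<open>shift q v\<close> selects the functionals below \<open>q\<close> with
  the largest admissible value at \<open>v\<close>, and a proper mean of two numbers bounded by
  \<open>q v\<close> equals \<open>q v\<close> only if both do.\<close>

lemma face_of_shift:
  assumes q: "sublin q" and v: "v \<in> S" and face: "face_of P q"
  shows "face_of P (shift q v)"
  unfolding face_of_def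
proof (intro allI impI)
  fix f g :: "'u \<Rightarrow> real" and t :: real
  assume A: "rlin f" "rlin g" "0 < t" "t < 1" "\<forall>x\<in>S. f x \<le> P x" "\<forall>x\<in>S. g x \<le> P x"
    "\<forall>x\<in>S. t * f x + (1 - t) * g x \<le> shift q v x"
  have "\<forall>x\<in>S. t * f x + (1 - t) * g x \<le> q x" using A(7) shift_le_self[OF q v] by fastforce
  with face A have le: "\<forall>x\<in>S. f x \<le> q x \<and> g x \<le> q x" unfolding face_of_def by blast
  have "t * f (- v) + (1 - t) * g (- v) \<le> shift q v (- v)" using A(7) v by blast
  also have "\<dots> \<le> - q v" by (rule shift_minus[OF q v])
  finally have "t * f (- v) + (1 - t) * g (- v) \<le> - q v" .
  then have ge: "q v \<le> t * f v + (1 - t) * g v" using A v by (simp add: rlin_minus)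
  have fv: "f v \<le> q v" "g v \<le> q v" using le v by auto
  have "t * f v \<le> t * q v" "(1 - t) * g v \<le> (1 - t) * q v"
    using fv A by (auto intro: mult_left_mono)
  moreover have "t * q v + (1 - t) * q v = q v" by (simp add: algebra_simps)
  ultimately have "t * f v = t * q v" "(1 - t) * g v = (1 - t) * q v" using ge by linarith+
  then have eq: "f v = q v" "g v = q v" using A by auto
  have key: "h x \<le> shift q v x" if h: "rlin h" "h v = q v" "\<forall>x\<in>S. h x \<le> q x" and x: "x \<in> S" for h x
  proof (rule shift_greatest[OF x])
    fix s :: real assume "s \<ge> 0"
    have "h (x + R s * v) = h x + s * q v" using h x v by (simp add: rlin_def)
    then show "h x \<le> q (x + R s * v) - s * q v" using h(3) x v
      by (metis add_closed le_diff_eq mult_closed R_closed)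
  qed
  show "\<forall>x\<in>S. f x \<le> shift q v x \<and> g x \<le> shift q v x"
    using key[of f] key[of g] A eq le by blast
qed

text \<open>Hahn--Banach and Krein--Milman in one application of Zorn's lemma: a minimal sublinear functional
  among those defining faces is both linear and extreme.\<close>
theorem extreme_functional_exists:
  assumes P: "sublin P" and v: "v \<in> S"
  obtains f where "rlin f" "\<And>x. x \<in> S \<Longrightarrow> f x \<le> P x" "f v = P v"
    "\<And>g h t x. rlin g \<Longrightarrow> rlin h \<Longrightarrow> 0 < t \<Longrightarrow> t < 1 \<Longrightarrow> (\<And>x. x \<in> S \<Longrightarrow> g x \<le> P x) \<Longrightarrow>
      (\<And>x. x \<in> S \<Longrightarrow> h x \<le> P x) \<Longrightarrow> (\<And>x. x \<in> S \<Longrightarrow> f x = t * g x + (1 - t) * h x) \<Longrightarrow>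
      x \<in> S \<Longrightarrow> g x = f x"
proof -
  \<comment> \<open>The value 0 outside \<open>S\<close> makes two members equal as soon as they
    agree on \<open>S\<close>, so that minimality yields an equation of functions. Starting from
    \<open>shift P v\<close> instead of \<open>P\<close> forces the value \<open>P v\<close> at
    \<open>v\<close>.\<close>
  define Q where "Q = {q. sublin q \<and> (\<forall>x. x \<notin> S \<longrightarrow> q x = 0) \<and>
    (\<forall>x\<in>S. q x \<le> shift P v x) \<and> face_of P q}"
  have "face_of P P" by (auto simp: face_of_def)
  then have Q0: "shift P v \<in> Q"
    using shift_sublin[OF P v] face_of_shift[OF P v] by (simp add: Q_def) (simp add: shift_def)
  let ?r = "relation_of (\<lambda>p q. q \<le> p) Q"
  have "\<exists>m\<in>Q. \<forall>q\<in>Q. q \<le> m \<longrightarrow> q = m"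
  proof (rule predicate_Zorn)
    show "partial_order_on Q ?r" by (rule partial_order_on_relation_ofI) auto
    fix C assume C: "C \<in> Chains ?r"
    have CQ: "C \<subseteq> Q" using C Chains_relation_of by blast
    have comp: "p \<le> q \<or> q \<le> p" if "p \<in> C" "q \<in> C" for p q
      using C that unfolding Chains_def relation_of_def by auto
    show "\<exists>u\<in>Q. \<forall>q\<in>C. u \<le> q"
    proof (cases "C = {}")
      case True then show ?thesis using Q0 by auto
    next
      case False
      define u where "u x = (INF q\<in>C. q x)" for x
      have bnd: "bdd_below ((\<lambda>q. q x) ` C)" for x
      proof (cases "x \<in> S")
        case True
        have "- shift P v (- x) \<le> q x" if "q \<in> C" for q
        proof -
          have "q (- x) \<le> shift P v (- x)" "sublin q" using that CQ True by (auto simp: Q_def)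
          then show ?thesis using sublin_minus[of q x] True by simp
        qed
        then show ?thesis by (intro bdd_belowI2)
      next
        case False
        then show ?thesis using CQ by (intro bdd_belowI2[of _ 0]) (auto simp: Q_def)
      qed
      have le: "u x \<le> q x" if "q \<in> C" for q x
        unfolding u_def using that bnd by (auto intro: cINF_lower)
      have ge: "b \<le> u x" if "\<And>q. q \<in> C \<Longrightarrow> b \<le> q x" for b x
        unfolding u_def using that False by (auto intro: cINF_greatest)
      have uS: "u x = 0" if "x \<notin> S" for x
        using ge[of 0 x] le[of _ x] False CQ that by (fastforce simp: Q_def)
      have "sublin u" unfolding sublin_def
      proof (intro conjI ballI allI impI)
        fix x y assume x: "x \<in> S" and y: "y \<in> S"
        have "u (x + y) - q y \<le> p x" if pq: "p \<in> C" "q \<in> C" for p q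
        proof -
          \<comment> \<open>An infimum of sublinear functionals is subadditive only if any two of
            them have a common lower one in \<open>C\<close>; the chain supplies it.\<close>
          obtain m where m: "m \<in> C" "m \<le> p" "m \<le> q" using comp[OF pq] pq by auto
          have "u (x + y) \<le> m (x + y)" using le m by blast
          also have "\<dots> \<le> m x + m y" using m CQ x y by (auto simp: Q_def sublin_add)
          also have "\<dots> \<le> p x + q y" using m by (intro add_mono) (auto simp: le_fun_def)
          finally show ?thesis by simp
        qed
        then have "u (x + y) - q y \<le> u x" if "q \<in> C" for q using ge that by blast
        then have "u (x + y) - u x \<le> u y" by (intro ge) (simp add: algebra_simps)
        then show "u (x + y) \<le> u x + u y" by simp
      next
        fix x and r :: real assume x: "x \<in> S" and r: "r \<ge> 0"
        have sc: "q (R r * x) = r * q x" if "q \<in> C" for q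
          using that CQ x r by (auto simp: Q_def sublin_scale)
        show "u (R r * x) = r * u x"
        proof (cases "r = 0")
          case True
          then have "u 0 = 0" using ge[of 0 0] le[of _ 0] False CQ
            by (smt (verit) Q_def all_not_in_conv mem_Collect_eq subsetD sublin_zero)
          then show ?thesis using True by simp
        next
          case False
          have "r * u x \<le> u (R r * x)" using le r by (intro ge) (simp add: sc mult_left_mono)
          moreover have "u (R r * x) / r \<le> u x"
            using le sc False r by (intro ge) (metis divide_le_eq less_eq_real_def mult.commute)
          ultimately show ?thesis using False r by (simp add: field_simps)
        qed
      qed
      moreover have "\<forall>x\<in>S. u x \<le> shift P v x"
      proof
        fix x assume x: "x \<in> S"
        obtain q where q: "q \<in> C" using False by blast
        have "u x \<le> q x" by (rule le[OF q])
        also have "\<dots> \<le> shift P v x" using q CQ x by (auto simp: Q_def)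
        finally show "u x \<le> shift P v x" .
      qed
      moreover have "face_of P u" unfolding face_of_def
      proof (intro allI impI ballI)
        fix f g :: "'u \<Rightarrow> real" and t :: real and x
        assume A: "rlin f" "rlin g" "0 < t" "t < 1" "\<forall>x\<in>S. f x \<le> P x" "\<forall>x\<in>S. g x \<le> P x"
          "\<forall>x\<in>S. t * f x + (1 - t) * g x \<le> u x" "x \<in> S"
        have "f x \<le> q x \<and> g x \<le> q x" if "q \<in> C" for q
        proof -
          have "face_of P q" using that CQ by (auto simp: Q_def)
          moreover have "\<forall>x\<in>S. t * f x + (1 - t) * g x \<le> q x" using A(7) le[OF that] order_trans by blast
          ultimately show ?thesis using A unfolding face_of_def by blast
        qed
        then show "f x \<le> u x \<and> g x \<le> u x" using ge by blast
      qed
      ultimately have "u \<in> Q" using uS by (auto simp: Q_def)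
      then show ?thesis using le by (auto simp: le_fun_def)
    qed
  qed
  then obtain m where m: "m \<in> Q" "\<And>q. q \<in> Q \<Longrightarrow> q \<le> m \<Longrightarrow> q = m" by blast
  have ms: "sublin m" and m0: "\<And>x. x \<notin> S \<Longrightarrow> m x = 0" and mP: "\<And>x. x \<in> S \<Longrightarrow> m x \<le> shift P v x"
    and mf: "face_of P m" using m by (auto simp: Q_def)
  \<comment> \<open>By minimality \<open>shift m w = m\<close>, while \<open>shift m w\<close> is at
    most \<open>- m w\<close> at \<open>- w\<close>. A sublinear functional that is odd is
    linear.\<close>
  have neg: "m (- w) = - m w" if w: "w \<in> S" for w
  proof -
    have "shift m w \<in> Q"
      using shift_sublin[OF ms w] face_of_shift[OF ms w mf] shift_le_self[OF ms w] mP
      by (auto simp: Q_def shift_def intro: order_trans)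
    moreover have "shift m w \<le> m" using shift_le_self[OF ms w] m0 by (auto simp: le_fun_def shift_def)
    ultimately have "shift m w = m" by (rule m(2))
    then have "m (- w) \<le> - m w" using shift_minus[OF ms w] by simp
    then show ?thesis using sublin_minus[OF ms w] by simp
  qed
  have lin: "rlin m" unfolding rlin_def
  proof (intro conjI ballI allI)
    fix x y assume x: "x \<in> S" and y: "y \<in> S"
    have "m x \<le> m (x + y) + m (- y)" using sublin_add[OF ms, of "x + y" "- y"] x y by simp
    then show "m (x + y) = m x + m y" using sublin_add[OF ms x y] neg[OF y] by simp
  next
    fix x and r :: real assume x: "x \<in> S"
    show "m (R r * x) = r * m x"
    proof (cases "r \<ge> 0")
      case False
      then have "m (R (- r) * x) = - r * m x" using sublin_scale[OF ms x, of "- r"] by simp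
      then show ?thesis using neg[of "R r * x"] x by (simp add: R_minus)
    qed (simp add: sublin_scale[OF ms x])
  qed
  have mP': "m x \<le> P x" if "x \<in> S" for x using mP[OF that] shift_le_self[OF P v that] by simp
  have "- m v \<le> - P v" using mP[of "- v"] shift_minus[OF P v] v neg[OF v] by simp
  then have mv: "m v = P v" using mP'[OF v] by simp
  show thesis
  proof (rule that[OF lin mP' mv])
    fix g h :: "'u \<Rightarrow> real" and t x
    assume A: "rlin g" "rlin h" "0 < t" "t < 1" "\<And>x. x \<in> S \<Longrightarrow> g x \<le> P x" "\<And>x. x \<in> S \<Longrightarrow> h x \<le> P x"
      "\<And>x. x \<in> S \<Longrightarrow> m x = t * g x + (1 - t) * h x" and x: "x \<in> S"
    have "\<forall>x\<in>S. g x \<le> m x \<and> h x \<le> m x"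
      using mf A unfolding face_of_def by (metis order_refl)
    then show "g x = m x" using rlin_le_imp_eq[OF A(1) lin _ x] by blast
  qed
qed

end

section \<open>Hilbert space completion\<close>

text \<open>The form may be degenerate, as the GNS form is. The laws of scalar multiplication are
  imposed only through \<open>g\<close>, so identities between vectors are often proved after
  pairing with a third vector.\<close>

locale semi_inner =
  fixes V :: "'u::ab_group_add set" and sc :: "complex \<Rightarrow> 'u \<Rightarrow> 'u" and g :: "'u \<Rightarrow> 'u \<Rightarrow> complex"
  assumes V_zero [simp, intro]: "0 \<in> V"
    and V_add [simp, intro]: "x \<in> V \<Longrightarrow> y \<in> V \<Longrightarrow> x + y \<in> V"
    and V_diff [simp, intro]: "x \<in> V \<Longrightarrow> y \<in> V \<Longrightarrow> x - y \<in> V"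
    and V_scale [simp, intro]: "x \<in> V \<Longrightarrow> sc c x \<in> V"
    and g_add: "x \<in> V \<Longrightarrow> y \<in> V \<Longrightarrow> z \<in> V \<Longrightarrow> g (x + y) z = g x z + g y z"
    and g_scale: "x \<in> V \<Longrightarrow> z \<in> V \<Longrightarrow> g (sc c x) z = c * g x z"
    and g_commute: "x \<in> V \<Longrightarrow> y \<in> V \<Longrightarrow> g x y = cnj (g y x)"
    and g_nonneg: "x \<in> V \<Longrightarrow> 0 \<le> Re (g x x)"
begin

definition nrm :: "'u \<Rightarrow> real" where "nrm x = sqrt (Re (g x x))"

lemma g_diff: "x \<in> V \<Longrightarrow> y \<in> V \<Longrightarrow> z \<in> V \<Longrightarrow> g (x - y) z = g x z - g y z"
  using g_add[of "x - y" y z] by simp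

lemma g_add_right: "x \<in> V \<Longrightarrow> y \<in> V \<Longrightarrow> z \<in> V \<Longrightarrow> g z (x + y) = g z x + g z y"
  using g_commute[of z "x + y"] g_commute[of z x] g_commute[of z y] g_add[of x y z] by simp

lemma g_diff_right: "x \<in> V \<Longrightarrow> y \<in> V \<Longrightarrow> z \<in> V \<Longrightarrow> g z (x - y) = g z x - g z y"
  using g_commute[of z "x - y"] g_commute[of z x] g_commute[of z y] g_diff[of x y z] by simp

lemma g_scale_right: "x \<in> V \<Longrightarrow> z \<in> V \<Longrightarrow> g z (sc c x) = cnj c * g z x"
  using g_commute[of z "sc c x"] g_commute[of z x] g_scale[of x z c] by simp

lemma g_zero [simp]: "z \<in> V \<Longrightarrow> g 0 z = 0"
  using g_add[of 0 0 z] by simp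

lemma g_zero_right [simp]: "z \<in> V \<Longrightarrow> g z 0 = 0"
  using g_add_right[of 0 0 z] by simp

lemma g_self: "x \<in> V \<Longrightarrow> g x x = of_real (nrm x ^ 2)"
  using g_commute[of x x] g_nonneg[of x] by (simp add: nrm_def complex_eq_iff)

lemma nrm_sq: "x \<in> V \<Longrightarrow> nrm x ^ 2 = Re (g x x)"
  using g_nonneg[of x] by (simp add: nrm_def)

lemma nrm_nonneg [simp]: "x \<in> V \<Longrightarrow> 0 \<le> nrm x"
  using g_nonneg[of x] by (simp add: nrm_def)

lemma nrm_zero [simp]: "nrm 0 = 0"
  by (simp add: nrm_def)

lemma cauchy_schwarz:
  assumes x: "x \<in> V" and y: "y \<in> V"
  shows "cmod (g x y) \<le> nrm x * nrm y"
proof -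
  define b where "b = cmod (g x y)"
  obtain l where l: "cmod l = 1" "l * g x y = of_real b"
  proof (cases "g x y = 0")
    case True then show ?thesis using that[of 1] by (simp add: b_def)
  next
    case False
    have "cnj (g x y) / of_real b * g x y = of_real b"
      using False complex_norm_square[of "g x y"]
      by (simp add: b_def divide_simps power2_eq_square mult.commute)
    then show ?thesis using that[of "cnj (g x y) / of_real b"] False by (simp add: b_def norm_divide)
  qed
  have q: "0 \<le> nrm x ^ 2 + 2 * t * b + t ^ 2 * nrm y ^ 2" for t :: real
  proof -
    let ?w = "sc l x + sc (of_real t) y"
    have l2: "l * cnj l = 1" using l(1) complex_norm_square[of l] by simp
    have yx: "cnj l * g y x = of_real b"
      using l(2) g_commute[OF y x] by (metis complex_cnj_complex_of_real complex_cnj_mult)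
    have "g ?w ?w = (l * cnj l) * g x x + of_real t * (l * g x y) + of_real t * (cnj l * g y x)
        + of_real (t ^ 2) * g y y"
      using x y by (simp add: g_add g_add_right g_scale g_scale_right algebra_simps power2_eq_square)
    also have "\<dots> = of_real (nrm x ^ 2 + 2 * t * b + t ^ 2 * nrm y ^ 2)"
      using x y by (simp add: l2 l(2) yx g_self)
    finally show ?thesis using g_nonneg[of ?w] x y by simp
  qed
  have b: "b \<ge> 0" by (simp add: b_def)
  show ?thesis
  proof (cases "nrm y = 0")
    case True
    have "b = 0"
    proof (rule ccontr)
      assume "b \<noteq> 0"
      then have "nrm x ^ 2 + 2 * (- (nrm x ^ 2 + 1) / (2 * b)) * b = - 1" by (simp add: field_simps)
      then show False using q[of "- (nrm x ^ 2 + 1) / (2 * b)"] True by simp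
    qed
    then show ?thesis using True by (simp add: b_def)
  next
    case False
    then have ny: "nrm y > 0" using nrm_nonneg[OF y] by linarith
    define c where "c = nrm y ^ 2"
    have c: "c > 0" using ny by (simp add: c_def)
    have "2 * (- b / c) * b + (- b / c) ^ 2 * c = - (b ^ 2 / c)"
      using c by (simp add: power2_eq_square)
    then have "0 \<le> nrm x ^ 2 - b ^ 2 / c"
      using q[of "- b / c"] unfolding c_def by linarith
    then have "b ^ 2 \<le> nrm x ^ 2 * c" using c by (simp add: field_simps)
    then have "b ^ 2 \<le> (nrm x * nrm y) ^ 2" by (simp add: c_def power_mult_distrib)
    then show ?thesis unfolding b_def by (rule power2_le_imp_le) (use x y in simp)
  qed
qed

lemma nrm_triangle:
  assumes x: "x \<in> V" and y: "y \<in> V" shows "nrm (x + y) \<le> nrm x + nrm y"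
proof (rule power2_le_imp_le)
  have "nrm (x + y) ^ 2 = nrm x ^ 2 + Re (g x y) + Re (g y x) + nrm y ^ 2"
    using x y by (simp add: nrm_sq g_add g_add_right)
  also have "Re (g y x) = Re (g x y)" using g_commute[OF y x] by simp
  also have "Re (g x y) \<le> nrm x * nrm y"
    using cauchy_schwarz[OF x y] complex_Re_le_cmod order_trans by blast
  finally show "nrm (x + y) ^ 2 \<le> (nrm x + nrm y) ^ 2" by (simp add: power2_sum)
  show "0 \<le> nrm x + nrm y" using x y by simp
qed

lemma nrm_scale: "x \<in> V \<Longrightarrow> nrm (sc c x) = cmod c * nrm x"
proof -
  assume x: "x \<in> V"
  have "g (sc c x) (sc c x) = c * cnj c * g x x" using x by (simp add: g_scale g_scale_right)
  also have "c * cnj c = of_real (cmod c ^ 2)" by (rule complex_norm_square[symmetric])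
  finally have "Re (g (sc c x) (sc c x)) = cmod c ^ 2 * Re (g x x)" by simp
  then show ?thesis by (simp add: nrm_def real_sqrt_mult)
qed

lemma nrm_diff_commute: "x \<in> V \<Longrightarrow> y \<in> V \<Longrightarrow> nrm (x - y) = nrm (y - x)"
  by (simp add: nrm_def g_diff g_diff_right)

lemma nrm_diff_triangle:
  "x \<in> V \<Longrightarrow> y \<in> V \<Longrightarrow> z \<in> V \<Longrightarrow> nrm (x - z) \<le> nrm (x - y) + nrm (y - z)"
  using nrm_triangle[of "x - y" "y - z"] by simp

lemma nrm_le_add: "x \<in> V \<Longrightarrow> y \<in> V \<Longrightarrow> nrm x \<le> nrm (x - y) + nrm y"
  using nrm_triangle[of "x - y" y] by simp

lemma parallelogram:
  "x \<in> V \<Longrightarrow> y \<in> V \<Longrightarrow> nrm (x + y) ^ 2 + nrm (x - y) ^ 2 = 2 * nrm x ^ 2 + 2 * nrm y ^ 2"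
  by (simp add: nrm_sq g_add g_add_right g_diff g_diff_right)

lemma orthogonal_projection_exists:
  assumes complete: "complete_wrt V (\<lambda>x y. nrm (x - y))"
    and K: "K \<subseteq> V" "0 \<in> K" "\<And>x y. x \<in> K \<Longrightarrow> y \<in> K \<Longrightarrow> x + y \<in> K" "\<And>c x. x \<in> K \<Longrightarrow> sc c x \<in> K"
    and closed: "closed_in_wrt K V (\<lambda>x y. nrm (x - y))"
    and xi: "\<xi> \<in> V"
  shows "\<exists>\<eta>\<in>K. \<forall>y\<in>K. g (\<xi> - \<eta>) y = 0"
proof -
  define d where "d = (INF k\<in>K. nrm (\<xi> - k))"
  have bdd: "bdd_below ((\<lambda>k. nrm (\<xi> - k)) ` K)"
    using K xi by (intro bdd_belowI2[of _ 0]) auto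
  have dle: "d \<le> nrm (\<xi> - k)" if "k \<in> K" for k
    unfolding d_def using that bdd by (rule cINF_lower[rotated])
  have d0: "d \<ge> 0" unfolding d_def using K xi by (intro cINF_greatest) auto
  have "\<exists>k\<in>K. nrm (\<xi> - k) < d + 1 / real (Suc n)" for n
  proof (rule ccontr)
    assume "\<not> ?thesis"
    then have "d + 1 / real (Suc n) \<le> d"
      unfolding d_def using K by (intro cINF_greatest) (auto simp: d_def[symmetric] not_less)
    then show False by simp
  qed
  then obtain k where k: "\<And>n. k n \<in> K" "\<And>n. nrm (\<xi> - k n) < d + 1 / real (Suc n)" by metis
  have kV: "k n \<in> V" for n using k K by blast
  have close: "nrm (k m - k n) ^ 2 \<le> 8 * (d + 1) / real (Suc M)" if mn: "m \<ge> M" "n \<ge> M" for m n M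
  proof -
    define e where "e = 1 / real (Suc M)"
    have e: "0 < e" "e \<le> 1" by (simp_all add: e_def)
    have sm: "nrm (\<xi> - k i) ^ 2 \<le> (d + e) ^ 2" if "i \<ge> M" for i
    proof (rule power_mono)
      have "1 / real (Suc i) \<le> e" unfolding e_def using that by (intro divide_left_mono) auto
      then show "nrm (\<xi> - k i) \<le> d + e" using k(2)[of i] by linarith
    qed (use kV xi in auto)
    \<comment> \<open>The midpoint lies in \<open>K\<close>, so \<open>\<xi> - h\<close> has norm at
      least \<open>d\<close>; the parallelogram law then forces the minimizing sequence to be
      Cauchy.\<close>
    define h where "h = sc (1 / 2) (k m + k n)"
    have hK: "h \<in> K" using K(3,4) k by (simp add: h_def)
    have hV: "h \<in> V" using hK K by blast
    let ?a = "\<xi> - k m" and ?b = "\<xi> - k n"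
    have aV: "?a \<in> V" "?b \<in> V" using kV xi by auto
    \<comment> \<open>\<open>?a + ?b\<close> and twice \<open>\<xi> - h\<close> are compared through
      \<open>g\<close> only, because their equality as vectors does not follow from the axioms on
      \<open>sc\<close>.\<close>
    have gh: "g (?a + ?b) z = 2 * g (\<xi> - h) z" if "z \<in> V" for z
      using that kV xi hV by (simp add: g_add g_diff h_def g_scale field_simps)
    have "g (?a + ?b) (?a + ?b) = 2 * g (\<xi> - h) (?a + ?b)" using gh aV by simp
    also have "g (\<xi> - h) (?a + ?b) = cnj (2 * g (\<xi> - h) (\<xi> - h))"
      using gh[of "\<xi> - h"] g_commute[of "\<xi> - h" "?a + ?b"] xi hV aV by simp
    finally have "nrm (?a + ?b) ^ 2 = 4 * nrm (\<xi> - h) ^ 2" using aV xi hV by (simp add: nrm_sq)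
    moreover have "d ^ 2 \<le> nrm (\<xi> - h) ^ 2" using dle[OF hK] d0 by (intro power_mono)
    moreover have "?a - ?b = k n - k m" by simp
    then have "nrm (k m - k n) ^ 2 = nrm (?a - ?b) ^ 2" using nrm_diff_commute[OF kV kV, of m n] by simp
    moreover have "nrm ?a ^ 2 \<le> (d + e) ^ 2" "nrm ?b ^ 2 \<le> (d + e) ^ 2" using sm mn by auto
    ultimately have "nrm (k m - k n) ^ 2 \<le> 4 * (d + e) ^ 2 - 4 * d ^ 2"
      using parallelogram[OF aV] by linarith
    also have "\<dots> = 8 * d * e + 4 * e * e" by (simp add: power2_sum algebra_simps power2_eq_square)
    also have "\<dots> \<le> 8 * d * e + 8 * e" using e mult_left_mono[of e 1 "4 * e"] by simp
    also have "\<dots> = 8 * (d + 1) / real (Suc M)" by (simp add: e_def add_divide_distrib distrib_left)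
    finally show ?thesis .
  qed
  have "\<exists>x\<in>V. (\<lambda>m. nrm (k m - x)) \<longlonglongrightarrow> 0"
  proof (rule complete[unfolded complete_wrt_def, rule_format])
    show "k m \<in> V" for m by (rule kV)
    fix \<epsilon> :: real assume e: "\<epsilon> > 0"
    obtain M where M: "8 * (d + 1) / \<epsilon> ^ 2 < real (Suc M)"
      using reals_Archimedean2 by (metis less_Suc_eq of_nat_less_iff order_less_trans lessI)
    have "nrm (k m - k n) < \<epsilon>" if "m \<ge> M" "n \<ge> M" for m n
    proof -
      have "8 * (d + 1) / real (Suc M) < \<epsilon> ^ 2" using M e by (simp add: field_simps)
      then have "nrm (k m - k n) ^ 2 < \<epsilon> ^ 2" using close[OF that] by linarith
      then show ?thesis using e by (simp add: power_less_imp_less_base)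
    qed
    then show "\<exists>N. \<forall>m\<ge>N. \<forall>n\<ge>N. nrm (k m - k n) < \<epsilon>" by blast
  qed
  then obtain \<eta> where eta: "\<eta> \<in> V" "(\<lambda>m. nrm (k m - \<eta>)) \<longlonglongrightarrow> 0" by blast
  have etaK: "\<eta> \<in> K" using closed k(1) eta unfolding closed_in_wrt_def by blast
  define w where "w = \<xi> - \<eta>"
  have w: "w \<in> V" using xi eta by (simp add: w_def)
  have "nrm w \<le> d"
  proof (rule LIMSEQ_le_const)
    have "(\<lambda>m. (d + 1 / real (Suc m)) + nrm (k m - \<eta>)) \<longlonglongrightarrow> (d + 0) + 0"
      using eta(2) LIMSEQ_inverse_real_of_nat by (intro tendsto_add) (auto simp: inverse_eq_divide)
    then show "(\<lambda>m. (d + 1 / real (Suc m)) + nrm (k m - \<eta>)) \<longlonglongrightarrow> d" by simp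
    have "nrm w \<le> d + 1 / real (Suc n) + nrm (k n - \<eta>)" for n
      using nrm_diff_triangle[OF xi kV eta(1), of n] k(2)[of n] unfolding w_def by linarith
    then show "\<exists>N. \<forall>n\<ge>N. nrm w \<le> d + 1 / real (Suc n) + nrm (k n - \<eta>)" by blast
  qed
  have "g w y = 0" if y: "y \<in> K" for y
  proof (rule ccontr)
    assume nz: "g w y \<noteq> 0"
    have yV: "y \<in> V" using y K by blast
    define b where "b = cmod (g w y) ^ 2"
    have b: "b > 0" using nz by (simp add: b_def)
    \<comment> \<open>Moving from \<open>\<eta>\<close> by \<open>c\<close> times \<open>y\<close>
      changes the squared distance by \<open>- 2 * t * b + t ^ 2 * b * nrm y ^ 2\<close>, which this
      \<open>t\<close> makes negative. The summand 1 covers vectors \<open>y\<close> of norm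
      0.\<close>
    define t where "t = 1 / (nrm y ^ 2 + 1)"
    have ny: "nrm y ^ 2 + 1 > 0" by (simp add: add_nonneg_pos)
    have t: "t > 0" "t * nrm y ^ 2 < 1" using ny by (simp_all add: t_def)
    define c where "c = of_real t * g w y"
    have cb: "cnj (g w y) * g w y = of_real b" by (simp add: b_def complex_norm_square mult.commute del: of_real_power)
    have "\<eta> + sc c y \<in> K" using etaK y K by blast
    then have "d \<le> nrm (w - sc c y)" using dle by (metis diff_diff_eq w_def)
    then have "d ^ 2 \<le> nrm (w - sc c y) ^ 2" using d0 by (intro power_mono)
    also have "g (w - sc c y) (w - sc c y) = of_real (nrm w ^ 2 - 2 * t * b + t ^ 2 * b * nrm y ^ 2)"
    proof -
      have "g (w - sc c y) (w - sc c y) = g w w - cnj c * g w y - c * g y w + c * cnj c * g y y"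
        using w yV by (simp add: g_diff g_diff_right g_scale g_scale_right algebra_simps)
      also have "g y w = cnj (g w y)" by (rule g_commute[OF yV w])
      also have "c * cnj (g w y) = of_real (t * b)" using cb by (simp add: c_def mult.commute mult.left_commute)
      also have "cnj c * g w y = of_real (t * b)" using cb by (simp add: c_def)
      also have "c * cnj c = of_real (t ^ 2 * b)"
        using cb by (simp add: c_def power2_eq_square mult.commute mult.left_commute)
      finally show ?thesis using w yV by (simp add: g_self)
    qed
    then have "nrm (w - sc c y) ^ 2 = nrm w ^ 2 - 2 * t * b + t ^ 2 * b * nrm y ^ 2"
      using w yV by (simp add: nrm_sq)
    finally have "d ^ 2 \<le> nrm w ^ 2 - 2 * t * b + t ^ 2 * b * nrm y ^ 2" .
    moreover have "nrm w ^ 2 \<le> d ^ 2" using \<open>nrm w \<le> d\<close> w by (intro power_mono) auto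
    ultimately have "2 * (t * b) \<le> (t * b) * (t * nrm y ^ 2)" by (simp add: power2_eq_square algebra_simps)
    also have "\<dots> < (t * b) * 1" using t b by (intro mult_strict_left_mono) auto
    finally have "t * b < 0" by linarith
    then show False using t b by (simp add: mult_less_0_iff)
  qed
  then show ?thesis using etaK w_def by blast
qed

end

section \<open>Completion of a semi-inner product space\<close>

context semi_inner
begin

definition rep :: "(nat \<Rightarrow> 'u) \<Rightarrow> ('u \<Rightarrow> complex) \<Rightarrow> bool" where
  "rep x F \<longleftrightarrow> (\<forall>n. x n \<in> V) \<and> (\<forall>\<epsilon>>0. \<exists>M. \<forall>m\<ge>M. \<forall>n\<ge>M. nrm (x m - x n) < \<epsilon>) \<and>
     (\<forall>z\<in>V. (\<lambda>n. g (x n) z) \<longlonglongrightarrow> F z) \<and> (\<forall>z. z \<notin> V \<longrightarrow> F z = 0)"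

text \<open>The completion, realised as a space of antilinear functionals: \<open>F z\<close> is the inner product of the
  limit point \<open>F\<close> with \<open>z\<close>.\<close>
definition HC :: "('u \<Rightarrow> complex) set" where
  "HC = {F. \<exists>x. rep x F}"

definition emb :: "'u \<Rightarrow> 'u \<Rightarrow> complex" where
  "emb x = (\<lambda>z. if z \<in> V then g x z else 0)"

text \<open>The limit is independent of the representatives picked by \<open>SOME\<close>; this is
  \<open>rep_inner\<close>.\<close>

definition ip :: "('u \<Rightarrow> complex) \<Rightarrow> ('u \<Rightarrow> complex) \<Rightarrow> complex" where
  "ip F G = lim (\<lambda>n. g ((SOME x. rep x F) n) ((SOME x. rep x G) n))"

definition hs :: "complex \<Rightarrow> ('u \<Rightarrow> complex) \<Rightarrow> 'u \<Rightarrow> complex" where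
  "hs c F = (\<lambda>z. c * F z)"

lemma rep_in: "rep x F \<Longrightarrow> x n \<in> V"
  and rep_lim: "rep x F \<Longrightarrow> z \<in> V \<Longrightarrow> (\<lambda>n. g (x n) z) \<longlonglongrightarrow> F z"
  and rep_Cauchy: "rep x F \<Longrightarrow> \<epsilon> > 0 \<Longrightarrow> \<exists>M. \<forall>m\<ge>M. \<forall>n\<ge>M. nrm (x m - x n) < \<epsilon>"
  and rep_outside: "rep x F \<Longrightarrow> z \<notin> V \<Longrightarrow> F z = 0"
  by (auto simp: rep_def)

lemma rep_bounded:
  assumes "rep x F" obtains B where "B > 0" "\<And>n. nrm (x n) \<le> B"
proof -
  obtain M where M: "\<And>m n. m \<ge> M \<Longrightarrow> n \<ge> M \<Longrightarrow> nrm (x m - x n) < 1"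
    using rep_Cauchy[OF assms, of 1] by auto
  define B where "B = Max ((\<lambda>n. nrm (x n)) ` {..M}) + 1"
  have le: "nrm (x n) \<le> B - 1" if "n \<le> M" for n
    unfolding B_def using that by simp
  have "nrm (x n) \<le> B" for n
  proof (cases "n \<le> M")
    case True then show ?thesis using le[OF True] by simp
  next
    case False
    then have "nrm (x n - x M) < 1" using M by simp
    then show ?thesis using nrm_le_add[of "x n" "x M"] rep_in[OF assms] le[of M] by fastforce
  qed
  moreover have "B > 0" using le[of M] nrm_nonneg[OF rep_in[OF assms, of M]] by simp
  ultimately show thesis using that by blast
qed

text \<open>Split \<open>nrm (d n) ^ 2\<close> into \<open>g (d n) (d M)\<close>, small by weak
  convergence, and \<open>g (d n) (d n - d M)\<close>, small by the Cauchy property. Hence a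
  functional determines its representing sequence up to null sequences.\<close>

lemma rep_null:
  assumes d: "rep d (\<lambda>z. 0)" shows "(\<lambda>n. nrm (d n)) \<longlonglongrightarrow> 0"
proof (rule LIMSEQ_I)
  fix r :: real assume r: "r > 0"
  obtain B where B: "B > 0" "\<And>n. nrm (d n) \<le> B" using rep_bounded[OF d] by blast
  have e: "r ^ 2 / (2 * B) > 0" using r B by simp
  obtain M where M: "\<And>m n. m \<ge> M \<Longrightarrow> n \<ge> M \<Longrightarrow> nrm (d m - d n) < r ^ 2 / (2 * B)"
    using rep_Cauchy[OF d e] by blast
  have "(\<lambda>n. g (d n) (d M)) \<longlonglongrightarrow> 0" using rep_lim[OF d rep_in[OF d]] by simp
  then obtain N where N: "\<And>n. n \<ge> N \<Longrightarrow> cmod (g (d n) (d M)) < r ^ 2 / 2"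
    using r by (fastforce dest: LIMSEQ_D[of _ _ "r ^ 2 / 2"])
  have "nrm (d n) < r" if n: "n \<ge> max M N" for n
  proof -
    have V: "d n \<in> V" "d M \<in> V" using rep_in[OF d] by auto
    have "g (d n) (d n) = g (d n) (d M) + g (d n) (d n - d M)" using V by (simp add: g_diff_right)
    then have "nrm (d n) ^ 2 = Re (g (d n) (d M)) + Re (g (d n) (d n - d M))" using V by (simp add: nrm_sq)
    also have "Re (g (d n) (d M)) \<le> cmod (g (d n) (d M))" by (rule complex_Re_le_cmod)
    also have "\<dots> < r ^ 2 / 2" using N n by simp
    also have "Re (g (d n) (d n - d M)) \<le> nrm (d n) * nrm (d n - d M)"
      using cauchy_schwarz[of "d n" "d n - d M"] V complex_Re_le_cmod order_trans by blast
    also have "\<dots> \<le> B * (r ^ 2 / (2 * B))"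
      using B V M[of n M] n by (intro mult_mono) (auto intro: less_imp_le)
    also have "B * (r ^ 2 / (2 * B)) = r ^ 2 / 2" using B by simp
    finally have "nrm (d n) ^ 2 < r ^ 2" by simp
    then show ?thesis using r by (simp add: power_less_imp_less_base)
  qed
  then show "\<exists>no. \<forall>n\<ge>no. norm (nrm (d n) - 0) < r" using rep_in[OF d] by (intro exI[of _ "max M N"]) simp
qed

lemma rep_add: assumes "rep x F" "rep y G" shows "rep (\<lambda>n. x n + y n) (F + G)"
  unfolding rep_def
proof (intro conjI allI impI ballI)
  show "x n + y n \<in> V" for n using assms rep_in by blast
  show "(\<lambda>n. g (x n + y n) z) \<longlonglongrightarrow> (F + G) z" if "z \<in> V" for z
    using tendsto_add[OF rep_lim[OF assms(1) that] rep_lim[OF assms(2) that]] that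
    by (simp add: g_add rep_in[OF assms(1)] rep_in[OF assms(2)])
  show "(F + G) z = 0" if "z \<notin> V" for z using rep_outside[OF assms(1) that] rep_outside[OF assms(2) that] by simp
  fix \<epsilon> :: real assume "\<epsilon> > 0"
  then have e: "\<epsilon> / 2 > 0" by simp
  obtain M1 where M1: "\<And>m n. m \<ge> M1 \<Longrightarrow> n \<ge> M1 \<Longrightarrow> nrm (x m - x n) < \<epsilon> / 2"
    using rep_Cauchy[OF assms(1) e] by blast
  obtain M2 where M2: "\<And>m n. m \<ge> M2 \<Longrightarrow> n \<ge> M2 \<Longrightarrow> nrm (y m - y n) < \<epsilon> / 2"
    using rep_Cauchy[OF assms(2) e] by blast
  have "nrm (x m + y m - (x n + y n)) < \<epsilon>" if "m \<ge> max M1 M2" "n \<ge> max M1 M2" for m n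
  proof -
    have eq: "x m + y m - (x n + y n) = (x m - x n) + (y m - y n)" by simp
    have "nrm (x m + y m - (x n + y n)) \<le> nrm (x m - x n) + nrm (y m - y n)"
      unfolding eq using nrm_triangle[of "x m - x n" "y m - y n"] rep_in[OF assms(1)] rep_in[OF assms(2)] by simp
    then show ?thesis using M1[of m n] M2[of m n] that by simp
  qed
  then show "\<exists>M. \<forall>m\<ge>M. \<forall>n\<ge>M. nrm (x m + y m - (x n + y n)) < \<epsilon>" by blast
qed

lemma rep_map:
  assumes x: "rep x F" and T: "\<And>z. z \<in> V \<Longrightarrow> T z \<in> V" "\<And>y z. y \<in> V \<Longrightarrow> z \<in> V \<Longrightarrow> T (y - z) = T y - T z"
    and bound: "\<And>z. z \<in> V \<Longrightarrow> nrm (T z) \<le> B * nrm z"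
    and lim: "\<And>z. z \<in> V \<Longrightarrow> (\<lambda>n. g (T (x n)) z) \<longlonglongrightarrow> G z" and out: "\<And>z. z \<notin> V \<Longrightarrow> G z = 0"
  shows "rep (\<lambda>n. T (x n)) G"
  unfolding rep_def
proof (intro conjI allI impI ballI)
  show "T (x n) \<in> V" for n using x T rep_in by blast
  show "(\<lambda>n. g (T (x n)) z) \<longlonglongrightarrow> G z" if "z \<in> V" for z using lim that .
  show "G z = 0" if "z \<notin> V" for z using out that .
  fix \<epsilon> :: real assume e: "\<epsilon> > 0"
  then have "\<epsilon> / (\<bar>B\<bar> + 1) > 0" by (simp add: add_nonneg_pos)
  then obtain M where M: "\<And>m n. m \<ge> M \<Longrightarrow> n \<ge> M \<Longrightarrow> nrm (x m - x n) < \<epsilon> / (\<bar>B\<bar> + 1)"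
    using rep_Cauchy[OF x] by blast
  have "nrm (T (x m) - T (x n)) < \<epsilon>" if "m \<ge> M" "n \<ge> M" for m n
  proof -
    have V: "x m \<in> V" "x n \<in> V" "x m - x n \<in> V" using rep_in[OF x] by auto
    have "nrm (T (x m) - T (x n)) \<le> B * nrm (x m - x n)" using bound[OF V(3)] T(2)[OF V(1,2)] by simp
    also have "\<dots> \<le> (\<bar>B\<bar> + 1) * nrm (x m - x n)" using V by (intro mult_right_mono) auto
    also have "\<dots> < (\<bar>B\<bar> + 1) * (\<epsilon> / (\<bar>B\<bar> + 1))" using M[OF that] by (intro mult_strict_left_mono) auto
    also have "\<dots> = \<epsilon>" by (simp add: add_nonneg_pos)
    finally show ?thesis .
  qed
  then show "\<exists>M. \<forall>m\<ge>M. \<forall>n\<ge>M. nrm (T (x m) - T (x n)) < \<epsilon>" by blast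
qed

end

locale semi_inner_space = semi_inner V sc g
  for V :: "'u::ab_group_add set" and sc :: "complex \<Rightarrow> 'u \<Rightarrow> 'u" and g :: "'u \<Rightarrow> 'u \<Rightarrow> complex" +
  assumes sc_diff: "x \<in> V \<Longrightarrow> y \<in> V \<Longrightarrow> sc c (x - y) = sc c x - sc c y"
begin

lemma rep_scale: "rep x F \<Longrightarrow> rep (\<lambda>n. sc c (x n)) (hs c F)"
  by (rule rep_map[where B = "cmod c"])
     (auto simp: nrm_scale sc_diff g_scale hs_def rep_in rep_outside intro!: tendsto_mult_left rep_lim)

lemma rep_diff:
  assumes "rep x F" "rep y G" shows "rep (\<lambda>n. x n - y n) (F - G)"
proof -
  have "hs (- 1) G = - G" by (auto simp: hs_def)
  have a: "x n + sc (- 1) (y n) \<in> V" for n using assms rep_in by auto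
  \<comment> \<open>\<open>x n - y n\<close> and \<open>x n + sc (- 1) (y n)\<close> may be
    different vectors, but they have the same inner products with all of \<open>V\<close>, which is
    what \<open>rep\<close> depends on.\<close>
  have eq: "g (x n + sc (- 1) (y n)) z = g (x n - y n) z" if "z \<in> V" for n z
    using assms that by (simp add: g_add g_scale g_diff rep_in)
  have "rep (\<lambda>n. x n + sc (- 1) (y n)) (F + hs (- 1) G)" (is "rep ?u _")
    using rep_add[OF assms(1) rep_scale[OF assms(2)]] .
  moreover have "F + hs (- 1) G = F - G" by (auto simp: hs_def)
  ultimately have u: "rep ?u (F - G)" by simp
  have nn: "nrm (?u m - ?u n) = nrm ((x m - y m) - (x n - y n))" for m n
  proof -
    have V: "x m \<in> V" "x n \<in> V" "y m \<in> V" "y n \<in> V" using assms rep_in by auto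
    then have "g (?u m - ?u n) z = g ((x m - y m) - (x n - y n)) z" if "z \<in> V" for z
      using that by (simp add: g_diff g_add g_scale)
    moreover from this have "g z (?u m - ?u n) = g z ((x m - y m) - (x n - y n))" if "z \<in> V" for z
      using that V g_commute[of z "?u m - ?u n"] g_commute[of z "(x m - y m) - (x n - y n)"] by simp
    ultimately show ?thesis using V by (simp add: nrm_def)
  qed
  show ?thesis
    using u assms unfolding rep_def nn by (auto simp: eq)
qed

lemma rep_const: "x \<in> V \<Longrightarrow> rep (\<lambda>n. x) (emb x)"
  by (auto simp: rep_def emb_def)

lemma HC_rep: "F \<in> HC \<Longrightarrow> rep (SOME x. rep x F) F"
  unfolding HC_def using someI_ex[of "\<lambda>x. rep x F"] by blast

lemma rep_HC: "rep x F \<Longrightarrow> F \<in> HC"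
  by (auto simp: HC_def)

lemma rep_inner_convergent:
  assumes x: "rep x F" and y: "rep y G" shows "convergent (\<lambda>n. g (x n) (y n))"
proof (intro Cauchy_convergent CauchyI)
  fix e :: real assume e: "e > 0"
  obtain B1 where B1: "B1 > 0" "\<And>n. nrm (x n) \<le> B1" using rep_bounded[OF x] by blast
  obtain B2 where B2: "B2 > 0" "\<And>n. nrm (y n) \<le> B2" using rep_bounded[OF y] by blast
  have e1: "e / (2 * B2) > 0" and e2: "e / (2 * B1) > 0" using e B1 B2 by auto
  obtain M1 where M1: "\<And>m n. m \<ge> M1 \<Longrightarrow> n \<ge> M1 \<Longrightarrow> nrm (x m - x n) < e / (2 * B2)"
    using rep_Cauchy[OF x e1] by blast
  obtain M2 where M2: "\<And>m n. m \<ge> M2 \<Longrightarrow> n \<ge> M2 \<Longrightarrow> nrm (y m - y n) < e / (2 * B1)"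
    using rep_Cauchy[OF y e2] by blast
  have "cmod (g (x m) (y m) - g (x n) (y n)) < e" if mn: "m \<ge> max M1 M2" "n \<ge> max M1 M2" for m n
  proof -
    have V: "x m \<in> V" "x n \<in> V" "y m \<in> V" "y n \<in> V" using rep_in x y by auto
    have "g (x m) (y m) - g (x n) (y n) = g (x m - x n) (y m) + g (x n) (y m - y n)"
      using V by (simp add: g_diff g_diff_right)
    also have "cmod \<dots> \<le> cmod (g (x m - x n) (y m)) + cmod (g (x n) (y m - y n))" by (rule norm_triangle_ineq)
    also have "\<dots> \<le> nrm (x m - x n) * nrm (y m) + nrm (x n) * nrm (y m - y n)"
      using V by (intro add_mono cauchy_schwarz) auto
    also have "\<dots> \<le> nrm (x m - x n) * B2 + B1 * nrm (y m - y n)"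
      using V B1 B2 by (intro add_mono mult_left_mono mult_right_mono) auto
    also have "\<dots> < e / (2 * B2) * B2 + B1 * (e / (2 * B1))"
      using B1 B2 M1[of m n] M2[of m n] mn by (intro add_strict_mono mult_strict_left_mono mult_strict_right_mono) auto
    also have "\<dots> = e" using B1 B2 by (simp add: field_simps)
    finally show ?thesis .
  qed
  then show "\<exists>M. \<forall>m\<ge>M. \<forall>n\<ge>M. norm (g (x m) (y m) - g (x n) (y n)) < e" by blast
qed

lemma inner_null:
  assumes d: "rep d (\<lambda>z. 0)" and y: "rep y G"
  shows "(\<lambda>n. g (d n) (y n)) \<longlonglongrightarrow> 0" "(\<lambda>n. g (y n) (d n)) \<longlonglongrightarrow> 0"
proof -
  obtain B where B: "B > 0" "\<And>n. nrm (y n) \<le> B" using rep_bounded[OF y] by blast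
  have V: "d n \<in> V" "y n \<in> V" for n using rep_in d y by auto
  have 1: "cmod (g (d n) (y n)) \<le> nrm (d n) * B" for n
    using cauchy_schwarz[OF V(1) V(2), of n n] mult_left_mono[OF B(2) nrm_nonneg[OF V(1)], of n n] by linarith
  then show "(\<lambda>n. g (d n) (y n)) \<longlonglongrightarrow> 0"
    by (intro tendsto_0_le[OF rep_null[OF d], where K = B]) (simp add: V)
  have "cmod (g (y n) (d n)) \<le> nrm (d n) * B" for n
    using 1[of n] g_commute[OF V(2) V(1), of n n] by simp
  then show "(\<lambda>n. g (y n) (d n)) \<longlonglongrightarrow> 0"
    by (intro tendsto_0_le[OF rep_null[OF d], where K = B]) (simp add: V)
qed

lemma rep_inner:
  assumes x: "rep x F" and y: "rep y G" shows "(\<lambda>n. g (x n) (y n)) \<longlonglongrightarrow> ip F G"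
proof -
  define x' where "x' = (SOME x. rep x F)"
  define y' where "y' = (SOME y. rep y G)"
  have x': "rep x' F" unfolding x'_def by (rule someI[of "\<lambda>x. rep x F", OF x])
  have y': "rep y' G" unfolding y'_def by (rule someI[of "\<lambda>x. rep x G", OF y])
  have lim: "(\<lambda>n. g (x' n) (y' n)) \<longlonglongrightarrow> ip F G"
    using rep_inner_convergent[OF x' y'] unfolding ip_def x'_def y'_def convergent_LIMSEQ_iff .
  have dx: "rep (\<lambda>n. x n - x' n) (\<lambda>z. 0)" and dy: "rep (\<lambda>n. y n - y' n) (\<lambda>z. 0)"
    using rep_diff[OF x x'] rep_diff[OF y y'] by (simp_all add: zero_fun_def)
  have "(\<lambda>n. g (x n - x' n) (y n) + g (x' n) (y n - y' n) + g (x' n) (y' n)) \<longlonglongrightarrow> 0 + 0 + ip F G"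
    by (intro tendsto_add inner_null(1)[OF dx y] inner_null(2)[OF dy x'] lim)
  moreover have "g (x n - x' n) (y n) + g (x' n) (y n - y' n) + g (x' n) (y' n) = g (x n) (y n)" for n
    using rep_in[OF x] rep_in[OF x'] rep_in[OF y] rep_in[OF y'] by (simp add: g_diff g_diff_right)
  ultimately show ?thesis by simp
qed

lemma ip_emb: "F \<in> HC \<Longrightarrow> z \<in> V \<Longrightarrow> ip F (emb z) = F z"
  by (rule LIMSEQ_unique[OF rep_inner[OF HC_rep rep_const] rep_lim[OF HC_rep]])

lemma emb_HC [simp, intro]: "x \<in> V \<Longrightarrow> emb x \<in> HC"
  by (rule rep_HC[OF rep_const])

lemma HC_zero [simp, intro]: "0 \<in> HC"
proof -
  have "emb 0 = 0" by (auto simp: emb_def)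
  then show ?thesis by (metis V_zero emb_HC)
qed

lemma HC_add [simp, intro]: "F \<in> HC \<Longrightarrow> G \<in> HC \<Longrightarrow> F + G \<in> HC"
  and HC_diff [simp, intro]: "F \<in> HC \<Longrightarrow> G \<in> HC \<Longrightarrow> F - G \<in> HC"
  and HC_scale [simp, intro]: "F \<in> HC \<Longrightarrow> hs c F \<in> HC"
  by (rule rep_HC[OF rep_add[OF HC_rep HC_rep]] rep_HC[OF rep_diff[OF HC_rep HC_rep]]
      rep_HC[OF rep_scale[OF HC_rep]]; assumption)+

lemma ip_add: "F \<in> HC \<Longrightarrow> G \<in> HC \<Longrightarrow> K \<in> HC \<Longrightarrow> ip (F + G) K = ip F K + ip G K"
proof -
  assume A: "F \<in> HC" "G \<in> HC" "K \<in> HC"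
  then obtain x y z where r: "rep x F" "rep y G" "rep z K" by (auto simp: HC_def)
  have "(\<lambda>n. g (x n + y n) (z n)) \<longlonglongrightarrow> ip (F + G) K" using rep_inner[OF rep_add[OF r(1,2)] r(3)] .
  moreover have "(\<lambda>n. g (x n) (z n) + g (y n) (z n)) \<longlonglongrightarrow> ip F K + ip G K"
    by (intro tendsto_add rep_inner r)
  moreover have "g (x n + y n) (z n) = g (x n) (z n) + g (y n) (z n)" for n
    using r by (simp add: g_add rep_in)
  ultimately show ?thesis using LIMSEQ_unique by force
qed

lemma ip_scale: "F \<in> HC \<Longrightarrow> K \<in> HC \<Longrightarrow> ip (hs c F) K = c * ip F K"
proof -
  assume A: "F \<in> HC" "K \<in> HC"
  then obtain x z where r: "rep x F" "rep z K" by (auto simp: HC_def)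
  have "(\<lambda>n. g (sc c (x n)) (z n)) \<longlonglongrightarrow> ip (hs c F) K" using rep_inner[OF rep_scale[OF r(1)] r(2)] .
  moreover have "(\<lambda>n. c * g (x n) (z n)) \<longlonglongrightarrow> c * ip F K"
    by (intro tendsto_mult_left rep_inner r)
  moreover have "g (sc c (x n)) (z n) = c * g (x n) (z n)" for n
    using r by (simp add: g_scale rep_in)
  ultimately show ?thesis using LIMSEQ_unique by force
qed

lemma ip_commute: "F \<in> HC \<Longrightarrow> G \<in> HC \<Longrightarrow> ip F G = cnj (ip G F)"
proof -
  assume A: "F \<in> HC" "G \<in> HC"
  then obtain x y where r: "rep x F" "rep y G" by (auto simp: HC_def)
  have "(\<lambda>n. g (x n) (y n)) \<longlonglongrightarrow> ip F G" using rep_inner r by blast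
  moreover have "(\<lambda>n. cnj (g (y n) (x n))) \<longlonglongrightarrow> cnj (ip G F)"
    using rep_inner[OF r(2,1)] by (simp add: lim_cnj)
  moreover have "cnj (g (y n) (x n)) = g (x n) (y n)" for n
    using g_commute[OF rep_in[OF r(1)] rep_in[OF r(2)]] by simp
  ultimately show ?thesis using LIMSEQ_unique by force
qed

lemma ip_nonneg: "F \<in> HC \<Longrightarrow> 0 \<le> Re (ip F F)"
proof -
  assume "F \<in> HC"
  then obtain x where r: "rep x F" by (auto simp: HC_def)
  have "(\<lambda>n. Re (g (x n) (x n))) \<longlonglongrightarrow> Re (ip F F)" using rep_inner[OF r r] by (rule tendsto_Re)
  then show ?thesis using g_nonneg[OF rep_in[OF r]] by (intro LIMSEQ_le_const) auto
qed

text \<open>The completion is again an instance of \<open>semi_inner\<close>, so Cauchy--Schwarz and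
  the projection theorem hold in it without a second proof.\<close>

sublocale C: semi_inner HC hs ip
  by unfold_locales (auto intro: ip_add ip_scale ip_commute ip_nonneg)

lemma hnorm_eq: "hnorm ip = C.nrm"
  by (auto simp: hnorm_def C.nrm_def)

lemma hdist_eq: "hdist (+) hs ip = (\<lambda>F G. C.nrm (F - G))"
proof (intro ext)
  fix F G
  have "F + hs (- 1) G = F - G" by (auto simp: hs_def)
  then show "hdist (+) hs ip F G = C.nrm (F - G)" by (simp add: hdist_def hnorm_eq)
qed

lemma rep_nrm: assumes x: "rep x F" shows "(\<lambda>n. nrm (x n)) \<longlonglongrightarrow> C.nrm F"
  unfolding nrm_def C.nrm_def by (intro tendsto_real_sqrt tendsto_Re rep_inner x)

lemma nrm_emb: "x \<in> V \<Longrightarrow> C.nrm (emb x) = nrm x"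
  using rep_nrm[OF rep_const] by (simp add: LIMSEQ_const_iff)

lemma emb_diff: "x \<in> V \<Longrightarrow> y \<in> V \<Longrightarrow> emb (x - y) = emb x - emb y"
  by (auto simp: emb_def g_diff)

lemma approx_emb:
  assumes x: "rep x F" and e: "\<epsilon> > 0" shows "\<exists>M. \<forall>m\<ge>M. C.nrm (F - emb (x m)) < \<epsilon>"
proof -
  have e2: "\<epsilon> / 2 > 0" using e by simp
  obtain M where M: "\<And>m n. m \<ge> M \<Longrightarrow> n \<ge> M \<Longrightarrow> nrm (x m - x n) < \<epsilon> / 2"
    using rep_Cauchy[OF x e2] by blast
  have "C.nrm (F - emb (x m)) < \<epsilon>" if m: "m \<ge> M" for m
  proof -
    have "(\<lambda>n. nrm (x n - x m)) \<longlonglongrightarrow> C.nrm (F - emb (x m))"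
      by (rule rep_nrm[OF rep_diff[OF x rep_const[OF rep_in[OF x]]]])
    then have "C.nrm (F - emb (x m)) \<le> \<epsilon> / 2"
      using M m by (intro LIMSEQ_le_const2) (auto intro!: exI[of _ M] less_imp_le)
    then show ?thesis using e by simp
  qed
  then show ?thesis by blast
qed

lemma dense_emb: "F \<in> HC \<Longrightarrow> \<epsilon> > 0 \<Longrightarrow> \<exists>x\<in>V. C.nrm (F - emb x) < \<epsilon>"
  using approx_emb[OF HC_rep] rep_in[OF HC_rep] by (metis order_refl)

lemma HC_eq_zero: assumes "F \<in> HC" "\<And>z. z \<in> V \<Longrightarrow> F z = 0" shows "F = 0"
proof
  fix z show "F z = 0 z" using assms rep_outside[OF HC_rep[OF assms(1)], of z] by (cases "z \<in> V") auto
qed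

lemma C_nrm_eq_zero: assumes F: "F \<in> HC" "C.nrm F = 0" shows "F = 0"
proof (rule HC_eq_zero[OF F(1)])
  fix z assume z: "z \<in> V"
  have "cmod (ip F (emb z)) \<le> C.nrm F * C.nrm (emb z)" using F z by (intro C.cauchy_schwarz) auto
  then show "F z = 0" using F z by (simp add: ip_emb)
qed

text \<open>Approximating \<open>f m\<close> by an embedded vector within \<open>1 / (m + 1)\<close>
  turns a Cauchy sequence of functionals into a Cauchy sequence in \<open>V\<close>, whose
  functional is the limit.\<close>

lemma complete_HC: "complete_wrt HC (\<lambda>F G. C.nrm (F - G))"
  unfolding complete_wrt_def
proof (intro allI impI)
  fix f :: "nat \<Rightarrow> 'u \<Rightarrow> complex" assume f: "\<forall>m. f m \<in> HC" and Cau: "\<forall>\<epsilon>>0. \<exists>N. \<forall>m\<ge>N. \<forall>n\<ge>N. C.nrm (f m - f n) < \<epsilon>"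
  have "\<exists>x\<in>V. C.nrm (f m - emb x) < 1 / real (Suc m)" for m using dense_emb f by simp
  then obtain x where x: "\<And>m. x m \<in> V" "\<And>m. C.nrm (f m - emb (x m)) < 1 / real (Suc m)" by metis
  have xC: "\<exists>N. \<forall>m\<ge>N. \<forall>n\<ge>N. nrm (x m - x n) < \<epsilon>" if e: "\<epsilon> > 0" for \<epsilon>
  proof -
    have "\<epsilon> / 3 > 0" using e by simp
    then obtain N1 where N1: "\<And>m n. m \<ge> N1 \<Longrightarrow> n \<ge> N1 \<Longrightarrow> C.nrm (f m - f n) < \<epsilon> / 3" using Cau by blast
    obtain N2 where N2: "1 / real (Suc N2) < \<epsilon> / 3" using \<open>\<epsilon> / 3 > 0\<close> nat_approx_posE by blast
    have sm: "C.nrm (f m - emb (x m)) < \<epsilon> / 3" if "m \<ge> N2" for m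
    proof -
      have "1 / real (Suc m) \<le> 1 / real (Suc N2)" using that by (intro divide_left_mono) auto
      then show ?thesis using x(2)[of m] N2 by linarith
    qed
    have "nrm (x m - x n) < \<epsilon>" if "m \<ge> max N1 N2" "n \<ge> max N1 N2" for m n
    proof -
      have F: "f m \<in> HC" "f n \<in> HC" "emb (x m) \<in> HC" "emb (x n) \<in> HC" using f x by auto
      have "nrm (x m - x n) = C.nrm (emb (x m) - emb (x n))"
        using x(1) nrm_emb[of "x m - x n"] by (simp add: emb_diff)
      also have "\<dots> \<le> C.nrm (emb (x m) - f m) + C.nrm (f m - emb (x n))"
        using F by (intro C.nrm_diff_triangle)
      finally have "nrm (x m - x n) \<le> C.nrm (emb (x m) - f m) + C.nrm (f m - emb (x n))" .
      moreover have "C.nrm (f m - emb (x n)) \<le> C.nrm (f m - f n) + C.nrm (f n - emb (x n))"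
        using F by (intro C.nrm_diff_triangle)
      moreover have "C.nrm (emb (x m) - f m) = C.nrm (f m - emb (x m))" using F by (intro C.nrm_diff_commute)
      moreover have "m \<ge> N1" "m \<ge> N2" "n \<ge> N1" "n \<ge> N2" using that by auto
      ultimately show ?thesis using sm[of m] sm[of n] N1[of m n] by linarith
    qed
    then show ?thesis by blast
  qed
  have conv: "convergent (\<lambda>n. g (x n) z)" if z: "z \<in> V" for z
  proof (intro Cauchy_convergent CauchyI)
    fix e :: real assume e: "e > 0"
    then have "e / (nrm z + 1) > 0" using z by (simp add: add_nonneg_pos)
    then obtain N where N: "\<And>m n. m \<ge> N \<Longrightarrow> n \<ge> N \<Longrightarrow> nrm (x m - x n) < e / (nrm z + 1)" using xC by blast
    have "cmod (g (x m) z - g (x n) z) < e" if "m \<ge> N" "n \<ge> N" for m n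
    proof -
      have nz: "nrm z + 1 > 0" using z by (simp add: add_nonneg_pos)
      have "cmod (g (x m) z - g (x n) z) \<le> nrm (x m - x n) * nrm z"
        using cauchy_schwarz[of "x m - x n" z] x z by (simp add: g_diff)
      also have "\<dots> \<le> nrm (x m - x n) * (nrm z + 1)" using x by (intro mult_left_mono) auto
      also have "\<dots> < e" using N[OF that] nz by (simp add: pos_less_divide_eq)
      finally show ?thesis .
    qed
    then show "\<exists>M. \<forall>m\<ge>M. \<forall>n\<ge>M. norm (g (x m) z - g (x n) z) < e" by blast
  qed
  define F where "F z = (if z \<in> V then lim (\<lambda>n. g (x n) z) else 0)" for z
  have r: "rep x F" unfolding rep_def using x(1) xC conv by (auto simp: F_def convergent_LIMSEQ_iff)
  have FH: "F \<in> HC" using r by (rule rep_HC)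
  have "(\<lambda>m. C.nrm (f m - F)) \<longlonglongrightarrow> 0"
  proof (rule LIMSEQ_I)
    fix e :: real assume e: "e > 0"
    then have e2: "e / 2 > 0" by simp
    obtain M where M: "\<And>m. m \<ge> M \<Longrightarrow> C.nrm (F - emb (x m)) < e / 2" using approx_emb[OF r e2] by blast
    obtain N2 where N2: "1 / real (Suc N2) < e / 2" using e2 nat_approx_posE by blast
    have "norm (C.nrm (f m - F) - 0) < e" if m: "m \<ge> max M N2" for m
    proof -
      have V: "f m \<in> HC" "emb (x m) \<in> HC" using f x by auto
      have "1 / real (Suc m) \<le> 1 / real (Suc N2)" using m by (intro divide_left_mono) auto
      then have "C.nrm (f m - emb (x m)) < e / 2" using x(2)[of m] N2 by linarith
      moreover have "C.nrm (emb (x m) - F) < e / 2" using M[of m] m C.nrm_diff_commute[OF V(2) FH] by simp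
      moreover have "C.nrm (f m - F) \<le> C.nrm (f m - emb (x m)) + C.nrm (emb (x m) - F)"
        using V FH by (intro C.nrm_diff_triangle)
      ultimately show ?thesis using V FH by simp
    qed
    then show "\<exists>no. \<forall>n\<ge>no. norm (C.nrm (f n - F) - 0) < e" by blast
  qed
  then show "\<exists>F\<in>HC. (\<lambda>m. C.nrm (f m - F)) \<longlonglongrightarrow> 0" using FH by blast
qed

theorem hilbert_space_HC: "hilbert_space HC (+) 0 hs ip"
proof -
  have "F = 0" if "F \<in> HC" "ip F F = 0" for F
    using C_nrm_eq_zero[OF that(1)] that(2) by (simp add: C.nrm_def)
  moreover have "Im (ip F F) = 0" if "F \<in> HC" for F using C.g_self[OF that] by simp
  moreover have "complete_wrt HC (hdist (+) hs ip)" using complete_HC by (simp add: hdist_eq)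
  moreover have "hs c (F + G) = hs c F + hs c G" "hs (c + d) F = hs c F + hs d F"
    "hs c (hs d F) = hs (c * d) F" "hs 1 F = F" "F + hs (- 1) F = 0" for c d F G
    by (auto simp: hs_def fun_eq_iff algebra_simps)
  ultimately show ?thesis unfolding hilbert_space_def
    by (intro conjI ballI allI impI)
       (assumption | rule ip_commute | simp add: ip_add ip_scale ip_nonneg add.assoc | simp add: add.commute)+
qed

end

section \<open>Representations of extreme states\<close>

context spectral_cstar
begin

text \<open>Positivity follows from the bound by \<open>N\<close> together with
  \<open>\<phi> 1 = 1\<close>, see \<open>phi_pos\<close>. In this form a state is what domination
  of a functional by a seminorm produces.\<close>

definition state :: "('u \<Rightarrow> complex) \<Rightarrow> bool" where
  "state \<phi> \<longleftrightarrow> (\<forall>x\<in>S. \<forall>y\<in>S. \<phi> (x + y) = \<phi> x + \<phi> y) \<and> (\<forall>c. \<forall>x\<in>S. \<phi> (\<iota> c * x) = c * \<phi> x) \<and>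
     \<phi> 1 = 1 \<and> (\<forall>x\<in>S. cmod (\<phi> x) \<le> N x)"

lemma state_of_real_functional:
  assumes f: "rlin f" "\<And>x. x \<in> S \<Longrightarrow> f x \<le> N x" "f 1 = 1"
  shows "state (\<lambda>x. Complex (f x) (- f (\<iota> \<i> * x)))" (is "state ?\<phi>")
proof -
  have ii: "\<iota> \<i> * (\<iota> \<i> * x) = - x" for x by (simp add: iota_left_mult iota_minus)
  have add: "?\<phi> (x + y) = ?\<phi> x + ?\<phi> y" if "x \<in> S" "y \<in> S" for x y
    using f(1) that by (simp add: rlin_def distrib_left complex_eq_iff)
  have scale: "?\<phi> (\<iota> c * x) = c * ?\<phi> x" if x: "x \<in> S" for c x
  proof -
    have c: "\<iota> c * x = R (Re c) * x + R (Im c) * (\<iota> \<i> * x)"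
    proof -
      have "c = of_real (Re c) + of_real (Im c) * \<i>" by (simp add: complex_eq_iff)
      then have "\<iota> c = R (Re c) + R (Im c) * \<iota> \<i>" by (metis R_def iota_add iota_mult)
      then show ?thesis by (simp add: distrib_right mult.assoc)
    qed
    have ic: "\<iota> \<i> * (\<iota> c * x) = R (Re c) * (\<iota> \<i> * x) + R (Im c) * (- x)"
      unfolding c by (simp add: distrib_left central[OF iota_closed] ii)
    have "f (\<iota> c * x) = Re c * f x + Im c * f (\<iota> \<i> * x)"
      unfolding c using f(1) x by (simp add: rlin_def)
    moreover have "f (\<iota> \<i> * (\<iota> c * x)) = Re c * f (\<iota> \<i> * x) - Im c * f x"
      unfolding ic using f(1) x rlin_minus[OF f(1) x] uminus_closed[OF x] unfolding rlin_def
      by (metis (no_types, lifting) iota_closed mult_closed R_closed mult_minus_right add_uminus_conv_diff)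
    ultimately show ?thesis by (simp add: complex_eq_iff)
  qed
  have bound: "cmod (?\<phi> x) \<le> N x" if x: "x \<in> S" for x
  proof (cases "?\<phi> x = 0")
    case True then show ?thesis using x by simp
  next
    case False
    define l where "l = cnj (?\<phi> x) / of_real (cmod (?\<phi> x))"
    have l: "cmod l = 1" using False by (simp add: l_def norm_divide)
    have "l * ?\<phi> x = of_real (cmod (?\<phi> x))"
      using False complex_norm_square[of "?\<phi> x"]
      by (simp add: l_def divide_simps power2_eq_square mult.commute)
    then have "of_real (cmod (?\<phi> x)) = ?\<phi> (\<iota> l * x)" using scale[OF x] by simp
    then have "cmod (?\<phi> x) = f (\<iota> l * x)" by (metis Re_complex_of_real complex.sel(1))
    also have "\<dots> \<le> N (\<iota> l * x)" using f(2) x by simp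
    also have "\<dots> = N x" using x l by (simp add: N_scale)
    finally show ?thesis .
  qed
  have "cmod (?\<phi> 1) \<le> 1" using bound[of 1] by simp
  then have "(f (\<iota> \<i> * 1)) ^ 2 \<le> 0" using f(3) by (simp add: cmod_def)
  then have "?\<phi> 1 = 1" using f(3) by (simp add: complex_eq_iff)
  then show ?thesis unfolding state_def using add scale bound by blast
qed

end

section \<open>The GNS representation of a state\<close>

locale cstar_state = spectral_cstar S \<iota> star N
  for S :: "'u::ring_1 set" and \<iota> :: "complex \<Rightarrow> 'u" and star :: "'u \<Rightarrow> 'u" and N :: "'u \<Rightarrow> real" +
  fixes \<phi> :: "'u \<Rightarrow> complex"
  assumes state: "state \<phi>"
begin

lemma phi_add: "x \<in> S \<Longrightarrow> y \<in> S \<Longrightarrow> \<phi> (x + y) = \<phi> x + \<phi> y"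
  and phi_scale: "x \<in> S \<Longrightarrow> \<phi> (\<iota> c * x) = c * \<phi> x"
  and phi_one [simp]: "\<phi> 1 = 1"
  and phi_bound: "x \<in> S \<Longrightarrow> cmod (\<phi> x) \<le> N x"
  using state by (auto simp: state_def)

lemma phi_iota: "\<phi> (\<iota> c) = c"
  using phi_scale[of 1 c] by simp

lemma phi_R: "\<phi> (R t) = of_real t"
  by (simp add: R_def phi_iota)

lemma phi_diff: "x \<in> S \<Longrightarrow> y \<in> S \<Longrightarrow> \<phi> (x - y) = \<phi> x - \<phi> y"
  using phi_add[of "x - y" y] by simp

text \<open>Adding \<open>i l\<close> to \<open>h\<close> raises the squared norm bound by
  \<open>l^2\<close> only, but the squared modulus of the value by \<open>2 b l + l^2\<close>. A
  large \<open>l\<close> with the sign of \<open>b\<close> contradicts the bound by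
  \<open>N\<close>.\<close>

lemma phi_sa_real: assumes h: "sa h" shows "Im (\<phi> h) = 0"
proof (rule ccontr)
  define a b where "a = Re (\<phi> h)" and "b = Im (\<phi> h)"
  assume "Im (\<phi> h) \<noteq> 0"
  then have b: "b \<noteq> 0" by (simp add: b_def)
  have hS: "h \<in> S" "star h = h" using h by (auto simp: sa_def)
  have ineq: "a ^ 2 + b ^ 2 + 2 * b * l \<le> N h ^ 2" for l :: real
  proof -
    let ?x = "h + \<iota> (of_real l * \<i>)"
    have x: "?x \<in> S" using hS by simp
    define c where "c = complex_of_real l * \<i>"
    have sx: "star (h + \<iota> c) = h - \<iota> c" using hS by (simp add: c_def flip: iota_minus)
    have cc: "c * c = - of_real (l ^ 2)" by (simp add: c_def power2_eq_square algebra_simps)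
    have "(h - \<iota> c) * (h + \<iota> c) = h * h - \<iota> c * \<iota> c"
      by (simp add: left_diff_distrib distrib_left central[OF hS(1)])
    also have "\<dots> = h * h + R (l ^ 2)"
      unfolding iota_iota cc iota_minus R_def by simp
    finally have "star ?x * ?x = h * h + R (l ^ 2)" using sx unfolding c_def by simp
    then have "N ?x ^ 2 = N (h * h + R (l ^ 2))" using N_cstar[OF x] by simp
    also have "\<dots> \<le> N h ^ 2 + l ^ 2" using N_triangle[of "h * h" "R (l ^ 2)"] hS N_sq[OF h] by simp
    finally have 1: "N ?x ^ 2 \<le> N h ^ 2 + l ^ 2" .
    have "\<phi> ?x = Complex a (b + l)" using hS by (simp add: phi_add phi_iota a_def b_def complex_eq_iff)
    then have "a ^ 2 + (b + l) ^ 2 \<le> N ?x ^ 2"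
      using power_mono[OF phi_bound[OF x], of 2] by (simp add: cmod_def)
    then show ?thesis using 1 by (simp add: power2_sum)
  qed
  have "a ^ 2 + b ^ 2 + 2 * b * ((N h ^ 2 + 1) / (2 * b)) \<le> N h ^ 2" by (rule ineq)
  moreover have "2 * b * ((N h ^ 2 + 1) / (2 * b)) = N h ^ 2 + 1" using b by simp
  moreover have "0 \<le> a ^ 2" "0 \<le> b ^ 2" by simp_all
  ultimately show False by linarith
qed

lemma phi_star: assumes x: "x \<in> S" shows "\<phi> (star x) = cnj (\<phi> x)"
proof -
  have "sa (x + star x)" "sa (\<iota> \<i> * (x - star x))"
    using x by (auto simp: sa_def add.commute iota_minus iota_comm algebra_simps)
  then have "Im (\<phi> (x + star x)) = 0" "Im (\<phi> (\<iota> \<i> * (x - star x))) = 0" by (auto intro: phi_sa_real)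
  then show ?thesis using x by (simp add: phi_add phi_scale phi_diff complex_eq_iff)
qed

lemma phi_pos: assumes "pos h" shows "0 \<le> Re (\<phi> h)"
proof -
  from assms obtain t where t: "t \<ge> 0" "N (R t - h) \<le> t" by (auto simp: pos_def)
  have "Re (\<phi> (R t - h)) \<le> t"
    using phi_bound[of "R t - h"] complex_Re_le_cmod[of "\<phi> (R t - h)"] t assms by (simp add: pos_closedS)
  then show ?thesis using assms by (simp add: phi_diff phi_R pos_closedS)
qed

text \<open>This is where \<open>pos_star_mult\<close> enters: it is the nonnegativity of the GNS
  form.\<close>

sublocale G: semi_inner_space S "\<lambda>c x. \<iota> c * x" "\<lambda>x y. \<phi> (star y * x)"
proof unfold_locales
  show "\<phi> (star y * x) = cnj (\<phi> (star x * y))" if "x \<in> S" "y \<in> S" for x y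
    using phi_star[of "star x * y"] that by simp
  show "0 \<le> Re (\<phi> (star x * x))" if "x \<in> S" for x
    using phi_pos[OF pos_star_mult[OF that]] .
qed (auto simp: distrib_left right_diff_distrib phi_add phi_scale central)

text \<open>A vector \<open>F\<close> returns inner products with elements of \<open>S\<close>, so
  \<open>\<pi> a F\<close> at \<open>z\<close> has to be the product of \<open>F\<close> with
  \<open>star a * z\<close>. The operators thus act on the whole completion at once, without an
  extension by continuity.\<close>

definition \<pi> :: "'u \<Rightarrow> ('u \<Rightarrow> complex) \<Rightarrow> 'u \<Rightarrow> complex" where
  "\<pi> a F = (\<lambda>z. if z \<in> S then F (star a * z) else 0)"

text \<open>If \<open>u\<close> is a square root of \<open>N a ^ 2 - star a * a + \<eta>\<close>,
  then \<open>0 \<le> Re (\<phi> (star (u * b) * (u * b)))\<close> is the squared inequality up to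
  an error proportional to \<open>\<eta>\<close>.\<close>

lemma nrm_mult_le: assumes a: "a \<in> S" and b: "b \<in> S" shows "G.nrm (a * b) \<le> N a * G.nrm b"
proof (rule power2_le_imp_le)
  have "pos (R (N a ^ 2) - star a * a)" using a by (intro pos_R_minus) (auto simp: N_cstar)
  have key: "Re (\<phi> (star (a * b) * (a * b))) \<le> N a ^ 2 * Re (\<phi> (star b * b)) + \<eta> * Re (\<phi> (star b * b))"
    if e: "\<eta> > 0" for \<eta>
  proof -
    obtain u where u: "sa u" "u * u = R (N a ^ 2) - star a * a + R \<eta>"
      using pos_square_root[OF \<open>pos (R (N a ^ 2) - star a * a)\<close> e] by blast
    have uS: "u \<in> S" "star u = u" using u by (auto simp: sa_def)
    have "star (u * b) * (u * b) = star b * (u * u) * b" using uS b by (simp add: mult.assoc)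
    also have "\<dots> = R (N a ^ 2) * (star b * b) - star (a * b) * (a * b) + R \<eta> * (star b * b)"
      using a b by (simp add: u distrib_left distrib_right right_diff_distrib left_diff_distrib mult.assoc central)
    finally have "0 \<le> Re (\<phi> (R (N a ^ 2) * (star b * b) - star (a * b) * (a * b) + R \<eta> * (star b * b)))"
      using phi_pos[OF pos_star_mult[of "u * b"]] uS b by simp
    then show ?thesis using a b by (simp add: phi_add phi_diff phi_scale R_def)
  qed
  have "Re (\<phi> (star (a * b) * (a * b))) \<le> N a ^ 2 * Re (\<phi> (star b * b))"
  proof (rule field_le_epsilon)
    fix e :: real assume e: "e > 0"
    define r where "r = Re (\<phi> (star b * b))"
    have r: "r \<ge> 0" unfolding r_def by (rule phi_pos[OF pos_star_mult[OF b]])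
    have "e / (r + 1) > 0" using e r by simp
    from key[OF this] have "Re (\<phi> (star (a * b) * (a * b))) \<le> N a ^ 2 * r + e / (r + 1) * r"
      unfolding r_def .
    moreover have "e / (r + 1) * r \<le> e" using e r by (simp add: field_simps)
    ultimately show "Re (\<phi> (star (a * b) * (a * b))) \<le> N a ^ 2 * Re (\<phi> (star b * b)) + e"
      unfolding r_def by linarith
  qed
  then show "(G.nrm (a * b)) ^ 2 \<le> (N a * G.nrm b) ^ 2"
    using a b by (simp add: G.nrm_sq power_mult_distrib)
  show "0 \<le> N a * G.nrm b" using a b by simp
qed

lemma rep_pi: assumes x: "G.rep x F" and a: "a \<in> S" shows "G.rep (\<lambda>n. a * x n) (\<pi> a F)"
proof (rule G.rep_map[OF x, where B = "N a"])
  fix z assume z: "z \<in> S"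
  have eq: "star z * (a * x n) = star (star a * z) * x n" for n
    using z a by (simp add: mult.assoc)
  show "(\<lambda>n. \<phi> (star z * (a * x n))) \<longlonglongrightarrow> \<pi> a F z"
    unfolding eq using G.rep_lim[OF x, of "star a * z"] z a by (simp add: \<pi>_def)
qed (use a in \<open>auto simp: \<pi>_def right_diff_distrib intro: nrm_mult_le\<close>)

lemma pi_HC [simp, intro]: "F \<in> G.HC \<Longrightarrow> a \<in> S \<Longrightarrow> \<pi> a F \<in> G.HC"
  by (rule G.rep_HC[OF rep_pi[OF G.HC_rep]])

lemma pi_bound: assumes F: "F \<in> G.HC" and a: "a \<in> S" shows "G.C.nrm (\<pi> a F) \<le> N a * G.C.nrm F"
proof -
  obtain x where x: "G.rep x F" using F by (auto simp: G.HC_def)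
  show ?thesis
  proof (rule LIMSEQ_le[OF G.rep_nrm[OF rep_pi[OF x a]] tendsto_mult_left[OF G.rep_nrm[OF x]]])
    show "\<exists>N'. \<forall>n\<ge>N'. G.nrm (a * x n) \<le> N a * G.nrm (x n)"
      using nrm_mult_le[OF a G.rep_in[OF x]] by blast
  qed
qed

lemma pi_adjoint:
  assumes F: "F \<in> G.HC" and K: "K \<in> G.HC" and a: "a \<in> S"
  shows "G.ip (\<pi> (star a) F) K = G.ip F (\<pi> a K)"
proof -
  obtain x y where r: "G.rep x F" "G.rep y K" using F K by (auto simp: G.HC_def)
  have "star (y n) * (star a * x n) = star (a * y n) * x n" for n
    using a G.rep_in[OF r(2)] by (simp add: mult.assoc)
  then show ?thesis
    using G.rep_inner[OF rep_pi[OF r(1) star_closed[OF a]] r(2)] G.rep_inner[OF r(1) rep_pi[OF r(2) a]]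
    by (auto intro: LIMSEQ_unique)
qed

lemma pi_emb: "x \<in> S \<Longrightarrow> a \<in> S \<Longrightarrow> \<pi> a (G.emb x) = G.emb (a * x)"
  by (auto simp: \<pi>_def G.emb_def mult.assoc)

lemma HC_linear:
  assumes F: "F \<in> G.HC"
  shows "x \<in> S \<Longrightarrow> y \<in> S \<Longrightarrow> F (x + y) = F x + F y" "x \<in> S \<Longrightarrow> F (\<iota> c * x) = cnj c * F x"
proof -
  obtain u where r: "G.rep u F" using F by (auto simp: G.HC_def)
  show "F (x + y) = F x + F y" if "x \<in> S" "y \<in> S"
  proof (rule LIMSEQ_unique)
    show "(\<lambda>n. \<phi> (star (x + y) * u n)) \<longlonglongrightarrow> F (x + y)" using G.rep_lim[OF r] that by blast
    show "(\<lambda>n. \<phi> (star (x + y) * u n)) \<longlonglongrightarrow> F x + F y"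
      using tendsto_add[OF G.rep_lim[OF r that(1)] G.rep_lim[OF r that(2)]] that G.rep_in[OF r]
      by (simp add: distrib_right phi_add)
  qed
  show "F (\<iota> c * x) = cnj c * F x" if "x \<in> S"
  proof (rule LIMSEQ_unique)
    show "(\<lambda>n. \<phi> (star (\<iota> c * x) * u n)) \<longlonglongrightarrow> F (\<iota> c * x)" using G.rep_lim[OF r] that by blast
    show "(\<lambda>n. \<phi> (star (\<iota> c * x) * u n)) \<longlonglongrightarrow> cnj c * F x"
      using tendsto_mult_left[OF G.rep_lim[OF r that], of "cnj c"] that G.rep_in[OF r]
      by (simp add: iota_comm mult.assoc phi_scale)
  qed
qed

lemma pi_iota: "F \<in> G.HC \<Longrightarrow> \<pi> (\<iota> c) F = G.hs c F"
  by (auto simp: \<pi>_def G.hs_def HC_linear G.rep_outside[OF G.HC_rep])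

theorem pi_star_representation:
  "star_representation S (\<lambda>c x. \<iota> c * x) star G.HC (+) 0 G.hs G.ip \<pi>"
  unfolding star_representation_def
proof (intro conjI ballI allI)
  show "hilbert_space G.HC (+) 0 G.hs G.ip" by (rule G.hilbert_space_HC)
  fix a F assume a: "a \<in> S" and F: "F \<in> G.HC"
  show "\<pi> a F \<in> G.HC" using a F by blast
  show "\<pi> a (F + K) = \<pi> a F + \<pi> a K" for K by (auto simp: \<pi>_def)
  show "\<pi> a (G.hs c F) = G.hs c (\<pi> a F)" for c by (auto simp: \<pi>_def G.hs_def)
  show "\<pi> (a + b) F = \<pi> a F + \<pi> b F" if "b \<in> S" for b
    using a F that by (auto simp: \<pi>_def distrib_right HC_linear)
  show "\<pi> (\<iota> c * a) F = G.hs c (\<pi> a F)" for c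
    using a F by (auto simp: \<pi>_def G.hs_def HC_linear iota_comm mult.assoc)
  show "\<pi> (a * b) F = \<pi> a (\<pi> b F)" if "b \<in> S" for b
    using a that by (auto simp: \<pi>_def mult.assoc)
  show "G.ip (\<pi> (star a) F) K = G.ip F (\<pi> a K)" if "K \<in> G.HC" for K
    using pi_adjoint[OF F that a] .
next
  fix a assume "a \<in> S"
  then show "\<exists>M. \<forall>F\<in>G.HC. hnorm G.ip (\<pi> a F) \<le> M * hnorm G.ip F"
    using pi_bound unfolding G.hnorm_eq by blast
qed

text \<open>The inner product of \<open>\<pi> y F\<close> with \<open>z\<close> is a limit of values
  of \<open>\<phi>\<close> at \<open>star z * y * u n\<close>, and these elements lie in the
  ideal.\<close>

lemma pi_kills:
  assumes I: "\<And>a x. a \<in> S \<Longrightarrow> x \<in> I \<Longrightarrow> a * x \<in> I \<and> x * a \<in> I" "I \<subseteq> S" "\<And>x. x \<in> I \<Longrightarrow> \<phi> x = 0"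
    and y: "y \<in> I" and F: "F \<in> G.HC"
  shows "\<pi> y F = 0"
proof
  fix z
  have yS: "y \<in> S" using y I by blast
  obtain u where r: "G.rep u F" using F by (auto simp: G.HC_def)
  show "\<pi> y F z = 0 z"
  proof (cases "z \<in> S")
    case True
    have "star z * y * u n \<in> I" for n using I(1) y True G.rep_in[OF r] by blast
    then have "\<phi> (star (star y * z) * u n) = 0" for n using True yS I(3) by simp
    then have "(\<lambda>n. 0) \<longlonglongrightarrow> F (star y * z)" using G.rep_lim[OF r, of "star y * z"] True yS by simp
    then show ?thesis using True by (simp add: \<pi>_def LIMSEQ_const_iff)
  qed (simp add: \<pi>_def)
qed

lemma vector_state:
  assumes e: "\<eta> \<in> G.HC" "G.C.nrm \<eta> > 0"
  defines "\<psi> \<equiv> \<lambda>x. G.ip (\<pi> x \<eta>) \<eta> / of_real (G.C.nrm \<eta> ^ 2)"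
  shows "state \<psi>"
proof -
  have rp: "\<pi> (x + y) \<eta> = \<pi> x \<eta> + \<pi> y \<eta>" "\<pi> (\<iota> c * x) \<eta> = G.hs c (\<pi> x \<eta>)" if "x \<in> S" "y \<in> S" for x y c
    using pi_star_representation e(1) that unfolding star_representation_def by blast+
  have "\<psi> 1 = 1"
  proof -
    have "\<pi> 1 \<eta> = \<eta>" using pi_iota[OF e(1), of 1] by (simp add: G.hs_def)
    then show ?thesis using e by (simp add: \<psi>_def G.C.g_self)
  qed
  moreover have "cmod (\<psi> x) \<le> N x" if x: "x \<in> S" for x
  proof -
    have "cmod (G.ip (\<pi> x \<eta>) \<eta>) \<le> G.C.nrm (\<pi> x \<eta>) * G.C.nrm \<eta>"
      using e x by (intro G.C.cauchy_schwarz) auto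
    also have "\<dots> \<le> N x * G.C.nrm \<eta> * G.C.nrm \<eta>" using pi_bound[OF e(1) x] e by (simp add: mult_right_mono)
    finally have "cmod (G.ip (\<pi> x \<eta>) \<eta>) \<le> N x * G.C.nrm \<eta> ^ 2" by (simp add: power2_eq_square mult.assoc)
    moreover have "cmod (of_real (G.C.nrm \<eta> ^ 2)) = G.C.nrm \<eta> ^ 2" by (simp only: norm_of_real) simp
    ultimately show ?thesis using e unfolding \<psi>_def norm_divide by (simp add: pos_divide_le_eq)
  qed
  ultimately show ?thesis unfolding state_def
    using e rp by (auto simp: \<psi>_def G.ip_add G.ip_scale add_divide_distrib)
qed

text \<open>Project the cyclic vector onto \<open>K\<close>. If neither component is zero,
  \<open>\<phi>\<close> is a proper convex combination of the two normalized vector states, both of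
  which vanish on \<open>I\<close>. Extremality makes the first of them \<open>\<phi>\<close>
  itself, so the projection is a multiple of the cyclic vector, which therefore lies in
  \<open>K\<close>.\<close>

theorem pi_irreducible:
  assumes I: "\<And>a x. a \<in> S \<Longrightarrow> x \<in> I \<Longrightarrow> a * x \<in> I \<and> x * a \<in> I" "I \<subseteq> S" "\<And>x. x \<in> I \<Longrightarrow> \<phi> x = 0"
    and extreme: "\<And>\<psi>1 \<psi>2 t x. state \<psi>1 \<Longrightarrow> state \<psi>2 \<Longrightarrow> 0 < t \<Longrightarrow> t < 1 \<Longrightarrow> (\<And>y. y \<in> I \<Longrightarrow> \<psi>1 y = 0) \<Longrightarrow>
      (\<And>y. y \<in> I \<Longrightarrow> \<psi>2 y = 0) \<Longrightarrow>
      (\<And>x. x \<in> S \<Longrightarrow> \<phi> x = of_real t * \<psi>1 x + of_real (1 - t) * \<psi>2 x) \<Longrightarrow> x \<in> S \<Longrightarrow> \<psi>1 x = \<phi> x"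
    and K: "closed_subspace K G.HC (+) 0 G.hs G.ip" "\<And>a F. a \<in> S \<Longrightarrow> F \<in> K \<Longrightarrow> \<pi> a F \<in> K"
  shows "K = {0} \<or> K = G.HC"
proof -
  have KH: "K \<subseteq> G.HC" and K0: "0 \<in> K" and Kadd: "\<And>x y. x \<in> K \<Longrightarrow> y \<in> K \<Longrightarrow> x + y \<in> K"
    and Ksc: "\<And>c x. x \<in> K \<Longrightarrow> G.hs c x \<in> K"
    and Kcl: "closed_in_wrt K G.HC (\<lambda>F G. G.C.nrm (F - G))"
    using K(1) unfolding closed_subspace_def G.hdist_eq by blast+
  define \<xi> where "\<xi> = G.emb 1"
  have xi: "\<xi> \<in> G.HC" by (simp add: \<xi>_def)
  have pxi: "\<pi> x \<xi> = G.emb x" if "x \<in> S" for x using that by (simp add: \<xi>_def pi_emb)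
  obtain \<xi>1 where x1: "\<xi>1 \<in> K" and orth: "\<And>y. y \<in> K \<Longrightarrow> G.ip (\<xi> - \<xi>1) y = 0"
    using G.C.orthogonal_projection_exists[OF G.complete_HC KH K0 Kadd Ksc Kcl xi] by blast
  have x1H: "\<xi>1 \<in> G.HC" using x1 KH by blast
  define \<xi>2 where "\<xi>2 = \<xi> - \<xi>1"
  have x2H: "\<xi>2 \<in> G.HC" using xi x1H by (simp add: \<xi>2_def)
  have full: "K = G.HC" if xK: "\<xi> \<in> K"
  proof
    show "G.HC \<subseteq> K"
    proof
      fix F assume F: "F \<in> G.HC"
      have eK: "G.emb x \<in> K" if "x \<in> S" for x using K(2)[OF that xK] pxi[OF that] by simp
      have "\<exists>x\<in>S. G.C.nrm (F - G.emb x) < 1 / real (Suc m)" for m using G.dense_emb[OF F] by simp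
      then obtain x where x: "\<And>m. x m \<in> S" "\<And>m. G.C.nrm (F - G.emb (x m)) < 1 / real (Suc m)" by metis
      have le: "G.C.nrm (G.emb (x m) - F) \<le> 1 / real (Suc m)" for m
        using x(2)[of m] G.C.nrm_diff_commute[OF F G.emb_HC[OF x(1)], of m] by linarith
      have ge: "0 \<le> G.C.nrm (G.emb (x m) - F)" for m
        by (rule G.C.nrm_nonneg[OF G.HC_diff[OF G.emb_HC[OF x(1)] F]])
      have "(\<lambda>m. G.C.nrm (G.emb (x m) - F)) \<longlonglongrightarrow> 0"
        by (rule tendsto_sandwich[OF _ _ tendsto_const LIMSEQ_inverse_real_of_nat])
           (use le ge in \<open>simp_all add: inverse_eq_divide\<close>)
      then show "F \<in> K"
        by (rule Kcl[unfolded closed_in_wrt_def, rule_format, of "\<lambda>m. G.emb (x m)", OF eK[OF x(1)] F])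
    qed
  qed (rule KH)
  have zero: "K = {0}" if x10: "\<xi>1 = 0"
  proof -
    have "F = 0" if F: "F \<in> K" for F
    proof (rule G.HC_eq_zero)
      show FH: "F \<in> G.HC" using F KH by blast
      fix z assume z: "z \<in> S"
      have "F z = G.ip F (\<pi> z \<xi>)" using FH z by (simp add: pxi G.ip_emb)
      also have "\<dots> = G.ip (\<pi> (star z) F) \<xi>" using pi_adjoint[OF FH xi z] by simp
      also have "\<dots> = cnj (G.ip \<xi> (\<pi> (star z) F))" using FH xi z by (intro G.ip_commute) auto
      also have "\<dots> = 0" using orth[OF K(2)[OF star_closed[OF z] F]] x10 by simp
      finally show "F z = 0" .
    qed
    then show ?thesis using K0 by blast
  qed
  show ?thesis
  proof (cases "G.C.nrm \<xi>1 = 0 \<or> G.C.nrm \<xi>2 = 0")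
    case True
    then show ?thesis
    proof
      assume "G.C.nrm \<xi>1 = 0"
      then show ?thesis using G.C_nrm_eq_zero[OF x1H] zero by blast
    next
      assume "G.C.nrm \<xi>2 = 0"
      then have "\<xi> = \<xi>1" using G.C_nrm_eq_zero[OF x2H] by (simp add: \<xi>2_def)
      then show ?thesis using full x1 by simp
    qed
  next
    case False
    then have n: "G.C.nrm \<xi>1 > 0" "G.C.nrm \<xi>2 > 0"
      using G.C.nrm_nonneg[OF x1H] G.C.nrm_nonneg[OF x2H] by linarith+
    define n1 where "n1 = G.C.nrm \<xi>1 ^ 2"
    define n2 where "n2 = G.C.nrm \<xi>2 ^ 2"
    have n12: "n1 > 0" "n2 > 0" using n by (simp_all add: n1_def n2_def)
    define \<psi>1 where "\<psi>1 x = G.ip (\<pi> x \<xi>1) \<xi>1 / of_real n1" for x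
    define \<psi>2 where "\<psi>2 x = G.ip (\<pi> x \<xi>2) \<xi>2 / of_real n2" for x
    have s1: "state \<psi>1" and s2: "state \<psi>2"
      using vector_state[OF x1H n(1)] vector_state[OF x2H n(2)]
      unfolding \<psi>1_def[abs_def] \<psi>2_def[abs_def] n1_def n2_def by blast+
    have k1: "\<psi>1 y = 0" and k2: "\<psi>2 y = 0" if "y \<in> I" for y
      using pi_kills[OF I that x1H] pi_kills[OF I that x2H] G.C.g_zero[OF x1H] G.C.g_zero[OF x2H]
      by (simp_all add: \<psi>1_def \<psi>2_def)
    have sum: "\<xi> = \<xi>1 + \<xi>2" by (simp add: \<xi>2_def)
    have padd: "\<pi> x \<xi> = \<pi> x \<xi>1 + \<pi> x \<xi>2" for x unfolding sum by (auto simp: \<pi>_def)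
    have c1: "G.ip \<xi>2 (\<pi> x \<xi>1) = 0" if "x \<in> S" for x
      using orth[OF K(2)[OF that x1]] by (simp add: \<xi>2_def)
    have c12: "G.ip (\<pi> x \<xi>1) \<xi>2 = 0" if x: "x \<in> S" for x
      using c1[OF x] G.ip_commute[OF pi_HC[OF x1H x] x2H] by simp
    have c21: "G.ip (\<pi> x \<xi>2) \<xi>1 = 0" if x: "x \<in> S" for x
      using c1[OF star_closed[OF x]] pi_adjoint[OF x2H x1H star_closed[OF x]] x by simp
    have ph: "\<phi> x = G.ip (\<pi> x \<xi>) \<xi>" if x: "x \<in> S" for x
    proof -
      have "G.ip (G.emb x) (G.emb 1) = G.emb x 1" using x by (intro G.ip_emb) auto
      then show ?thesis using pxi[OF x] x by (simp add: \<xi>_def G.emb_def)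
    qed
    have dec: "\<phi> x = of_real n1 * \<psi>1 x + of_real n2 * \<psi>2 x" if x: "x \<in> S" for x
    proof -
      have "\<phi> x = G.ip (\<pi> x \<xi>1 + \<pi> x \<xi>2) (\<xi>1 + \<xi>2)" using ph[OF x] padd[of x] sum by simp
      also have "\<dots> = G.ip (\<pi> x \<xi>1) \<xi>1 + G.ip (\<pi> x \<xi>2) \<xi>2"
        using x x1H x2H c12[OF x] c21[OF x] by (simp add: G.ip_add G.C.g_add_right)
      finally show ?thesis using n12 by (simp add: \<psi>1_def \<psi>2_def)
    qed
    have "\<psi>1 1 = 1" "\<psi>2 1 = 1" using s1 s2 by (simp_all add: state_def)
    then have "of_real n1 + of_real n2 = (1 :: complex)" using dec[of 1] by simp
    then have t: "n1 + n2 = 1" by (metis of_real_add of_real_eq_1_iff)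
    then have n2: "n2 = 1 - n1" by simp
    have eq: "\<psi>1 x = \<phi> x" if x: "x \<in> S" for x
    proof (rule extreme[OF s1 s2 _ _ k1 k2 _ x])
      show "0 < n1" "n1 < 1" using n12 t by auto
      show "\<phi> x = of_real n1 * \<psi>1 x + of_real (1 - n1) * \<psi>2 x" if "x \<in> S" for x
        using dec[OF that] n2 by simp
    qed auto
    have "G.hs (of_real n1) \<xi> - \<xi>1 = 0"
    proof (rule G.HC_eq_zero)
      show H: "G.hs (of_real n1) \<xi> - \<xi>1 \<in> G.HC" using xi x1H by blast
      fix z assume z: "z \<in> S"
      have "\<xi>1 z = G.ip \<xi>1 (\<pi> z \<xi>)" using x1H z by (simp add: pxi G.ip_emb)
      also have "\<dots> = cnj (G.ip (\<pi> z \<xi>) \<xi>1)" using x1H xi z by (intro G.ip_commute) auto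
      also have "G.ip (\<pi> z \<xi>) \<xi>1 = G.ip (\<pi> z \<xi>1) \<xi>1"
        unfolding padd using z x1H x2H c21[OF z] by (simp add: G.ip_add)
      also have "\<dots> = of_real n1 * \<phi> z" using eq[OF z] n12 by (simp add: \<psi>1_def field_simps)
      also have "cnj \<dots> = of_real n1 * \<phi> (star z)" using z by (simp add: phi_star)
      also have "\<phi> (star z) = \<xi> z" using z by (simp add: \<xi>_def G.emb_def)
      finally show "(G.hs (of_real n1) \<xi> - \<xi>1) z = 0" by (simp add: G.hs_def)
    qed
    then have "G.hs (of_real n1) \<xi> = \<xi>1" by simp
    then have "\<xi> = G.hs (of_real (1 / n1)) \<xi>1" using n12 by (auto simp: G.hs_def)
    then show ?thesis using full Ksc[OF x1] by metis
  qed
qed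

end

section \<open>Extreme states that vanish on an ideal\<close>

context spectral_cstar
begin

text \<open>The second hypothesis on \<open>c\<close> bounds the quotient seminorm \<open>p\<close>
  of \<open>N\<close> modulo \<open>I\<close> from below along the ray \<open>v + t\<close>. The
  linear functionals below \<open>P = shift p 1\<close> are the real parts of the states that vanish
  on \<open>I\<close>, and the bound becomes \<open>c \<le> P v\<close>. The last conclusions, on
  the values of a vector on \<open>B\<close> and on its behaviour under scalars, prepare the
  encoding of vectors as subsets of the algebra.\<close>

theorem irreducible_representation_exists:
  assumes I: "I \<subseteq> S" "0 \<in> I" "\<And>x y. x \<in> I \<Longrightarrow> y \<in> I \<Longrightarrow> x + y \<in> I"
      "\<And>a x. a \<in> S \<Longrightarrow> x \<in> I \<Longrightarrow> a * x \<in> I \<and> x * a \<in> I"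
    and B: "B \<subseteq> S" "\<And>b. b \<in> B \<Longrightarrow> star b \<in> B" "\<And>a b. a \<in> S \<Longrightarrow> b \<in> B \<Longrightarrow> a * b \<in> B" "v \<in> B"
    and c: "c > 0" "\<And>t y. t \<ge> 0 \<Longrightarrow> y \<in> I \<Longrightarrow> c + t \<le> N (v + R t + y)"
  shows "\<exists>(H :: ('u \<Rightarrow> complex) set) hs ip \<pi>.
    top_irreducible_rep S (\<lambda>c x. \<iota> c * x) star H (+) 0 hs ip \<pi> \<and>
    (\<forall>x\<in>I. \<forall>F\<in>H. \<pi> x F = 0) \<and> (\<exists>F\<in>H. \<pi> v F \<noteq> 0) \<and> (\<forall>c. \<forall>F\<in>H. \<pi> (\<iota> c) F = hs c F) \<and>
    hs = (\<lambda>c F z. c * F z) \<and>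
    (\<forall>F\<in>H. (\<forall>b\<in>B. F b = 0) \<longrightarrow> F = 0) \<and> (\<forall>F\<in>H. \<forall>c. \<forall>z\<in>S. F (\<iota> c * z) = cnj c * F z)"
proof -
  have v: "v \<in> S" using B by blast
  have Isc: "R r * x \<in> I" if "x \<in> I" for r x using I(4) that by blast
  define p where "p x = (INF y\<in>I. N (x + y))" for x
  have ple: "p x \<le> N (x + y)" if "x \<in> S" "y \<in> I" for x y
    unfolding p_def using that I(1)
    by (intro cINF_lower bdd_belowI2[of _ 0]) auto
  have pge: "b \<le> p x" if "\<And>y. y \<in> I \<Longrightarrow> b \<le> N (x + y)" for b x
    unfolding p_def using that I(2) by (intro cINF_greatest) auto
  have sub: "sublin p" unfolding sublin_def
  proof (intro conjI ballI allI impI)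
    fix x y assume x: "x \<in> S" and y: "y \<in> S"
    have "p (x + y) - N (x + a) \<le> p y" if a: "a \<in> I" for a
    proof (rule pge)
      fix b assume b: "b \<in> I"
      have "p (x + y) \<le> N (x + y + (a + b))" using x y a b I by (intro ple) auto
      also have "x + y + (a + b) = (x + a) + (y + b)" by simp
      also have "N \<dots> \<le> N (x + a) + N (y + b)" using x y a b I(1) by (intro N_triangle) auto
      finally show "p (x + y) - N (x + a) \<le> N (y + b)" by simp
    qed
    then have "p (x + y) - p y \<le> p x" by (intro pge) (simp add: algebra_simps)
    then show "p (x + y) \<le> p x + p y" by simp
  next
    fix x and r :: real assume x: "x \<in> S" and r: "r \<ge> 0"
    have le: "p (R r * x) \<le> r * p x" if x: "x \<in> S" and r: "r > 0" for x r
    proof -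
      have "p (R r * x) / r \<le> p x"
      proof (rule pge)
        fix y assume y: "y \<in> I"
        have "p (R r * x) \<le> N (R r * x + R r * y)" using x y Isc by (intro ple) auto
        also have "R r * x + R r * y = R r * (x + y)" by (simp add: distrib_left)
        also have "N \<dots> = r * N (x + y)" using x y r I(1) by (subst N_scaleR) auto
        finally show "p (R r * x) / r \<le> N (x + y)" using r by (simp add: field_simps)
      qed
      then show ?thesis using r by (simp add: field_simps)
    qed
    show "p (R r * x) = r * p x"
    proof (cases "r = 0")
      case True
      have "0 \<le> p 0" using I(1) by (intro pge) auto
      moreover have "p 0 \<le> N 0" using ple[of 0 0] I(2) by simp
      ultimately show ?thesis using True N_iota[of 0] by simp
    next
      case False
      then have "p (R (1 / r) * (R r * x)) \<le> 1 / r * p (R r * x)" using le[of "R r * x" "1 / r"] x r by simp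
      then have "r * p x \<le> p (R r * x)" using False r by (simp add: R_R field_simps)
      then show ?thesis using le[OF x, of r] False r by simp
    qed
  qed
  have pN: "p x \<le> N x" if "x \<in> S" for x using ple[OF that I(2)] by simp
  have pv: "c + t \<le> p (v + R t)" if "t \<ge> 0" for t using c(2)[OF that] by (intro pge)
  have p1: "p 1 = 1"
  proof (rule antisym)
    show "p 1 \<le> 1" using pN[of 1] by simp
    show "1 \<le> p 1"
    proof (rule ccontr)
      assume "\<not> 1 \<le> p 1"
      then have d: "1 - p 1 > 0" by simp
      \<comment> \<open>At this \<open>t\<close> the inequality
        \<open>c + t \<le> p v + t * p 1\<close> becomes
        \<open>c + \<bar>p v\<bar> \<le> p v\<close>, which is absurd.\<close>
      define t where "t = \<bar>p v\<bar> / (1 - p 1)"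
      have t: "t \<ge> 0" "t * (1 - p 1) = \<bar>p v\<bar>" using d by (simp_all add: t_def)
      have "c + t \<le> p v + t * p 1"
        using pv[OF t(1)] sublin_add[OF sub v, of "R t"] sublin_scale[OF sub one_closed t(1)] by simp
      then show False using t(2) c(1) by (simp add: algebra_simps)
    qed
  qed
  define P where "P = shift p 1"
  have P: "sublin P" unfolding P_def by (rule shift_sublin[OF sub one_closed])
  have Pp: "P x \<le> p x" if "x \<in> S" for x unfolding P_def by (rule shift_le_self[OF sub one_closed that])
  have Pv: "c \<le> P v"
    unfolding P_def using pv p1 by (intro shift_greatest[OF v]) (simp add: algebra_simps)
  obtain f where f: "rlin f" "\<And>x. x \<in> S \<Longrightarrow> f x \<le> P x" "f v = P v"
    and ext: "\<And>g h t x. rlin g \<Longrightarrow> rlin h \<Longrightarrow> 0 < t \<Longrightarrow> t < 1 \<Longrightarrow> (\<And>x. x \<in> S \<Longrightarrow> g x \<le> P x) \<Longrightarrow>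
      (\<And>x. x \<in> S \<Longrightarrow> h x \<le> P x) \<Longrightarrow> (\<And>x. x \<in> S \<Longrightarrow> f x = t * g x + (1 - t) * h x) \<Longrightarrow>
      x \<in> S \<Longrightarrow> g x = f x"
    by (rule extreme_functional_exists[OF P v]) blast
  have fN: "f x \<le> N x" if "x \<in> S" for x using f(2)[OF that] Pp[OF that] pN[OF that] by linarith
  have f1: "f 1 = 1"
  proof (rule antisym)
    show "f 1 \<le> 1" using fN[of 1] by simp
    have "f (- 1) \<le> - p 1" using f(2)[of "- 1"] shift_minus[OF sub one_closed] by (simp add: P_def)
    then show "1 \<le> f 1" using p1 rlin_minus[OF f(1) one_closed] by simp
  qed
  define \<phi> where "\<phi> x = Complex (f x) (- f (\<iota> \<i> * x))" for x
  have st: "state \<phi>" unfolding \<phi>_def by (rule state_of_real_functional[OF f(1) fN f1])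
  then interpret cstar_state S \<iota> star N \<phi> by unfold_locales
  have f0: "f y = 0" if y: "y \<in> I" for y
  proof -
    have "f x \<le> 0" if x: "x \<in> I" for x
    proof -
      have "- x \<in> I" using Isc[OF x, of "- 1"] by (simp add: R_minus)
      then have "p x \<le> 0" using ple[of x "- x"] x I(1) N_iota[of 0] by auto
      then show ?thesis using f(2)[of x] Pp[of x] x I(1) by fastforce
    qed
    moreover have "- y \<in> I" using Isc[OF y, of "- 1"] by (simp add: R_minus)
    ultimately have "f y \<le> 0" "f (- y) \<le> 0" using y by blast+
    then show ?thesis using rlin_minus[OF f(1), of y] y I(1) by auto
  qed
  have kill: "\<phi> y = 0" if "y \<in> I" for y
    using f0[OF that] f0[of "\<iota> \<i> * y"] I(4) that by (simp add: \<phi>_def complex_eq_iff)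
  \<comment> \<open>The converse inclusion: every state vanishing on \<open>I\<close> is dominated
    by \<open>P\<close>. Extremality among the functionals below \<open>P\<close> is thereby
    extremality among these states.\<close>
  have stP: "rlin (\<lambda>x. Re (\<psi> x))" "\<And>x. x \<in> S \<Longrightarrow> Re (\<psi> x) \<le> P x"
    if s: "state \<psi>" and k: "\<And>y. y \<in> I \<Longrightarrow> \<psi> y = 0" for \<psi>
  proof -
    show "rlin (\<lambda>x. Re (\<psi> x))" using s by (simp add: rlin_def state_def R_def)
    have Rp: "Re (\<psi> x) \<le> p x" if x: "x \<in> S" for x
    proof (rule pge)
      fix y assume y: "y \<in> I"
      have yS: "y \<in> S" using y I(1) by blast
      have "\<psi> (x + y) = \<psi> x" using s x yS k[OF y] by (simp add: state_def)
      moreover have "cmod (\<psi> (x + y)) \<le> N (x + y)" using s x yS add_closed unfolding state_def by blast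
      ultimately show "Re (\<psi> x) \<le> N (x + y)" using complex_Re_le_cmod[of "\<psi> x"] by simp
    qed
    show "Re (\<psi> x) \<le> P x" if x: "x \<in> S" for x
      unfolding P_def
    proof (rule shift_greatest[OF x])
      fix t :: real assume "t \<ge> 0"
      have "\<psi> (x + R t * 1) = \<psi> x + of_real t"
        using s x unfolding state_def R_def by (metis iota_closed mult_closed mult.right_neutral one_closed)
      then show "Re (\<psi> x) \<le> p (x + R t * 1) - t * p 1" using Rp[of "x + R t * 1"] x p1 by simp
    qed
  qed
  have extreme: "\<psi>1 x = \<phi> x" if s: "state \<psi>1" "state \<psi>2" and t: "0 < t" "t < 1" and k: "\<And>y. y \<in> I \<Longrightarrow> \<psi>1 y = 0"
     "\<And>y. y \<in> I \<Longrightarrow> \<psi>2 y = 0" and d: "\<And>x. x \<in> S \<Longrightarrow> \<phi> x = of_real t * \<psi>1 x + of_real (1 - t) * \<psi>2 x"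
     and x: "x \<in> S" for \<psi>1 \<psi>2 t x
  proof -
    have fr: "f x = t * Re (\<psi>1 x) + (1 - t) * Re (\<psi>2 x)" if "x \<in> S" for x
      using arg_cong[OF d[OF that], of Re] by (simp add: \<phi>_def)
    have re: "Re (\<psi>1 x) = f x" if "x \<in> S" for x
      using ext[OF stP(1)[OF s(1) k(1)] stP(1)[OF s(2) k(2)] t stP(2)[OF s(1) k(1)] stP(2)[OF s(2) k(2)] fr that]
      by blast
    have "\<psi>1 (\<iota> \<i> * x) = \<i> * \<psi>1 x" using s(1) x by (simp add: state_def)
    then have "Re (\<i> * \<psi>1 x) = f (\<iota> \<i> * x)" using re[of "\<iota> \<i> * x"] x by simp
    then show ?thesis using re[OF x] by (simp add: \<phi>_def complex_eq_iff)
  qed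
  have irr: "K = {0} \<or> K = G.HC"
    if "closed_subspace K G.HC (+) 0 G.hs G.ip" "\<And>a F. a \<in> S \<Longrightarrow> F \<in> K \<Longrightarrow> \<pi> a F \<in> K" for K
    by (rule pi_irreducible[where I = I and K = K]; (rule that extreme I(1) I(4) kill; assumption?)?)
  have phv: "\<phi> v \<noteq> 0" using f(3) Pv c(1) by (auto simp: \<phi>_def complex_eq_iff)
  have e1: "G.emb 1 \<in> G.HC" by simp
  have "\<pi> v (G.emb 1) 1 = \<phi> v" using v by (simp add: \<pi>_def G.emb_def)
  then have nz: "\<pi> v (G.emb 1) \<noteq> 0" using phv by auto
  \<comment> \<open>The vectors vanishing on \<open>B\<close> form a closed invariant subspace,
    because \<open>B\<close> is a left ideal. The cyclic vector is not in it, since its value at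
    \<open>star v\<close> is \<open>\<phi> v\<close>; by irreducibility the subspace is
    zero.\<close>
  have inj: "F = 0" if FH: "F \<in> G.HC" and FB: "\<forall>b\<in>B. F b = 0" for F
  proof -
    define K where "K = {F \<in> G.HC. \<forall>b\<in>B. F b = 0}"
    have "closed_subspace K G.HC (+) 0 G.hs G.ip"
      unfolding closed_subspace_def G.hdist_eq
    proof (intro conjI ballI allI)
      fix c F assume F: "F \<in> K"
      then have "G.hs c F \<in> G.HC" by (simp add: K_def)
      then show "G.hs c F \<in> K" using F by (simp add: K_def) (simp add: G.hs_def)
    next
      show "closed_in_wrt K G.HC (\<lambda>F G. G.C.nrm (F - G))"
        unfolding closed_in_wrt_def
      proof (intro allI impI)
        fix g F assume g: "\<forall>m. g m \<in> K" and F: "F \<in> G.HC" and l: "(\<lambda>m. G.C.nrm (g m - F)) \<longlonglongrightarrow> 0"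
        have gH: "g m \<in> G.HC" for m using g by (simp add: K_def)
        have "F b = 0" if b: "b \<in> B" for b
        proof -
          have bS: "b \<in> S" using b B by blast
          have "cmod (F b) \<le> G.C.nrm (g m - F) * G.C.nrm (G.emb b)" for m
          proof -
            have "G.ip (g m - F) (G.emb b) = (g m - F) b" using gH F bS by (intro G.ip_emb) auto
            also have "\<dots> = - F b" using g b by (simp add: K_def)
            finally have "cmod (F b) = cmod (G.ip (g m - F) (G.emb b))" by simp
            also have "\<dots> \<le> G.C.nrm (g m - F) * G.C.nrm (G.emb b)"
              using gH F bS by (intro G.C.cauchy_schwarz) auto
            finally show ?thesis .
          qed
          moreover have "(\<lambda>m. G.C.nrm (g m - F) * G.C.nrm (G.emb b)) \<longlonglongrightarrow> 0 * G.C.nrm (G.emb b)"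
            by (intro tendsto_mult l tendsto_const)
          ultimately have "cmod (F b) \<le> 0 * G.C.nrm (G.emb b)" by (intro LIMSEQ_le_const) auto
          then show ?thesis by simp
        qed
        then show "F \<in> K" using F by (simp add: K_def)
      qed
    qed (auto simp: K_def)
    moreover have "\<pi> a F \<in> K" if "a \<in> S" "F \<in> K" for a F
    proof -
      have "\<pi> a F \<in> G.HC" using that pi_HC by (simp add: K_def)
      then show ?thesis using that B(3) star_closed by (simp add: K_def) (simp add: \<pi>_def)
    qed
    ultimately have "K = {0} \<or> K = G.HC" by (rule irr)
    moreover have "G.emb 1 \<notin> K"
    proof
      assume "G.emb 1 \<in> K"
      then have "G.emb 1 (star v) = 0" using B by (simp add: K_def)
      then show False using v phv by (simp add: G.emb_def)
    qed
    ultimately show ?thesis using FH FB e1 unfolding K_def by blast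
  qed
  have "top_irreducible_rep S (\<lambda>c x. \<iota> c * x) star G.HC (+) 0 G.hs G.ip \<pi>"
    unfolding top_irreducible_rep_def using pi_star_representation irr nz e1 v by blast
  moreover have "\<forall>x\<in>I. \<forall>F\<in>G.HC. \<pi> x F = 0" using pi_kills[OF I(4) I(1) kill] by blast
  moreover have "G.hs = (\<lambda>c (F :: 'u \<Rightarrow> complex) z. c * F z)"
    by (simp add: fun_eq_iff G.hs_def)
  ultimately show ?thesis
    using nz e1 inj pi_iota HC_linear(2)
    by (intro exI[of _ G.HC] exI[of _ G.hs] exI[of _ G.ip] exI[of _ \<pi>]) blast
qed

end

section \<open>Transport and restriction of irreducible representations\<close>

lemma hilbert_space_transport:
  assumes H: "hilbert_space H ad z hs ip" and D: "\<And>x. x \<in> H \<Longrightarrow> D (E x) = x"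
  shows "hilbert_space (E ` H) (\<lambda>X Y. E (ad (D X) (D Y))) (E z) (\<lambda>c X. E (hs c (D X)))
    (\<lambda>X Y. ip (D X) (D Y))"
proof -
  have comp: "complete_wrt H (hdist ad hs ip)" and cl: "\<And>x y. x \<in> H \<Longrightarrow> y \<in> H \<Longrightarrow> ad x y \<in> H"
    "\<And>c x. x \<in> H \<Longrightarrow> hs c x \<in> H" and z: "z \<in> H"
    using H by (simp_all add: hilbert_space_def)
  have dist: "hdist (\<lambda>X Y. E (ad (D X) (D Y))) (\<lambda>c X. E (hs c (D X))) (\<lambda>X Y. ip (D X) (D Y)) (E x) (E y)
     = hdist ad hs ip x y" if "x \<in> H" "y \<in> H" for x y
    using that by (simp add: hdist_def hnorm_def D cl)
  have "complete_wrt (E ` H) (hdist (\<lambda>X Y. E (ad (D X) (D Y))) (\<lambda>c X. E (hs c (D X))) (\<lambda>X Y. ip (D X) (D Y)))"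
    unfolding complete_wrt_def
  proof (intro allI impI)
    fix f :: "nat \<Rightarrow> 'b"
    assume f: "\<forall>m. f m \<in> E ` H" and C: "\<forall>\<epsilon>>0. \<exists>N. \<forall>m\<ge>N. \<forall>n\<ge>N. hdist (\<lambda>X Y. E (ad (D X) (D Y)))
       (\<lambda>c X. E (hs c (D X))) (\<lambda>X Y. ip (D X) (D Y)) (f m) (f n) < \<epsilon>"
    from f have "\<forall>m. \<exists>x. x \<in> H \<and> f m = E x" by blast
    then obtain x where x: "\<And>m. x m \<in> H" "\<And>m. f m = E (x m)" by metis
    have "\<exists>y\<in>H. (\<lambda>m. hdist ad hs ip (x m) y) \<longlonglongrightarrow> 0"
    proof (rule comp[unfolded complete_wrt_def, rule_format])
      show "x m \<in> H" for m by (rule x(1))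
      show "\<exists>N. \<forall>m\<ge>N. \<forall>n\<ge>N. hdist ad hs ip (x m) (x n) < \<epsilon>" if "\<epsilon> > 0" for \<epsilon>
        using C[rule_format, OF that] unfolding x(2) by (simp only: dist x(1))
    qed
    then show "\<exists>Y\<in>E ` H. (\<lambda>m. hdist (\<lambda>X Y. E (ad (D X) (D Y))) (\<lambda>c X. E (hs c (D X)))
        (\<lambda>X Y. ip (D X) (D Y)) (f m) Y) \<longlonglongrightarrow> 0"
      unfolding x(2) by (auto simp: dist x(1))
  qed
  note compl = this
  have f: "\<forall>x\<in>H. \<forall>y\<in>H. \<forall>w\<in>H. ad (ad x y) w = ad x (ad y w)" "\<forall>x\<in>H. ad z x = x"
    "\<forall>x\<in>H. ad x (hs (- 1) x) = z" "\<forall>c. \<forall>x\<in>H. \<forall>y\<in>H. hs c (ad x y) = ad (hs c x) (hs c y)"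
    "\<forall>c d. \<forall>x\<in>H. hs (c + d) x = ad (hs c x) (hs d x)" "\<forall>c d. \<forall>x\<in>H. hs c (hs d x) = hs (c * d) x"
    "\<forall>x\<in>H. hs 1 x = x" "\<forall>x\<in>H. \<forall>y\<in>H. \<forall>w\<in>H. ip (ad x y) w = ip x w + ip y w"
    "\<forall>c. \<forall>x\<in>H. \<forall>y\<in>H. ip (hs c x) y = c * ip x y" "\<forall>x\<in>H. Im (ip x x) = 0 \<and> 0 \<le> Re (ip x x)"
    "\<forall>x\<in>H. ip x x = 0 \<longrightarrow> x = z"
    using H unfolding hilbert_space_def by - (elim conjE, assumption)+
  have ip_comm: "\<forall>X\<in>E ` H. \<forall>Y\<in>E ` H. ip (D X) (D Y) = cnj (ip (D Y) (D X))"
  proof -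
    have "\<forall>x\<in>H. \<forall>y\<in>H. ip x y = cnj (ip y x)" using H unfolding hilbert_space_def by (elim conjE)
    then show ?thesis using D by (metis imageE)
  qed
  have ad_comm: "\<forall>X\<in>E ` H. \<forall>Y\<in>E ` H. E (ad (D X) (D Y)) = E (ad (D Y) (D X))"
  proof -
    have "\<forall>x\<in>H. \<forall>y\<in>H. ad x y = ad y x" using H unfolding hilbert_space_def by (elim conjE)
    then show ?thesis using D by (metis imageE)
  qed
  have definite: "\<forall>X\<in>E ` H. ip (D X) (D X) = 0 \<longrightarrow> X = E z"
    using f(11) D by (metis imageE)
  show ?thesis
    unfolding hilbert_space_def by (intro conjI; (rule compl ip_comm ad_comm definite | simp add: f D cl z))
qed

text \<open>The Hilbert space found above consists of functionals, whereas
  \<open>wiener_property\<close> asks for vectors that are sets of algebra elements. A map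
  \<open>E\<close> that is injective on \<open>H\<close> carries the whole structure over.\<close>

lemma top_irreducible_rep_transport:
  assumes T: "top_irreducible_rep A sm st H ad z hs ip rp" and D: "\<And>x. x \<in> H \<Longrightarrow> D (E x) = x"
    and stA: "\<And>a. a \<in> A \<Longrightarrow> st a \<in> A"
  shows "top_irreducible_rep A sm st (E ` H) (\<lambda>X Y. E (ad (D X) (D Y))) (E z) (\<lambda>c X. E (hs c (D X)))
    (\<lambda>X Y. ip (D X) (D Y)) (\<lambda>a X. E (rp a (D X)))"
proof -
  have sr: "star_representation A sm st H ad z hs ip rp" and nz: "\<exists>a\<in>A. \<exists>x\<in>H. rp a x \<noteq> z"
    and irr: "\<And>K. closed_subspace K H ad z hs ip \<Longrightarrow> (\<forall>a\<in>A. \<forall>x\<in>K. rp a x \<in> K) \<Longrightarrow> K = {z} \<or> K = H"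
    using T unfolding top_irreducible_rep_def by blast+
  have H: "hilbert_space H ad z hs ip" and PH: "\<And>a x. a \<in> A \<Longrightarrow> x \<in> H \<Longrightarrow> rp a x \<in> H"
    using sr by (simp_all add: star_representation_def)
  have cl: "\<And>x y. x \<in> H \<Longrightarrow> y \<in> H \<Longrightarrow> ad x y \<in> H"
    "\<And>c x. x \<in> H \<Longrightarrow> hs c x \<in> H" and z: "z \<in> H"
    using H by (simp_all add: hilbert_space_def)
  have inj: "x = y" if "x \<in> H" "y \<in> H" "E x = E y" for x y using that D by metis
  have "star_representation A sm st (E ` H) (\<lambda>X Y. E (ad (D X) (D Y))) (E z) (\<lambda>c X. E (hs c (D X)))
    (\<lambda>X Y. ip (D X) (D Y)) (\<lambda>a X. E (rp a (D X)))"
    using sr hilbert_space_transport[where D = D and E = E, OF H D] unfolding star_representation_def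
    by (simp add: D PH cl hnorm_def stA)
  moreover have "\<exists>a\<in>A. \<exists>X\<in>E ` H. E (rp a (D X)) \<noteq> E z"
    using nz inj PH z D by (metis imageI)
  moreover have "K = {E z} \<or> K = E ` H"
    if K: "closed_subspace K (E ` H) (\<lambda>X Y. E (ad (D X) (D Y))) (E z) (\<lambda>c X. E (hs c (D X)))
      (\<lambda>X Y. ip (D X) (D Y))" and inv: "\<forall>a\<in>A. \<forall>X\<in>K. E (rp a (D X)) \<in> K" for K
  proof -
    define L where "L = {x \<in> H. E x \<in> K}"
    have KE: "K = E ` L" using K unfolding closed_subspace_def L_def by blast
    have dist: "hdist (\<lambda>X Y. E (ad (D X) (D Y))) (\<lambda>c X. E (hs c (D X))) (\<lambda>X Y. ip (D X) (D Y)) (E x) (E y)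
       = hdist ad hs ip x y" if "x \<in> H" "y \<in> H" for x y
      using that by (simp add: hdist_def hnorm_def D cl)
    have "closed_in_wrt L H (hdist ad hs ip)"
      unfolding closed_in_wrt_def
    proof (intro allI impI)
      fix f x assume f: "\<forall>m. f m \<in> L" and x: "x \<in> H" and l: "(\<lambda>m. hdist ad hs ip (f m) x) \<longlonglongrightarrow> 0"
      have fH: "f m \<in> H" "E (f m) \<in> K" for m using f by (auto simp: L_def)
      have cK: "closed_in_wrt K (E ` H) (hdist (\<lambda>X Y. E (ad (D X) (D Y))) (\<lambda>c X. E (hs c (D X))) (\<lambda>X Y. ip (D X) (D Y)))"
        using K unfolding closed_subspace_def by blast
      have "E x \<in> K"
        by (rule cK[unfolded closed_in_wrt_def, rule_format, of "\<lambda>m. E (f m)"])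
           (use fH x l in \<open>simp_all add: dist\<close>)
      then show "x \<in> L" using x by (simp add: L_def)
    qed
    moreover have "ad x y \<in> L" if "x \<in> L" "y \<in> L" for x y
    proof -
      have "E (ad (D (E x)) (D (E y))) \<in> K" using K that unfolding closed_subspace_def L_def by blast
      then show ?thesis using that by (simp add: L_def D cl)
    qed
    moreover have "hs c x \<in> L" if "x \<in> L" for x c
    proof -
      have "E (hs c (D (E x))) \<in> K" using K that unfolding closed_subspace_def L_def by blast
      then show ?thesis using that by (simp add: L_def D cl)
    qed
    moreover have "z \<in> L" "L \<subseteq> H" using K z unfolding closed_subspace_def L_def by blast+
    ultimately have "closed_subspace L H ad z hs ip" unfolding closed_subspace_def by blast
    moreover have "\<forall>a\<in>A. \<forall>x\<in>L. rp a x \<in> L"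
    proof (intro ballI)
      fix a x assume a: "a \<in> A" and x: "x \<in> L"
      have "E (rp a (D (E x))) \<in> K" using inv a x unfolding L_def by blast
      then show "rp a x \<in> L" using a x by (simp add: L_def D PH)
    qed
    ultimately have "L = {z} \<or> L = H" by (rule irr)
    then show ?thesis using KE by auto
  qed
  ultimately show ?thesis unfolding top_irreducible_rep_def by blast
qed

text \<open>The unitization exceeds \<open>A\<close> by scalars only, and these act as scalars; so a
  subspace invariant under \<open>A\<close> is invariant under \<open>S\<close>.\<close>

lemma top_irreducible_rep_restrict:
  assumes T: "top_irreducible_rep S (\<lambda>c x. \<iota> c * x) star H ad z hs ip rp"
    and j: "\<And>a. a \<in> A \<Longrightarrow> j a \<in> S" "\<And>a b. a \<in> A \<Longrightarrow> b \<in> A \<Longrightarrow> j (a + b) = j a + j b"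
      "\<And>a b. a \<in> A \<Longrightarrow> b \<in> A \<Longrightarrow> j (a * b) = j a * j b" "\<And>c a. a \<in> A \<Longrightarrow> j (sm c a) = \<iota> c * j a"
      "\<And>a. a \<in> A \<Longrightarrow> j (st a) = star (j a)"
    and span: "\<And>s. s \<in> S \<Longrightarrow> \<exists>c. \<exists>a\<in>A. s = \<iota> c + j a" and iota: "\<And>c. \<iota> c \<in> S"
      "\<And>c x. x \<in> H \<Longrightarrow> rp (\<iota> c) x = hs c x"
    and nz: "\<exists>a\<in>A. \<exists>x\<in>H. rp (j a) x \<noteq> z"
  shows "top_irreducible_rep A sm st H ad z hs ip (\<lambda>a. rp (j a))"
proof -
  have sr: "star_representation S (\<lambda>c x. \<iota> c * x) star H ad z hs ip rp"
    and irr: "\<And>K. closed_subspace K H ad z hs ip \<Longrightarrow> (\<forall>a\<in>S. \<forall>x\<in>K. rp a x \<in> K) \<Longrightarrow> K = {z} \<or> K = H"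
    using T unfolding top_irreducible_rep_def by blast+
  have add: "rp (a + b) x = ad (rp a x) (rp b x)" if "a \<in> S" "b \<in> S" "x \<in> H" for a b x
    using sr that unfolding star_representation_def by blast
  have "star_representation A sm st H ad z hs ip (\<lambda>a. rp (j a))"
    using sr unfolding star_representation_def by (simp add: j)
  moreover have "K = {z} \<or> K = H"
    if K: "closed_subspace K H ad z hs ip" and inv: "\<forall>a\<in>A. \<forall>x\<in>K. rp (j a) x \<in> K" for K
  proof (rule irr[OF K], intro ballI)
    fix s x assume s: "s \<in> S" and x: "x \<in> K"
    obtain c a where a: "a \<in> A" "s = \<iota> c + j a" using span[OF s] by blast
    have xH: "x \<in> H" using K x unfolding closed_subspace_def by blast
    have "rp s x = ad (hs c x) (rp (j a) x)" using a xH j(1) by (simp add: add iota)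
    then show "rp s x \<in> K" using K x inv a unfolding closed_subspace_def by simp
  qed
  ultimately show ?thesis using nz unfolding top_irreducible_rep_def by blast
qed

section \<open>Banach algebras of subexponential growth\<close>

text \<open>The ratio of consecutive coefficients is \<open>(1 / 2 - n) / (n + 1)\<close>, of
  modulus at most 1.\<close>

lemma abs_gbinomial_half_le: "\<bar>(1 / 2 :: real) gchoose n\<bar> \<le> 1"
proof (induction n)
  case (Suc n)
  have "of_nat (Suc n) * ((1 / 2 :: real) gchoose Suc n) = (1 / 2 - of_nat n) * (1 / 2 gchoose n)"
    using gbinomial_mult_1[of "1 / 2 :: real" n] by (simp add: algebra_simps)
  then have "real (Suc n) * \<bar>(1 / 2 :: real) gchoose Suc n\<bar> = \<bar>1 / 2 - real n\<bar> * \<bar>1 / 2 gchoose n\<bar>"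
    by (metis abs_mult abs_of_nat)
  also have "\<dots> \<le> real (Suc n) * 1" using Suc by (intro mult_mono) auto
  finally show ?case by (subst (asm) mult_le_cancel_left_pos) auto
qed simp

lemma exists_power_interval:
  fixes n k :: nat
  assumes "n > 0" "k \<ge> 2" obtains l where "k ^ l \<le> n" "n < k ^ Suc l"
  using ex_power_ivl1[of k n] assms by auto

text \<open>\<open>N\<close> is the C*-norm and \<open>\<alpha>\<close> the complete norm. The
  assumption \<open>growth\<close> is the differential inequality in a form that survives
  unitization: restricted to \<open>N x \<le> 1\<close>, with \<open>max 1\<close> absorbing lower
  powers of \<open>\<alpha> x\<close>. Its strength lies in \<open>s < real k\<close>; the exponent
  \<open>k\<close> would be mere submultiplicativity.\<close>

locale banach_cstar_pair = star_scalars S \<iota> star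
  for S :: "'u::ring_1 set" and \<iota> :: "complex \<Rightarrow> 'u" and star :: "'u \<Rightarrow> 'u" +
  fixes N :: "'u \<Rightarrow> real" and \<alpha> :: "'u \<Rightarrow> real" and k :: nat and s :: real
  assumes N_nonneg': "x \<in> S \<Longrightarrow> 0 \<le> N x"
    and N_triangle': "x \<in> S \<Longrightarrow> y \<in> S \<Longrightarrow> N (x + y) \<le> N x + N y"
    and N_mult': "x \<in> S \<Longrightarrow> y \<in> S \<Longrightarrow> N (x * y) \<le> N x * N y"
    and N_iota': "N (\<iota> c) = cmod c"
    and N_cstar': "x \<in> S \<Longrightarrow> N (star x * x) = N x ^ 2"
    and \<alpha>_nonneg [simp]: "x \<in> S \<Longrightarrow> 0 \<le> \<alpha> x"
    and \<alpha>_eq_zero: "x \<in> S \<Longrightarrow> \<alpha> x = 0 \<Longrightarrow> x = 0"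
    and \<alpha>_triangle: "x \<in> S \<Longrightarrow> y \<in> S \<Longrightarrow> \<alpha> (x + y) \<le> \<alpha> x + \<alpha> y"
    and \<alpha>_mult: "x \<in> S \<Longrightarrow> y \<in> S \<Longrightarrow> \<alpha> (x * y) \<le> \<alpha> x * \<alpha> y"
    and \<alpha>_iota [simp]: "\<alpha> (\<iota> c) = cmod c"
    and \<alpha>_star: "\<exists>B. \<forall>x\<in>S. \<alpha> (star x) \<le> B * \<alpha> x"
    and \<alpha>_complete: "complete_wrt S (\<lambda>x y. \<alpha> (x - y))"
    and k2: "k \<ge> 2" and s1: "1 < s" and sk: "s < real k"
    and growth: "\<exists>K. \<forall>x\<in>S. N x \<le> 1 \<longrightarrow> \<alpha> (x ^ k) \<le> K * max 1 (\<alpha> x) powr s"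
begin

lemma \<alpha>_R [simp]: "\<alpha> (R t) = \<bar>t\<bar>"
  by (simp add: R_def)

lemma \<alpha>_one [simp]: "\<alpha> 1 = 1"
  using \<alpha>_iota[of 1] by simp

lemma \<alpha>_zero [simp]: "\<alpha> 0 = 0"
  using \<alpha>_iota[of 0] by simp

lemma \<alpha>_iota_mult: "x \<in> S \<Longrightarrow> \<alpha> (\<iota> c * x) \<le> cmod c * \<alpha> x"
  using \<alpha>_mult[of "\<iota> c" x] by simp

lemma \<alpha>_R_mult: "x \<in> S \<Longrightarrow> \<alpha> (R t * x) \<le> \<bar>t\<bar> * \<alpha> x"
  using \<alpha>_mult[of "R t" x] by simp

lemma \<alpha>_uminus [simp]: "x \<in> S \<Longrightarrow> \<alpha> (- x) = \<alpha> x"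
  using \<alpha>_R_mult[of x "- 1"] \<alpha>_R_mult[of "- x" "- 1"] by (simp add: R_minus)

lemma \<alpha>_diff_commute: "x \<in> S \<Longrightarrow> y \<in> S \<Longrightarrow> \<alpha> (x - y) = \<alpha> (y - x)"
  using \<alpha>_uminus[of "x - y"] by simp

lemma \<alpha>_diff: "x \<in> S \<Longrightarrow> y \<in> S \<Longrightarrow> \<alpha> (x - y) \<le> \<alpha> x + \<alpha> y"
  using \<alpha>_triangle[of x "- y"] by simp

lemma \<alpha>_power: "x \<in> S \<Longrightarrow> \<alpha> (x ^ n) \<le> \<alpha> x ^ n"
proof (induction n)
  case (Suc n)
  have "\<alpha> (x * x ^ n) \<le> \<alpha> x * \<alpha> (x ^ n)" using Suc.prems by (intro \<alpha>_mult) auto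
  also have "\<dots> \<le> \<alpha> x * \<alpha> x ^ n" using Suc by (intro mult_left_mono) auto
  finally show ?case by simp
qed simp

lemma R_sum: "R (sum f B) = (\<Sum>i\<in>B. R (f i))"
  by (induction B rule: infinite_finite_induct) (auto simp: R_add)

lemma \<alpha>_sum: "(\<And>i. i \<in> B \<Longrightarrow> f i \<in> S) \<Longrightarrow> \<alpha> (sum f B) \<le> (\<Sum>i\<in>B. \<alpha> (f i))"
proof (induction B rule: infinite_finite_induct)
  case (insert x B)
  then have "\<alpha> (f x + sum f B) \<le> \<alpha> (f x) + \<alpha> (sum f B)" by (intro \<alpha>_triangle sum_closed) auto
  with insert show ?case by fastforce
qed auto

text \<open>Writing \<open>n = k * q + r\<close> bounds the logarithm of
  \<open>\<alpha> (x ^ n)\<close> by a constant plus \<open>s\<close> times the bound for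
  \<open>x ^ q\<close>. Each base-\<open>k\<close> digit costs one factor \<open>s\<close>.\<close>

lemma growth_bound:
  assumes \<rho>: "\<rho> \<ge> 0"
  obtains E where "E \<ge> 0" "\<And>x n l. x \<in> S \<Longrightarrow> N x \<le> 1 \<Longrightarrow> \<alpha> x \<le> \<rho> \<Longrightarrow> n < k ^ l \<Longrightarrow> \<alpha> (x ^ n) \<le> exp (E * s ^ l)"
proof -
  obtain K0 where K0: "\<And>x. x \<in> S \<Longrightarrow> N x \<le> 1 \<Longrightarrow> \<alpha> (x ^ k) \<le> K0 * max 1 (\<alpha> x) powr s"
    using growth by blast
  define K where "K = max 1 K0"
  define Q where "Q = max 1 \<rho> ^ k"
  define c where "c = ln (K * Q)"
  \<comment> \<open>Chosen so that the bounds \<open>E * s ^ l - E\<close> reproduce themselves when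
    \<open>X\<close> is replaced by \<open>c + s * X\<close>; the term \<open>- E\<close> absorbs
    the constant \<open>c\<close> at every step.\<close>
  define E where "E = c / (s - 1)"
  have K1: "K \<ge> 1" and Q1: "Q \<ge> 1" by (simp_all add: K_def Q_def)
  have KQ: "K * Q \<ge> 1" using K1 Q1 by (simp add: mult_ge1_I)
  have c: "c \<ge> 0" using KQ by (simp add: c_def)
  have E0: "E \<ge> 0" using c s1 by (simp add: E_def)
  have Ec: "c + s * (E * s ^ l - E) = E * s ^ Suc l - E" for l
  proof -
    have "c = E * (s - 1)" using s1 by (simp add: E_def)
    then show ?thesis by (simp add: algebra_simps)
  qed
  have main: "\<alpha> (x ^ n) \<le> exp (E * s ^ l - E)" if x: "x \<in> S" "N x \<le> 1" "\<alpha> x \<le> \<rho>" and n: "n < k ^ l" for x n l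
    using n
  proof (induction l arbitrary: n)
    case 0
    then show ?case by simp
  next
    case (Suc l)
    define q r where "q = n div k" and "r = n mod k"
    have nqr: "n = k * q + r" by (simp add: q_def r_def)
    have q: "q < k ^ l" using Suc.prems k2 by (simp add: q_def div_less_iff_less_mult mult.commute)
    have r: "r < k" using k2 by (simp add: r_def)
    have Nq: "N (x ^ q) \<le> 1"
    proof (induction q)
      case 0 then show ?case using N_iota'[of 1] by simp
    next
      case (Suc q)
      have "N (x * x ^ q) \<le> N x * N (x ^ q)" using x by (intro N_mult') auto
      also have "\<dots> \<le> 1 * 1" using Suc x by (intro mult_mono) (auto intro: N_nonneg')
      finally show ?case by simp
    qed
    have B: "0 \<le> E * s ^ l - E" using E0 s1 by (simp add: mult_le_cancel_left1)
    have "\<alpha> (x ^ n) = \<alpha> ((x ^ q) ^ k * x ^ r)" by (simp add: nqr power_add power_mult mult.commute[of k])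
    also have "\<dots> \<le> \<alpha> ((x ^ q) ^ k) * \<alpha> (x ^ r)" using x by (intro \<alpha>_mult) auto
    also have "\<dots> \<le> (K * exp (E * s ^ l - E) powr s) * Q"
    proof (rule mult_mono)
      have "\<alpha> ((x ^ q) ^ k) \<le> K0 * max 1 (\<alpha> (x ^ q)) powr s" using K0 x Nq by simp
      also have "\<dots> \<le> K * max 1 (\<alpha> (x ^ q)) powr s" by (intro mult_right_mono) (auto simp: K_def)
      also have "\<dots> \<le> K * exp (E * s ^ l - E) powr s"
        using K1 Suc.IH[OF q] B s1 by (intro mult_left_mono powr_mono2) auto
      finally show "\<alpha> ((x ^ q) ^ k) \<le> K * exp (E * s ^ l - E) powr s" .
      have "\<alpha> (x ^ r) \<le> \<alpha> x ^ r" by (rule \<alpha>_power[OF x(1)])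
      also have "\<dots> \<le> max 1 \<rho> ^ r" using x by (intro power_mono) auto
      also have "\<dots> \<le> Q" unfolding Q_def using r by (intro power_increasing) auto
      finally show "\<alpha> (x ^ r) \<le> Q" .
    qed (use K1 x in auto)
    also have "\<dots> = (K * Q) * exp (s * (E * s ^ l - E))" by (simp add: powr_def mult_ac)
    also have "K * Q = exp c" using KQ by (simp add: c_def)
    also have "exp c * exp (s * (E * s ^ l - E)) = exp (E * s ^ Suc l - E)"
      by (simp only: Ec flip: exp_add)
    finally show ?case .
  qed
  show thesis
  proof (rule that[OF E0])
    fix x n l assume "x \<in> S" "N x \<le> 1" "\<alpha> x \<le> \<rho>" "n < k ^ l"
    then have "\<alpha> (x ^ n) \<le> exp (E * s ^ l - E)" by (rule main)
    also have "\<dots> \<le> exp (E * s ^ l)" using E0 by simp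
    finally show "\<alpha> (x ^ n) \<le> exp (E * s ^ l)" .
  qed
qed

text \<open>Scaling by some \<open>r'\<close> strictly between \<open>N x\<close> and
  \<open>r\<close> moves \<open>x\<close> into the unit ball of \<open>N\<close>, where powers grow
  subexponentially, and \<open>(r / r') ^ n\<close> outgrows that. So the spectral radius for
  \<open>\<alpha>\<close> is at most \<open>N x\<close>.\<close>

lemma power_bound:
  assumes x: "x \<in> S" and r: "N x < r"
  obtains K where "K > 0" "\<And>n. \<alpha> (x ^ n) \<le> K * r ^ n"
proof -
  define r' where "r' = (N x + r) / 2"
  have r': "r' > 0" "r' < r" "N x \<le> r'" using r N_nonneg'[OF x] by (simp_all add: r'_def)
  have r0: "r > 0" using r' by simp
  define y where "y = R (1 / r') * x"
  have y: "y \<in> S" using x by (simp add: y_def)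
  have "N y \<le> N (R (1 / r')) * N x" unfolding y_def using x by (intro N_mult') auto
  also have "\<dots> \<le> 1" using r' by (simp add: R_def N_iota' norm_divide)
  finally have Ny: "N y \<le> 1" .
  obtain E where E: "E \<ge> 0" "\<And>n l. n < k ^ l \<Longrightarrow> \<alpha> (y ^ n) \<le> exp (E * s ^ l)"
    using growth_bound[of "\<alpha> y"] y Ny by (metis \<alpha>_nonneg order_refl)
  define L where "L = ln (r / r')"
  have L: "L > 0" using r' r0 by (simp add: L_def)
  \<comment> \<open>For \<open>n\<close> between \<open>k ^ l\<close> and \<open>k ^ Suc l\<close>
    the exponent \<open>E * s ^ Suc l\<close> competes with \<open>L * n\<close>, which is at least
    \<open>L * k ^ l\<close>; the quotient tends to 0 because \<open>s < real k\<close>.\<close>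
  have "(\<lambda>l. E * s * (s / real k) ^ l) \<longlonglongrightarrow> E * s * 0"
    using s1 sk by (intro tendsto_mult_left LIMSEQ_power_zero) auto
  then have "eventually (\<lambda>l. E * s * (s / real k) ^ l < L) sequentially"
    using L by (intro order_tendstoD) auto
  then obtain l0 where l0: "\<And>l. l \<ge> l0 \<Longrightarrow> E * s * (s / real k) ^ l < L"
    by (auto simp: eventually_sequentially)
  define M where "M = exp (E * s ^ Suc l0)"
  have M1: "M \<ge> 1" using E s1 by (simp add: M_def)
  have key: "\<alpha> (y ^ n) \<le> M * (r / r') ^ n" for n
  proof (cases "n < k ^ Suc l0")
    case True
    have "\<alpha> (y ^ n) \<le> M" unfolding M_def by (rule E(2)[OF True])
    also have "\<dots> \<le> M * (r / r') ^ n" using M1 r' by (simp add: mult_le_cancel_left1)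
    finally show ?thesis .
  next
    case False
    then have "n > 0" using k2 by (auto intro: gr0I)
    then obtain l where l: "k ^ l \<le> n" "n < k ^ Suc l" using exists_power_interval k2 by blast
    have "l \<ge> l0"
    proof (rule ccontr)
      assume "\<not> l \<ge> l0"
      then have "k ^ Suc l \<le> k ^ Suc l0" using k2 by (intro power_increasing) auto
      then show False using l False by linarith
    qed
    have kl: "real k ^ l > 0" using k2 by simp
    have "E * s ^ Suc l = E * s * (s / real k) ^ l * real k ^ l"
      using kl by (simp add: power_divide)
    also have "\<dots> \<le> L * real k ^ l" using l0[OF \<open>l \<ge> l0\<close>] kl by simp
    also have "\<dots> \<le> L * real n" using l(1) L by (simp flip: of_nat_power)
    finally have "exp (E * s ^ Suc l) \<le> exp (real n * L)" by (simp add: mult.commute)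
    also have "\<dots> = (r / r') ^ n" using r' r0 by (simp add: exp_of_nat_mult L_def)
    finally have "\<alpha> (y ^ n) \<le> (r / r') ^ n" using E(2)[OF l(2)] by linarith
    also have "\<dots> \<le> M * (r / r') ^ n"
      using mult_right_mono[OF M1, of "(r / r') ^ n"] r'(1) r0 by simp
    finally show ?thesis .
  qed
  have "\<alpha> (x ^ n) \<le> M * r ^ n" for n
  proof -
    have "x = R r' * y" using r' by (simp add: y_def R_R)
    then have "x ^ n = R (r' ^ n) * y ^ n"
    proof (induction n)
      case (Suc n)
      then show ?case using y by (simp add: mult.assoc central R_R flip: R_mult)
    qed simp
    then have "\<alpha> (x ^ n) \<le> r' ^ n * \<alpha> (y ^ n)" using \<alpha>_R_mult[of "y ^ n" "r' ^ n"] y r' by simp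
    also have "\<dots> \<le> r' ^ n * (M * (r / r') ^ n)" using key r' by (intro mult_left_mono) auto
    also have "\<dots> = M * r ^ n" using r' by (simp add: power_divide)
    finally show ?thesis .
  qed
  then show thesis using that M1 by (meson less_le_trans zero_less_one)
qed

section \<open>Power series in the complete norm\<close>

definition tends :: "(nat \<Rightarrow> 'u) \<Rightarrow> 'u \<Rightarrow> bool" where
  "tends f x \<longleftrightarrow> (\<lambda>n. \<alpha> (f n - x)) \<longlonglongrightarrow> 0"

lemma tends_unique:
  assumes "tends f x" "tends f y" "\<And>n. f n \<in> S" "x \<in> S" "y \<in> S" shows "x = y"
proof -
  have "(\<lambda>n. \<alpha> (f n - x) + \<alpha> (f n - y)) \<longlonglongrightarrow> 0 + 0"
    using assms by (intro tendsto_add) (auto simp: tends_def)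
  moreover have "\<alpha> (x - y) \<le> \<alpha> (f n - x) + \<alpha> (f n - y)" for n
    using \<alpha>_diff[of "f n - y" "f n - x"] assms by simp
  ultimately have "\<alpha> (x - y) \<le> 0 + 0" by (intro LIMSEQ_le_const) auto
  then have "\<alpha> (x - y) = 0" using \<alpha>_nonneg[of "x - y"] assms by (intro antisym) auto
  then show ?thesis using \<alpha>_eq_zero[of "x - y"] assms by simp
qed

lemma tends_const: "tends (\<lambda>n. x) x"
  by (simp add: tends_def)

lemma tends_null: assumes "\<And>n. f n \<in> S" "\<And>n. \<alpha> (f n) \<le> b n" "b \<longlonglongrightarrow> 0" shows "tends f 0"
  unfolding tends_def using assms
  by (intro tendsto_sandwich[OF _ _ tendsto_const assms(3)]) auto

lemma tends_add:
  assumes "tends f x" "tends g y" "\<And>n. f n \<in> S" "\<And>n. g n \<in> S" "x \<in> S" "y \<in> S"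
  shows "tends (\<lambda>n. f n + g n) (x + y)"
proof -
  have lim: "(\<lambda>n. \<alpha> (f n - x) + \<alpha> (g n - y)) \<longlonglongrightarrow> 0"
    using tendsto_add[OF assms(1,2)[unfolded tends_def]] by simp
  have "\<alpha> (f n + g n - (x + y)) \<le> \<alpha> (f n - x) + \<alpha> (g n - y)" for n
    using \<alpha>_triangle[of "f n - x" "g n - y"] assms by (simp add: algebra_simps)
  then show ?thesis unfolding tends_def using assms
    by (intro tendsto_sandwich[OF _ _ tendsto_const lim]) auto
qed

lemma tends_mult_left:
  assumes "tends f x" "\<And>n. f n \<in> S" "x \<in> S" "y \<in> S"
  shows "tends (\<lambda>n. y * f n) (y * x)"
proof -
  have lim: "(\<lambda>n. \<alpha> y * \<alpha> (f n - x)) \<longlonglongrightarrow> 0"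
    using tendsto_mult_left[OF assms(1)[unfolded tends_def]] by simp
  have "\<alpha> (y * f n - y * x) \<le> \<alpha> y * \<alpha> (f n - x)" for n
    using \<alpha>_mult[of y "f n - x"] assms by (simp add: right_diff_distrib)
  then show ?thesis unfolding tends_def using assms
    by (intro tendsto_sandwich[OF _ _ tendsto_const lim]) auto
qed

lemma tends_mult_right:
  assumes "tends f x" "\<And>n. f n \<in> S" "x \<in> S" "y \<in> S"
  shows "tends (\<lambda>n. f n * y) (x * y)"
proof -
  have lim: "(\<lambda>n. \<alpha> (f n - x) * \<alpha> y) \<longlonglongrightarrow> 0"
    using tendsto_mult_right[OF assms(1)[unfolded tends_def]] by simp
  have "\<alpha> (f n * y - x * y) \<le> \<alpha> (f n - x) * \<alpha> y" for n
    using \<alpha>_mult[of "f n - x" y] assms by (simp add: left_diff_distrib)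
  then show ?thesis unfolding tends_def using assms
    by (intro tendsto_sandwich[OF _ _ tendsto_const lim]) auto
qed

lemma tends_star:
  assumes "tends f x" "\<And>n. f n \<in> S" "x \<in> S" shows "tends (\<lambda>n. star (f n)) (star x)"
proof -
  obtain B where B: "\<And>x. x \<in> S \<Longrightarrow> \<alpha> (star x) \<le> B * \<alpha> x" using \<alpha>_star by blast
  have lim: "(\<lambda>n. B * \<alpha> (f n - x)) \<longlonglongrightarrow> 0"
    using tendsto_mult_left[OF assms(1)[unfolded tends_def]] by simp
  have "\<alpha> (star (f n) - star x) \<le> B * \<alpha> (f n - x)" for n
    using B[of "f n - x"] assms by simp
  then show ?thesis unfolding tends_def using assms
    by (intro tendsto_sandwich[OF _ _ tendsto_const lim]) auto
qed

lemma series_converges: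
  assumes f: "\<And>n. f n \<in> S" "\<And>n. \<alpha> (f n) \<le> b n" and b: "summable b"
  obtains x where "x \<in> S" "tends (\<lambda>n. \<Sum>i<n. f i) x"
proof -
  have b0: "b n \<ge> 0" for n using f[of n] \<alpha>_nonneg order_trans by blast
  have le: "\<alpha> ((\<Sum>i<n. f i) - (\<Sum>i<m. f i)) \<le> sum b {m..<n}" if "m \<le> n" for m n
  proof -
    have "(\<Sum>i<n. f i) - (\<Sum>i<m. f i) = (\<Sum>i\<in>{m..<n}. f i)"
      using that by (metis sum_diff_nat_ivl lessThan_atLeast0 zero_le)
    then have "\<alpha> ((\<Sum>i<n. f i) - (\<Sum>i<m. f i)) \<le> (\<Sum>i\<in>{m..<n}. \<alpha> (f i))"
      using f by (simp add: \<alpha>_sum)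
    also have "\<dots> \<le> sum b {m..<n}" using f by (intro sum_mono)
    finally show ?thesis .
  qed
  have "\<exists>x\<in>S. (\<lambda>n. \<alpha> ((\<Sum>i<n. f i) - x)) \<longlonglongrightarrow> 0"
  proof (rule \<alpha>_complete[unfolded complete_wrt_def, rule_format])
    show "(\<Sum>i<n. f i) \<in> S" for n using f by (intro sum_closed)
    fix e :: real assume "e > 0"
    then obtain M where M: "\<And>m n. m \<ge> M \<Longrightarrow> norm (sum b {m..<n}) < e"
      using b unfolding summable_Cauchy by blast
    have "\<alpha> ((\<Sum>i<m. f i) - (\<Sum>i<n. f i)) < e" if mn: "m \<ge> M" "n \<ge> M" for m n
    proof (cases "m \<le> n")
      case True
      have "\<alpha> ((\<Sum>i<m. f i) - (\<Sum>i<n. f i)) = \<alpha> ((\<Sum>i<n. f i) - (\<Sum>i<m. f i))"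
        using f by (intro \<alpha>_diff_commute sum_closed)
      then show ?thesis using le[OF True] M[OF mn(1), of n] by simp
    next
      case False
      then show ?thesis using le[of n m] M[OF mn(2), of m] by simp
    qed
    then show "\<exists>M. \<forall>m\<ge>M. \<forall>n\<ge>M. \<alpha> ((\<Sum>i<m. f i) - (\<Sum>i<n. f i)) < e" by blast
  qed
  then show thesis using that unfolding tends_def by blast
qed

lemma power_series_converges:
  assumes x: "x \<in> S" "N x < 1" and b: "\<And>n. \<bar>b n\<bar> \<le> 1"
  obtains y where "y \<in> S" "tends (\<lambda>n. \<Sum>i<n. R (b i) * x ^ i) y"
proof -
  define r where "r = (N x + 1) / 2"
  have r: "0 \<le> r" "r < 1" "N x < r" using x N_nonneg'[of x] by (simp_all add: r_def)
  obtain K where K: "K > 0" "\<And>n. \<alpha> (x ^ n) \<le> K * r ^ n" using power_bound[OF x(1) r(3)] by blast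
  have "\<alpha> (R (b n) * x ^ n) \<le> K * r ^ n" for n
  proof -
    have "\<alpha> (R (b n) * x ^ n) \<le> \<bar>b n\<bar> * \<alpha> (x ^ n)" using x by (intro \<alpha>_R_mult) auto
    also have "\<dots> \<le> 1 * \<alpha> (x ^ n)" using b x by (intro mult_right_mono) auto
    finally show ?thesis using K(2)[of n] by simp
  qed
  moreover have "summable (\<lambda>n. K * r ^ n)" using r by (intro summable_mult summable_geometric) auto
  moreover have "R (b n) * x ^ n \<in> S" for n using x by simp
  ultimately show thesis
    using series_converges[of "\<lambda>i. R (b i) * x ^ i" "\<lambda>n. K * r ^ n"] that by blast
qed

text \<open>The geometric series converges in \<open>\<alpha>\<close> although only
  \<open>N x < 1\<close> is assumed: \<open>power_bound\<close> makes its terms decay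
  geometrically.\<close>

lemma neumann:
  assumes x: "x \<in> S" "N x < 1" shows "\<exists>v\<in>S. v * (1 - x) = 1 \<and> (1 - x) * v = 1"
proof -
  obtain v where v: "v \<in> S" "tends (\<lambda>n. \<Sum>i<n. R 1 * x ^ i) v"
    using power_series_converges[OF x, of "\<lambda>_. 1"] by auto
  have v': "tends (\<lambda>n. \<Sum>i<n. x ^ i) v" using v by simp
  have sS: "(\<Sum>i<n. x ^ i) \<in> S" for n using x by (intro sum_closed) auto
  define r where "r = (N x + 1) / 2"
  have r: "0 \<le> r" "r < 1" "N x < r" using x N_nonneg'[of x] by (simp_all add: r_def)
  obtain K where K: "K > 0" "\<And>n. \<alpha> (x ^ n) \<le> K * r ^ n" using power_bound[OF x(1) r(3)] by blast
  have "(\<lambda>n. K * r ^ n) \<longlonglongrightarrow> K * 0" using r by (intro tendsto_mult_left LIMSEQ_power_zero) auto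
  then have "tends (\<lambda>n. - (x ^ n)) 0" using x K by (intro tends_null[of _ "\<lambda>n. K * r ^ n"]) auto
  from tends_add[OF tends_const[of 1] this] x have one: "tends (\<lambda>n. 1 - x ^ n) 1" by simp
  have "(1 - x) * (\<Sum>i<n. x ^ i) = 1 - x ^ n \<and> (\<Sum>i<n. x ^ i) * (1 - x) = 1 - x ^ n" for n
  proof (induction n)
    case (Suc n)
    have "(1 - x) * (\<Sum>i<Suc n. x ^ i) = (1 - x ^ n) + (1 - x) * x ^ n"
      using Suc by (simp add: distrib_left)
    moreover have "(\<Sum>i<Suc n. x ^ i) * (1 - x) = (1 - x ^ n) + x ^ n * (1 - x)"
      using Suc by (simp add: distrib_right)
    ultimately show ?case by (simp add: left_diff_distrib right_diff_distrib power_commutes)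
  qed simp
  then have "tends (\<lambda>n. (1 - x) * (\<Sum>i<n. x ^ i)) 1" "tends (\<lambda>n. (\<Sum>i<n. x ^ i) * (1 - x)) 1"
    using one by simp_all
  moreover have "tends (\<lambda>n. (1 - x) * (\<Sum>i<n. x ^ i)) ((1 - x) * v)"
    using v' sS v(1) x by (intro tends_mult_left) auto
  moreover have "tends (\<lambda>n. (\<Sum>i<n. x ^ i) * (1 - x)) (v * (1 - x))"
    using v' sS v(1) x by (intro tends_mult_right) auto
  moreover have "(1 - x) * (\<Sum>i<n. x ^ i) \<in> S" "(\<Sum>i<n. x ^ i) * (1 - x) \<in> S"
    "(1 - x) * v \<in> S" "v * (1 - x) \<in> S" for n
    using sS v(1) x by auto
  ultimately have "(1 - x) * v = 1" "v * (1 - x) = 1"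
    using tends_unique[of "\<lambda>n. (1 - x) * (\<Sum>i<n. x ^ i)" "(1 - x) * v" 1]
      tends_unique[of "\<lambda>n. (\<Sum>i<n. x ^ i) * (1 - x)" "v * (1 - x)" 1] by blast+
  then show ?thesis using v(1) by blast
qed

text \<open>This is the binomial series of exponent 1/2. Its partial sums are real polynomials in
  \<open>x\<close>, so self-adjointness and the commutation clause pass to the limit.\<close>

lemma square_root_exists:
  assumes x: "x \<in> S" "star x = x" "N x < 1"
  shows "\<exists>t\<in>S. star t = t \<and> t * t = 1 - x \<and> (\<forall>z\<in>S. z * x = x * z \<longrightarrow> z * t = t * z)"
proof -
  define b :: "nat \<Rightarrow> real" where "b i = (- 1) ^ i * (1 / 2 gchoose i)" for i
  have b1: "\<bar>b i\<bar> \<le> 1" for i using abs_gbinomial_half_le[of i] by (simp add: b_def abs_mult power_abs)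
  define T where "T n = (\<Sum>i<n. R (b i) * x ^ i)" for n
  have TS: "T n \<in> S" for n unfolding T_def using x by (intro sum_closed) auto
  obtain t where "t \<in> S" "tends (\<lambda>n. \<Sum>i<n. R (b i) * x ^ i) t"
    by (rule power_series_converges[of x b, OF x(1,3) b1])
  then have t: "t \<in> S" "tends T t" by (simp_all add: T_def[abs_def])
  have comm: "z * t = t * z" if z: "z \<in> S" "z * x = x * z" for z
  proof -
    have "z * x ^ i = x ^ i * z" for i
      by (induction i) (simp_all add: mult.assoc[symmetric] z(2), metis mult.assoc z(2))
    then have "z * T n = T n * z" for n
      unfolding T_def sum_distrib_left sum_distrib_right using z by (simp add: central mult.assoc)
    then have "tends (\<lambda>n. z * T n) (t * z)" using tends_mult_right[OF t(2) TS t(1) z(1)] by simp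
    then show ?thesis using tends_mult_left[OF t(2) TS t(1) z(1)] TS t(1) z(1)
      by (metis mult_closed tends_unique)
  qed
  have "star (T n) = T n" for n
  proof -
    have "star (\<Sum>i<n. R (b i) * x ^ i) = (\<Sum>i<n. R (b i) * x ^ i)" for n
      using x sum_closed[of "{..<n}" "\<lambda>i. R (b i) * x ^ i" for n] by (induction n) (auto simp: star_power central)
    then show ?thesis by (simp add: T_def)
  qed
  then have "tends T (star t)" using tends_star[OF t(2) TS t(1)] by simp
  then have st: "star t = t" using tends_unique[OF _ t(2) TS] t(1) by blast
  define r where "r = (N x + 1) / 2"
  have r: "0 < r" "r < 1" "N x < r" using x N_nonneg'[of x] by (simp_all add: r_def add_nonneg_pos)
  obtain K where K: "K > 0" "\<And>n. \<alpha> (x ^ n) \<le> K * r ^ n" using power_bound[OF x(1) r(3)] by blast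
  have coef: "(\<Sum>i\<le>m. b i * b (m - i)) = (- 1) ^ m * (1 gchoose m)" for m
  proof -
    have "b i * b (m - i) = (- 1) ^ m * ((1 / 2 gchoose i) * (1 / 2 gchoose (m - i)))" if "i \<le> m" for i
      using that by (simp add: b_def mult_ac) (simp flip: power_add)
    then have "(\<Sum>i\<le>m. b i * b (m - i)) = (- 1) ^ m * (\<Sum>i\<le>m. (1 / 2 gchoose i) * (1 / 2 gchoose (m - i)))"
      by (simp add: sum_distrib_left)
    also have "(\<Sum>i\<le>m. (1 / 2 gchoose i) * ((1 / 2 :: real) gchoose (m - i))) = 1 gchoose m"
      using gbinomial_Vandermonde[of "1 / 2 :: real" "1 / 2" m] by (simp add: atMost_atLeast0)
    finally show ?thesis .
  qed
  have g1: "(- 1) ^ m * ((1 :: real) gchoose m) = (if m = 0 then 1 else if m = 1 then - 1 else 0)" for m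
    using binomial_gbinomial[of 1 m, where 'a = real] by (cases m) (auto simp: binomial_eq_0)
  define D where "D n = {(i, j). i < n \<and> j < (n :: nat)}" for n
  have D: "finite (D n)" "card (D n) = n * n" for n
  proof -
    have "D n = {..<n} \<times> {..<n}" by (auto simp: D_def)
    then show "finite (D n)" "card (D n) = n * n" by simp_all
  qed
  define F where "F = (\<lambda>(i, j). R (b i * b j) * x ^ (i + j))"
  have FS: "F p \<in> S" for p using x by (auto simp: F_def split: prod.split)
  have TT: "T n * T n = sum F (D n)" for n
  proof -
    have "T n * T n = (\<Sum>i<n. \<Sum>j<n. (R (b i) * x ^ i) * (R (b j) * x ^ j))"
      by (simp add: T_def sum_product)
    also have "\<dots> = (\<Sum>i<n. \<Sum>j<n. F (i, j))"
      using x by (simp add: F_def central mult.assoc R_R power_add)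
    also have "\<dots> = sum F ({..<n} \<times> {..<n})" by (simp add: sum.cartesian_product)
    also have "{..<n} \<times> {..<n} = D n" by (auto simp: D_def)
    finally show ?thesis .
  qed
  \<comment> \<open>By Vandermonde the terms of the Cauchy product over the triangle
    \<open>i + j < n\<close> add up to the truncated binomial series of exponent 1, and
    \<open>n \<ge> 2\<close> makes both of its terms present.\<close>
  have low: "sum F {(i, j). i + j < n} = 1 - x" if "n \<ge> 2" for n
  proof -
    have "sum F {(i, j). i + j < n} = (\<Sum>m<n. \<Sum>i\<le>m. F (i, m - i))"
      using sum.triangle_reindex[of "\<lambda>i j. F (i, j)" n] by simp
    also have "\<dots> = (\<Sum>m<n. R ((- 1) ^ m * (1 gchoose m)) * x ^ m)"
    proof (rule sum.cong[OF refl])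
      fix m
      have "(\<Sum>i\<le>m. F (i, m - i)) = (\<Sum>i\<le>m. R (b i * b (m - i)) * x ^ m)" by (simp add: F_def)
      also have "\<dots> = (\<Sum>i\<le>m. R (b i * b (m - i))) * x ^ m" by (simp add: sum_distrib_right)
      also have "(\<Sum>i\<le>m. R (b i * b (m - i))) = R (\<Sum>i\<le>m. b i * b (m - i))"
        by (simp add: R_sum)
      finally show "(\<Sum>i\<le>m. F (i, m - i)) = R ((- 1) ^ m * (1 gchoose m)) * x ^ m" by (simp add: coef)
    qed
    also have "\<dots> = (\<Sum>m<n. if m = 0 then 1 else if m = 1 then - x else 0)"
      by (intro sum.cong refl) (simp add: g1 R_minus)
    also have "\<dots> = (\<Sum>m\<in>{0, 1 :: nat}. if m = 0 then 1 else if m = 1 then - x else 0)"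
      using that by (intro sum.mono_neutral_right) auto
    also have "\<dots> = 1 - x" by simp
    finally show ?thesis .
  qed
  \<comment> \<open>The square of a partial sum has at most \<open>n ^ 2\<close> terms outside the
    triangle, each of degree at least \<open>n\<close> and so of norm at most
    \<open>K * r ^ n\<close>.\<close>
  have "\<alpha> (T n * T n - (1 - x)) \<le> real n ^ 2 * (K * r ^ n)" if n: "n \<ge> 2" for n
  proof -
    have sub: "{(i, j). i + j < n} \<subseteq> D n" by (auto simp: D_def)
    have "T n * T n - (1 - x) = sum F (D n - {(i, j). i + j < n})"
      unfolding TT low[OF n, symmetric] using D sub by (simp add: sum_diff)
    then have "\<alpha> (T n * T n - (1 - x)) \<le> (\<Sum>p\<in>D n - {(i, j). i + j < n}. \<alpha> (F p))"
      using FS by (simp add: \<alpha>_sum)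
    also have "\<dots> \<le> (\<Sum>p\<in>D n - {(i, j). i + j < n}. K * r ^ n)"
    proof (rule sum_mono)
      fix p assume p: "p \<in> D n - {(i, j). i + j < n}"
      obtain i j where ij: "p = (i, j)" "n \<le> i + j" using p by (cases p) auto
      have "\<alpha> (F p) \<le> \<bar>b i * b j\<bar> * \<alpha> (x ^ (i + j))" unfolding F_def ij using x by (simp add: \<alpha>_R_mult)
      also have "\<dots> \<le> 1 * \<alpha> (x ^ (i + j))"
        using b1[of i] b1[of j] x by (intro mult_right_mono) (auto simp: abs_mult mult_le_one)
      also have "\<dots> \<le> K * r ^ (i + j)" using K(2)[of "i + j"] by simp
      also have "\<dots> \<le> K * r ^ n" using K(1) r ij by (intro mult_left_mono power_decreasing) auto
      finally show "\<alpha> (F p) \<le> K * r ^ n" .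
    qed
    also have "\<dots> \<le> (\<Sum>p\<in>D n. K * r ^ n)" using D K r by (intro sum_mono2) auto
    also have "\<dots> = real n ^ 2 * (K * r ^ n)" using D by (simp add: power2_eq_square)
    finally show ?thesis .
  qed
  then have ub: "eventually (\<lambda>n. \<alpha> (T n * T n - (1 - x)) \<le> real n ^ 2 * (K * r ^ n)) sequentially"
    unfolding eventually_sequentially by blast
  have lb: "eventually (\<lambda>n. 0 \<le> \<alpha> (T n * T n - (1 - x))) sequentially"
    using x(1) TS by (intro always_eventually allI \<alpha>_nonneg) blast
  have "(\<lambda>n. real n ^ 2 * (K * r ^ n)) \<longlonglongrightarrow> 0" using r K by real_asymp
  then have lim1: "tends (\<lambda>n. T n * T n) (1 - x)"
    unfolding tends_def by (rule tendsto_sandwich[OF lb ub tendsto_const])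
  have "tends (\<lambda>n. T n * T n) (t * t)"
  proof -
    have "convergent (\<lambda>n. \<alpha> (T n - t))" using t(2) by (auto simp: tends_def convergent_def)
    then obtain B where B: "B > 0" "\<And>n. norm (\<alpha> (T n - t)) \<le> B"
      using convergent_imp_Bseq BseqE by metis
    define E where "E = B + \<alpha> t"
    have E: "\<alpha> (T n) \<le> E" for n
      using \<alpha>_triangle[of "T n - t" t] B(2)[of n] TS t(1) by (simp add: E_def)
    have "tends (\<lambda>n. T n * (T n - t)) 0"
    proof (rule tends_null)
      show "T n * (T n - t) \<in> S" for n using TS t by simp
      show "\<alpha> (T n * (T n - t)) \<le> E * \<alpha> (T n - t)" for n
        using \<alpha>_mult[of "T n" "T n - t"] mult_right_mono[OF E[of n], of "\<alpha> (T n - t)"] TS t by force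
      show "(\<lambda>n. E * \<alpha> (T n - t)) \<longlonglongrightarrow> 0"
        using tendsto_mult_left[OF t(2)[unfolded tends_def], of E] by simp
    qed
    from tends_add[OF this tends_mult_right[OF t(2) TS t(1) t(1)]] TS t(1)
    show ?thesis by (simp add: right_diff_distrib)
  qed
  then have "t * t = 1 - x" using tends_unique[OF _ lim1] TS t x by simp
  then show ?thesis using t(1) st comm by blast
qed

sublocale spectral_cstar S \<iota> star N
  by unfold_locales
    (auto intro: N_nonneg' N_triangle' N_mult' N_cstar' neumann square_root_exists simp: N_iota')

end

section \<open>Rapidly decaying coefficients with local support\<close>

text \<open>Sign and shift are those of multiplication by \<open>w - 1\<close>: if \<open>d\<close>
  are the coefficients of a Laurent series in \<open>w\<close>, then \<open>bdiff m d\<close> are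
  the coefficients of \<open>(w - 1) ^ m\<close> times that series.\<close>

fun bdiff :: "nat \<Rightarrow> (int \<Rightarrow> real) \<Rightarrow> int \<Rightarrow> real" where
  "bdiff 0 d = d"
| "bdiff (Suc m) d = bdiff m (\<lambda>n. d (n - 1) - d n)"

lemma bdiff_shift: "bdiff m (\<lambda>n. d (n - 1)) n = bdiff m d (n - 1)"
proof (induction m arbitrary: d)
  case (Suc m)
  then show ?case using Suc[of "\<lambda>n. d (n - 1) - d n"] by simp
qed simp

lemma bdiff_add: "bdiff m (\<lambda>n. d n + e n) n = bdiff m d n + bdiff m e n"
proof (induction m arbitrary: d e)
  case (Suc m)
  have "(\<lambda>n. d (n - 1) + e (n - 1) - (d n + e n)) = (\<lambda>n. (d (n - 1) - d n) + (e (n - 1) - e n))"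
    by auto
  then show ?case by (simp add: Suc)
qed simp

lemma bdiff_diff: "bdiff m (\<lambda>n. d n - e n) n = bdiff m d n - bdiff m e n"
proof (induction m arbitrary: d e)
  case (Suc m)
  have "(\<lambda>n. d (n - 1) - e (n - 1) - (d n - e n)) = (\<lambda>n. (d (n - 1) - d n) - (e (n - 1) - e n))"
    by auto
  then show ?case by (simp add: Suc)
qed simp

lemma bdiff_cmult: "bdiff m (\<lambda>n. c * d n) n = c * bdiff m d n"
proof (induction m arbitrary: d)
  case (Suc m)
  then show ?case using Suc[of "\<lambda>n. d (n - 1) - d n"] by (simp add: right_diff_distrib)
qed simp

lemma bdiff_Suc: "bdiff (Suc m) d n = bdiff m d (n - 1) - bdiff m d n"
  using bdiff_diff[of m "\<lambda>n. d (n - 1)" d n] by (simp add: bdiff_shift)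

lemma bdiff_limit:
  assumes "\<And>n. (\<lambda>L. d L n) \<longlonglongrightarrow> c n" shows "(\<lambda>L. bdiff m (d L) n) \<longlonglongrightarrow> bdiff m c n"
proof (induction m arbitrary: n)
  case (Suc m)
  show ?case unfolding bdiff_Suc by (intro tendsto_diff Suc)
qed (simp add: assms)

lemma bdiff_bound_support:
  assumes "\<And>j. j \<le> m \<Longrightarrow> \<bar>d (n - int j)\<bar> \<le> B" shows "\<bar>bdiff m d n\<bar> \<le> 2 ^ m * B"
  using assms
proof (induction m arbitrary: n)
  case (Suc m)
  have "\<bar>d (n - 1 - int j)\<bar> \<le> B" if "j \<le> m" for j
    using Suc.prems[of "Suc j"] that by (simp add: algebra_simps)
  then have 1: "\<bar>bdiff m d (n - 1)\<bar> \<le> 2 ^ m * B" by (intro Suc.IH)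
  have 2: "\<bar>bdiff m d n\<bar> \<le> 2 ^ m * B" using Suc.prems by (intro Suc.IH) auto
  show ?case unfolding bdiff_Suc using 1 2 by simp
qed (use assms in force)

text \<open>This is the Bernstein-type bound for Fourier coefficients of a measure of total mass
  \<open>B\<close> carried by \<open>[- \<delta>, \<delta>]\<close>; it expresses localization
  without mentioning measures.\<close>

definition smooth :: "real \<Rightarrow> real \<Rightarrow> (int \<Rightarrow> real) \<Rightarrow> bool" where
  "smooth B \<delta> d \<longleftrightarrow> (\<forall>m n. \<bar>bdiff m d n\<bar> \<le> B * \<delta> ^ m)"

text \<open>A Leibniz rule for differences. The parameters \<open>\<delta>\<close> and
  \<open>\<eta>\<close> add, as supports do under convolution.\<close>

lemma smooth_mult:
  assumes "smooth A \<delta> d" "smooth B \<eta> e" "0 \<le> \<delta>" "0 \<le> \<eta>"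
  shows "smooth (A * B) (\<delta> + \<eta>) (\<lambda>n. d n * e n)"
proof -
  have "\<bar>bdiff m (\<lambda>n. d n * e n) n\<bar> \<le> A * B * (\<delta> + \<eta>) ^ m"
    if "smooth A \<delta> d" "smooth B \<eta> e" for m n d e A B
    using that
  proof (induction m arbitrary: d e A B)
    case 0
    then have "\<bar>bdiff 0 d n\<bar> \<le> A * \<delta> ^ 0" "\<bar>bdiff 0 e n\<bar> \<le> B * \<eta> ^ 0" unfolding smooth_def by blast+
    then show ?case by (simp add: abs_mult mult_mono')
  next
    case (Suc m)
    have d': "smooth (A * \<delta>) \<delta> (\<lambda>n. d (n - 1) - d n)" unfolding smooth_def
    proof (intro allI)
      fix m n
      have "\<bar>bdiff (Suc m) d n\<bar> \<le> A * \<delta> ^ Suc m" using Suc.prems unfolding smooth_def by blast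
      then show "\<bar>bdiff m (\<lambda>n. d (n - 1) - d n) n\<bar> \<le> A * \<delta> * \<delta> ^ m" by (simp add: mult_ac)
    qed
    have e': "smooth (B * \<eta>) \<eta> (\<lambda>n. e (n - 1) - e n)" unfolding smooth_def
    proof (intro allI)
      fix m n
      have "\<bar>bdiff (Suc m) e n\<bar> \<le> B * \<eta> ^ Suc m" using Suc.prems unfolding smooth_def by blast
      then show "\<bar>bdiff m (\<lambda>n. e (n - 1) - e n) n\<bar> \<le> B * \<eta> * \<eta> ^ m" by (simp add: mult_ac)
    qed
    have es: "smooth B \<eta> (\<lambda>n. e (n - 1))"
      using Suc.prems(2) unfolding smooth_def bdiff_shift by blast
    have "(\<lambda>n. d (n - 1) * e (n - 1) - d n * e n)
        = (\<lambda>n. (d (n - 1) - d n) * e (n - 1) + d n * (e (n - 1) - e n))"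
      by (auto simp: algebra_simps)
    then have "bdiff (Suc m) (\<lambda>n. d n * e n) n = bdiff m (\<lambda>n. (d (n - 1) - d n) * e (n - 1)) n
        + bdiff m (\<lambda>n. d n * (e (n - 1) - e n)) n" by (simp add: bdiff_add)
    also have "\<bar>\<dots>\<bar> \<le> A * \<delta> * B * (\<delta> + \<eta>) ^ m + A * (B * \<eta>) * (\<delta> + \<eta>) ^ m"
      using Suc.IH[OF d' es] Suc.IH[OF Suc.prems(1) e'] by linarith
    also have "\<dots> = A * B * (\<delta> + \<eta>) ^ Suc m" by (simp add: algebra_simps)
    finally show ?case .
  qed
  then show ?thesis using assms unfolding smooth_def by blast
qed

text \<open>A difference of cosines is again a cosine, multiplied by
  \<open>2 * sin (\<theta> / 2)\<close> and shifted in phase; the induction therefore runs over an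
  arbitrary phase \<open>b\<close>.\<close>

lemma smooth_cos: "smooth 1 \<bar>\<theta>\<bar> (\<lambda>n. cos (\<theta> * of_int n))"
proof -
  have 0: "\<bar>bdiff m (\<lambda>n. cos (\<theta> * of_int n + b)) n\<bar> \<le> \<bar>2 * sin (\<theta> / 2)\<bar> ^ m" for m n b
  proof (induction m arbitrary: b)
    case (Suc m)
    have "(\<lambda>n. cos (\<theta> * of_int (n - 1) + b) - cos (\<theta> * of_int n + b))
       = (\<lambda>n. (2 * sin (\<theta> / 2)) * cos (\<theta> * of_int n + (b - \<theta> / 2 - pi / 2)))"
    proof
      fix n :: int
      have "cos (y - pi / 2) = sin y" for y
        using sin_cos_eq[of y] cos_minus[of "pi / 2 - y"] by simp
      from this[of "\<theta> * of_int n + b - \<theta> / 2"]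
      have "cos (\<theta> * of_int n + (b - \<theta> / 2 - pi / 2)) = sin (\<theta> * of_int n + b - \<theta> / 2)"
        by (simp add: algebra_simps)
      moreover have "cos (\<theta> * of_int (n - 1) + b) - cos (\<theta> * of_int n + b)
          = 2 * sin (\<theta> / 2) * sin (\<theta> * of_int n + b - \<theta> / 2)"
      proof -
        have e: "((\<theta> * of_int (n - 1) + b) + (\<theta> * of_int n + b)) / 2 = \<theta> * of_int n + b - \<theta> / 2"
          "((\<theta> * of_int n + b) - (\<theta> * of_int (n - 1) + b)) / 2 = \<theta> / 2"
          by (simp_all add: right_diff_distrib)
        have "cos (\<theta> * of_int (n - 1) + b) - cos (\<theta> * of_int n + b)
            = 2 * sin (\<theta> * of_int n + b - \<theta> / 2) * sin (\<theta> / 2)"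
          using cos_diff_cos[of "\<theta> * of_int (n - 1) + b" "\<theta> * of_int n + b"] unfolding e .
        also have "\<dots> = 2 * sin (\<theta> / 2) * sin (\<theta> * of_int n + b - \<theta> / 2)"
          by (rule mult.commute[of "2 * _" _, THEN trans]) (rule mult.left_commute[THEN trans], rule mult.assoc[symmetric])
        finally show ?thesis .
      qed
      ultimately show "cos (\<theta> * of_int (n - 1) + b) - cos (\<theta> * of_int n + b)
          = (2 * sin (\<theta> / 2)) * cos (\<theta> * of_int n + (b - \<theta> / 2 - pi / 2))" by simp
    qed
    then have "bdiff (Suc m) (\<lambda>n. cos (\<theta> * of_int n + b)) n
        = (2 * sin (\<theta> / 2)) * bdiff m (\<lambda>n. cos (\<theta> * of_int n + (b - \<theta> / 2 - pi / 2))) n"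
      by (simp add: bdiff_cmult)
    also have "\<bar>\<dots>\<bar> \<le> \<bar>2 * sin (\<theta> / 2)\<bar> * \<bar>2 * sin (\<theta> / 2)\<bar> ^ m"
      unfolding abs_mult[of "2 * sin (\<theta> / 2)"] by (intro mult_left_mono Suc) auto
    finally show ?case by simp
  qed simp
  have 1: "\<bar>bdiff m (\<lambda>n. cos (\<theta> * of_int n)) n\<bar> \<le> \<bar>2 * sin (\<theta> / 2)\<bar> ^ m" for m n
    using 0[of m 0 n] by (simp only: add_0_right)
  have "\<bar>2 * sin (\<theta> / 2)\<bar> \<le> \<bar>\<theta>\<bar>"
    using abs_sin_x_le_abs_x[of "\<theta> / 2"] by linarith
  then have 2: "\<bar>2 * sin (\<theta> / 2)\<bar> ^ m \<le> \<bar>\<theta>\<bar> ^ m" for m by (rule power_mono) simp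
  show ?thesis unfolding smooth_def mult_1_left
    by (intro allI order_trans[OF 1 2])
qed

lemma smooth_one: "smooth 1 0 (\<lambda>n. 1)"
proof -
  have "bdiff m (\<lambda>n. 0) n = 0" for m n by (induction m) auto
  then have "\<bar>bdiff m (\<lambda>n. 1) n\<bar> \<le> 1 * 0 ^ m" for m n by (cases m) auto
  then show ?thesis by (simp add: smooth_def)
qed

lemma smooth_power:
  assumes "smooth 1 \<delta> d" "0 \<le> \<delta>" shows "smooth 1 (real j * \<delta>) (\<lambda>n. d n ^ j)"
proof (induction j)
  case (Suc j)
  have "smooth (1 * 1) (\<delta> + real j * \<delta>) (\<lambda>n. d n * d n ^ j)"
    using assms Suc by (intro smooth_mult) auto
  then show ?case by (simp add: algebra_simps)
qed (simp add: smooth_one)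

lemma smooth_prod:
  fixes L :: nat
  assumes "\<And>l. smooth 1 (\<delta> l) (d l)" "\<And>l. 0 \<le> \<delta> l"
  shows "smooth 1 (\<Sum>l<L. \<delta> l) (\<lambda>n. \<Prod>l<L. d l n)"
proof (induction L)
  case (Suc L)
  have "smooth (1 * 1) ((\<Sum>l<L. \<delta> l) + \<delta> L) (\<lambda>n. (\<Prod>l<L. d l n) * d L n)"
    using assms Suc by (intro smooth_mult sum_nonneg) auto
  then show ?case by simp
qed (simp add: smooth_one)

lemma smooth_mono: "smooth 1 \<delta> d \<Longrightarrow> 0 \<le> \<delta> \<Longrightarrow> \<delta> \<le> \<eta> \<Longrightarrow> smooth 1 \<eta> d"
  unfolding smooth_def by (meson mult_left_mono order_trans power_mono zero_le_one)

text \<open>The logarithm of the left side is \<open>E * s ^ l\<close> plus a term linear in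
  \<open>l\<close>, hence negligible against \<open>r ^ l\<close>; the finitely many small
  \<open>l\<close> go into \<open>K\<close>.\<close>

lemma double_exponential_domination:
  fixes E s r c :: real and k :: nat
  assumes s: "1 < s" "s < r" and c: "c > 0"
  obtains K where "K > 0" "\<And>l. exp (E * s ^ l) * real k ^ (2 * l) \<le> K * exp (c * r ^ l)"
proof -
  have r: "r > 1" using s by simp
  define b where "b l = E * (s / r) ^ l + 2 * ln (real k + 1) * (real l * (1 / r) ^ l)" for l
  have "b \<longlonglongrightarrow> E * 0 + 2 * ln (real k + 1) * 0"
    unfolding b_def[abs_def] using s r
    by (intro tendsto_add tendsto_mult_left LIMSEQ_power_zero powser_times_n_limit_0) auto
  then have "eventually (\<lambda>l. b l < c) sequentially" using c by (intro order_tendstoD) auto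
  then obtain l0 where l0: "\<And>l. l \<ge> l0 \<Longrightarrow> b l < c" by (auto simp: eventually_sequentially)
  define h where "h l = exp (E * s ^ l) * real k ^ (2 * l)" for l
  define K where "K = 1 + (\<Sum>l<l0. h l)"
  have h0: "h l \<ge> 0" for l by (simp add: h_def)
  have K: "K \<ge> 1" unfolding K_def using h0 by (simp add: sum_nonneg)
  have "h l \<le> K * exp (c * r ^ l)" for l
  proof (cases "l < l0")
    case True
    then have "h l \<le> (\<Sum>l<l0. h l)" using h0 by (intro member_le_sum) auto
    then have "h l \<le> K * 1" by (simp add: K_def)
    also have "\<dots> \<le> K * exp (c * r ^ l)" using K c r by (intro mult_left_mono) auto
    finally show ?thesis .
  next
    case False
    have rl: "r ^ l > 0" using r by simp
    have "h l \<le> exp (E * s ^ l) * (real k + 1) ^ (2 * l)"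
      unfolding h_def by (intro mult_left_mono power_mono) auto
    also have "(real k + 1) ^ (2 * l) = exp (2 * real l * ln (real k + 1))"
      using exp_of_nat_mult[of "2 * l" "ln (real k + 1)"] by simp
    also have "exp (E * s ^ l) * \<dots> = exp (b l * r ^ l)"
      using rl r by (simp add: b_def algebra_simps power_divide flip: exp_add)
    also have "\<dots> \<le> exp (c * r ^ l)" using l0[of l] False rl by simp
    also have "\<dots> \<le> K * exp (c * r ^ l)" using K by simp
    finally show ?thesis .
  qed
  then show thesis using that K unfolding h_def by (meson less_le_trans zero_less_one)
qed

text \<open>The coefficients \<open>c n = \<Prod>l. cos (a n / k^l)^(2 N l)\<close> with \<open>N l \<approx> r^l\<close>: they are the Fourier coefficients of a
  probability measure carried by a small neighbourhood of \<open>0\<close>, which bounds \<open>bdiff m c\<close> by \<open>\<delta>^m\<close>;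
  since \<open>r > s\<close> they decay fast enough to beat the weights \<open>exp (E s^l)\<close>.\<close>
theorem localized_coefficients:
  fixes k :: nat and s E \<delta> :: real
  assumes k: "k \<ge> 2" and s: "1 < s" "s < real k" and E: "E \<ge> 0" and \<delta>: "0 < \<delta>" "\<delta> \<le> 1"
  obtains c :: "int \<Rightarrow> real" and K :: real
  where "K > 0" "\<And>n. 0 \<le> c n" "c 0 = 1"
    "\<And>m i n. n = int i \<or> n = - int i - 1 \<Longrightarrow>
       \<exists>l. Suc i < k ^ l \<and> \<bar>bdiff m c n\<bar> * exp (E * s ^ l) \<le> K * \<delta> ^ m / real (Suc i) ^ 2"
proof -
  define r where "r = (s + real k) / 2"
  have r: "1 < r" "s < r" "r < real k" using s by (simp_all add: r_def)
  have k0: "real k > 1" using k by simp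
  define M where "M l = nat \<lceil>r ^ l\<rceil>" for l
  have M: "r ^ l \<le> real (M l)" "real (M l) \<le> 2 * r ^ l" for l
  proof -
    show "r ^ l \<le> real (M l)" unfolding M_def by linarith
    have "1 \<le> r ^ l" using r by simp
    then show "real (M l) \<le> 2 * r ^ l" unfolding M_def by linarith
  qed
  \<comment> \<open>Squared in view of the geometric mean taken below:
    \<open>\<delta>0 ^ m * 2 ^ m\<close> is at most \<open>(\<delta> ^ 2) ^ m\<close>, which leaves
    \<open>\<delta> ^ m\<close> after the square root.\<close>
  define \<delta>0 where "\<delta>0 = \<delta> ^ 2 / 4"
  have d0: "\<delta>0 > 0" using \<delta> by (simp add: \<delta>0_def)
  \<comment> \<open>The factor of index \<open>l\<close> contributes at most
    \<open>4 * a * (r / real k) ^ l\<close> to the smoothness parameter, and the geometric sum is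
    then at most \<open>\<delta>0\<close>. It converges because \<open>r\<close> was put below
    \<open>k\<close>. The bound 1 keeps the relevant angles where cosine is positive and
    decreasing.\<close>
  define a where "a = min 1 (\<delta>0 * (1 - r / real k) / 4)"
  have a: "0 < a" "a \<le> 1" using d0 r by (simp_all add: a_def)
  have "4 * min 1 (x / 4) \<le> x" for x :: real by (simp add: min_def)
  then have a4: "4 * a \<le> \<delta>0 * (1 - r / real k)" unfolding a_def .
  define b where "b l n = cos (a / real k ^ l * of_int n) ^ (2 * M l)" for l and n :: int
  have b01: "0 \<le> b l n" "b l n \<le> 1" for l n
  proof -
    show "0 \<le> b l n" by (simp add: b_def)
    have "\<bar>cos (a / real k ^ l * of_int n)\<bar> ^ (2 * M l) \<le> 1" by (intro power_le_one) auto
    then show "b l n \<le> 1" by (simp only: b_def power_even_abs even_mult_iff even_numeral simp_thms)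
  qed
  define p where "p L n = (\<Prod>l<L. b l n)" for L n
  have p0: "0 \<le> p L n" for L n unfolding p_def by (intro prod_nonneg) (auto simp: b01)
  have "decseq (\<lambda>L. p L n)" for n
    by (rule decseq_SucI) (use b01 p0 in \<open>simp add: p_def mult_left_le\<close>)
  then have conv: "convergent (\<lambda>L. p L n)" for n
    using p0 by (metis decseq_convergent convergentI)
  define c where "c n = lim (\<lambda>L. p L n)" for n
  have lim: "(\<lambda>L. p L n) \<longlonglongrightarrow> c n" for n using conv unfolding c_def by (simp add: convergent_LIMSEQ_iff)
  have c0: "0 \<le> c n" for n using lim[of n] p0 by (intro LIMSEQ_le_const) auto
  have "p L 0 = 1" for L by (simp add: p_def b_def)
  then have c1: "c 0 = 1" using lim[of 0] by (simp add: LIMSEQ_const_iff)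
  have cb: "c n \<le> b l n" for l n
  proof (rule LIMSEQ_le_const2[OF lim])
    have "p L n \<le> b l n" if "L \<ge> Suc l" for L
    proof -
      have "p L n = b l n * (\<Prod>j\<in>{..<L} - {l}. b j n)"
        unfolding p_def using that by (subst prod.remove[of _ l]) auto
      also have "\<dots> \<le> b l n" using b01 by (intro mult_left_le prod_le_1) auto
      finally show ?thesis .
    qed
    then show "\<exists>N. \<forall>L\<ge>N. p L n \<le> b l n" by blast
  qed
  have smooth_b: "smooth 1 (real (2 * M l) * \<bar>a / real k ^ l\<bar>) (b l)" for l
    unfolding b_def by (intro smooth_power smooth_cos) auto
  have sum_le: "(\<Sum>l<L. real (2 * M l) * \<bar>a / real k ^ l\<bar>) \<le> \<delta>0" for L
  proof -
    have "real (2 * M l) * \<bar>a / real k ^ l\<bar> \<le> 4 * a * (r / real k) ^ l" for l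
    proof -
      have "real (2 * M l) * \<bar>a / real k ^ l\<bar> = 2 * real (M l) * (a / real k ^ l)" using a by simp
      also have "\<dots> \<le> 2 * (2 * r ^ l) * (a / real k ^ l)" using M(2)[of l] a by (intro mult_right_mono) auto
      finally show ?thesis by (simp add: power_divide mult_ac)
    qed
    then have "(\<Sum>l<L. real (2 * M l) * \<bar>a / real k ^ l\<bar>) \<le> (\<Sum>l<L. 4 * a * (r / real k) ^ l)"
      by (rule sum_mono)
    also have "\<dots> = 4 * a * (\<Sum>l<L. (r / real k) ^ l)" by (simp add: sum_distrib_left)
    also have "(\<Sum>l<L. (r / real k) ^ l) \<le> (\<Sum>l. (r / real k) ^ l)"
      using r by (intro sum_le_suminf summable_geometric) auto
    also have "(\<Sum>l. (r / real k) ^ l) = 1 / (1 - r / real k)" using r by (intro suminf_geometric) auto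
    also have "4 * a * (1 / (1 - r / real k)) \<le> \<delta>0 * (1 - r / real k) * (1 / (1 - r / real k))"
      using r a4 by (intro mult_right_mono) auto
    also have "\<dots> = \<delta>0" using r by simp
    finally show ?thesis using a by simp
  qed
  have smooth_p: "smooth 1 \<delta>0 (p L)" for L
    unfolding p_def
    by (rule smooth_mono[OF smooth_prod[OF smooth_b] _ sum_le]) (auto intro: sum_nonneg)
  have bd1: "\<bar>bdiff m c n\<bar> \<le> \<delta>0 ^ m" for m n
  proof (rule LIMSEQ_le_const2)
    show "(\<lambda>L. \<bar>bdiff m (p L) n\<bar>) \<longlonglongrightarrow> \<bar>bdiff m c n\<bar>"
      by (intro tendsto_rabs bdiff_limit lim)
    show "\<exists>N. \<forall>L\<ge>N. \<bar>bdiff m (p L) n\<bar> \<le> \<delta>0 ^ m" using smooth_p by (simp add: smooth_def)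
  qed
  define \<gamma> where "\<gamma> = cos (a / real k)"
  have ak: "0 < a / real k" "a / real k \<le> 1" "a / real k < pi / 2"
  proof -
    show "0 < a / real k" using a k0 by simp
    have "a / real k \<le> 1 / 2" using a k by (intro frac_le) auto
    then show "a / real k \<le> 1" "a / real k < pi / 2" using pi_ge_two by linarith+
  qed
  have ap: "a / real k \<le> pi" using ak pi_ge_two by linarith
  have g: "0 < \<gamma>" "\<gamma> < 1"
    using ak cos_gt_zero_pi[of "a / real k"] cos_monotone_0_pi[OF order_refl ak(1) ap] by (auto simp: \<gamma>_def)
  define \<mu> where "\<mu> = - ln \<gamma>"
  have mu: "\<mu> > 0" using g by (simp add: \<mu>_def)
  \<comment> \<open>One factor suffices, that of index \<open>j + 1\<close> with
    \<open>k ^ j\<close> the largest power not exceeding the modulus of \<open>n\<close>. Its angle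
    lies between \<open>a / k\<close> and \<open>a\<close>, so its cosine is at most
    \<open>\<gamma>\<close>.\<close>
  have decay: "c n \<le> exp (- \<mu> * r ^ Suc l)" if n: "int k ^ l \<le> \<bar>n\<bar>" for n l
  proof -
    have "0 < int k ^ l" using k by simp
    then have "nat \<bar>n\<bar> > 0" using n by linarith
    then obtain j where j: "k ^ j \<le> nat \<bar>n\<bar>" "nat \<bar>n\<bar> < k ^ Suc j" using exists_power_interval k by blast
    have "l \<le> j"
    proof (rule ccontr)
      assume "\<not> l \<le> j"
      then have "k ^ Suc j \<le> k ^ l" using k by (intro power_increasing) auto
      then have "nat \<bar>n\<bar> < k ^ l" using j by linarith
      then have "int (nat \<bar>n\<bar>) < int (k ^ l)" by (simp only: of_nat_less_iff)
      then show False using n by simp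
    qed
    define x where "x = a / real k ^ Suc j * \<bar>of_int n\<bar>"
    have an: "real (nat \<bar>n\<bar>) = \<bar>of_int n\<bar>" by simp
    have "real (k ^ j) \<le> real (nat \<bar>n\<bar>)" using j(1) by (rule of_nat_mono)
    then have n1: "real k ^ j \<le> \<bar>of_int n\<bar>" unfolding an by simp
    have "real (nat \<bar>n\<bar>) \<le> real (k ^ Suc j)" using j(2) by (intro of_nat_mono) simp
    then have n2: "\<bar>of_int n\<bar> \<le> real k ^ Suc j" unfolding an by simp
    have "a / real k ^ Suc j * real k ^ j \<le> x" unfolding x_def using a n1 by (intro mult_left_mono) auto
    moreover have "a / real k ^ Suc j * real k ^ j = a / real k" using k0 by simp
    moreover have "x \<le> a / real k ^ Suc j * real k ^ Suc j" unfolding x_def using a n2 by (intro mult_left_mono) auto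
    moreover have "a / real k ^ Suc j * real k ^ Suc j = a" using k0 by simp
    ultimately have x: "a / real k \<le> x" "x \<le> 1" using a by linarith+
    have "cos (a / real k ^ Suc j * of_int n) = cos x"
      by (cases "n \<ge> 0") (auto simp: x_def)
    moreover have "cos x \<le> \<gamma>" unfolding \<gamma>_def using x ak pi_ge_two by (intro cos_monotone_0_pi_le) auto
    moreover have "0 \<le> cos x" using x ak pi_ge_two by (intro cos_ge_zero) auto
    ultimately have "b (Suc j) n \<le> \<gamma> ^ (2 * M (Suc j))" by (simp add: b_def power_mono del: power_Suc)
    also have "\<dots> = exp (- \<mu> * real (2 * M (Suc j)))"
      using g exp_of_nat_mult[of "2 * M (Suc j)" "ln \<gamma>"] by (simp add: \<mu>_def mult.commute)
    also have "\<dots> \<le> exp (- \<mu> * r ^ Suc l)"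
    proof -
      have "r ^ Suc l \<le> r ^ Suc j" using r \<open>l \<le> j\<close> by (intro power_increasing) auto
      also have "\<dots> \<le> real (2 * M (Suc j))" using M(1)[of "Suc j"] by linarith
      finally show ?thesis using mu by simp
    qed
    finally show ?thesis using cb[of n "Suc j"] by linarith
  qed
  \<comment> \<open>\<open>E * s\<close> replaces \<open>E\<close> because the weight to be beaten
    is that of the next exponent, \<open>E * s ^ Suc l\<close>: the index satisfies
    \<open>Suc i < k ^ Suc l\<close>.\<close>
  obtain K1 where K1: "K1 > 0" "\<And>l. exp ((E * s) * s ^ l) * real k ^ (2 * l) \<le> K1 * exp (\<mu> / 2 * r ^ l)"
    using double_exponential_domination[of s r "\<mu> / 2" "E * s" k] s r mu by auto
  obtain K2 where K2: "K2 > 0" "\<And>l. exp ((E * s) * s ^ l) * real k ^ (2 * l) \<le> K2 * exp (ln 2 / 2 * real k ^ l)"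
    using double_exponential_domination[of s "real k" "ln 2 / 2" "E * s" k] s by auto
  define K3 where "K3 = K1 * exp (\<mu> / 2) + K2"
  have K3: "K1 * exp (\<mu> / 2) \<le> K3" "K1 \<le> K3" "K2 \<le> K3" "K3 > 0"
  proof -
    have "K1 * 1 \<le> K1 * exp (\<mu> / 2)" using K1 mu by (intro mult_left_mono) auto
    then show "K1 * exp (\<mu> / 2) \<le> K3" "K1 \<le> K3" "K2 \<le> K3" "K3 > 0"
      using K1 K2 unfolding K3_def by linarith+
  qed
  define K where "K = real k ^ 2 * K3"
  have K: "K > 0" using K3 k0 by (simp add: K_def)
  have main: "\<exists>l. Suc i < k ^ l \<and> \<bar>bdiff m c n\<bar> * exp (E * s ^ l) \<le> K * \<delta> ^ m / real (Suc i) ^ 2"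
    if n: "n = int i \<or> n = - int i - 1" for m i n
  proof -
    obtain l where l: "k ^ l \<le> Suc i" "Suc i < k ^ Suc l" using exists_power_interval[of "Suc i" k] k by auto
    have il: "real (Suc i) \<le> real k ^ Suc l" using l(2) by (metis less_imp_le of_nat_le_iff of_nat_power)
    have "real (Suc i) ^ 2 \<le> (real k ^ Suc l) ^ 2" using il by (intro power_mono) auto
    also have "(real k ^ Suc l) ^ 2 = real k ^ 2 * real k ^ (2 * l)"
      by (simp add: power_mult_distrib power_mult mult.commute[of 2 l])
    finally have i2: "real (Suc i) ^ 2 \<le> real k ^ 2 * real k ^ (2 * l)" .
    define Z where "Z = exp ((E * s) * s ^ l) * real k ^ (2 * l)"
    have Z0: "Z \<ge> 0" by (simp add: Z_def)
    \<comment> \<open>For \<open>i < 2 * m\<close> the weight is at most a constant times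
      \<open>2 ^ m\<close>, so the bound \<open>\<delta>0 ^ m\<close> wins by itself. Otherwise the
      difference only involves values of \<open>c\<close> at distance at least \<open>i / 2\<close>
      from 0, which are small.\<close>
    have main: "\<bar>bdiff m c n\<bar> * Z \<le> K3 * \<delta> ^ m"
    proof (cases "i < 2 * m")
      case True
      have "real k ^ l \<le> real (Suc i)" using l(1) by (metis of_nat_le_iff of_nat_power)
      then have "real k ^ l \<le> 2 * real m" using True by linarith
      then have "ln 2 / 2 * real k ^ l \<le> ln 2 / 2 * (2 * real m)" by (intro mult_left_mono) auto
      then have "exp (ln 2 / 2 * real k ^ l) \<le> exp (real m * ln 2)" by (simp add: mult.commute)
      also have "\<dots> = 2 ^ m" by (simp add: exp_of_nat_mult)
      finally have "K2 * exp (ln 2 / 2 * real k ^ l) \<le> K2 * 2 ^ m" using K2 by simp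
      with K2(2)[of l] have 1: "Z \<le> K2 * 2 ^ m" unfolding Z_def by linarith
      have "\<bar>bdiff m c n\<bar> * Z \<le> \<delta>0 ^ m * (K2 * 2 ^ m)"
        using bd1 1 d0 Z0 by (intro mult_mono) auto
      also have "\<dots> = K2 * (2 * \<delta>0) ^ m" by (simp add: power_mult_distrib)
      also have "\<dots> \<le> K2 * \<delta> ^ m"
      proof (intro mult_left_mono power_mono)
        have "\<delta> ^ 2 \<le> \<delta>" using \<delta> by (simp add: power2_eq_square mult_left_le)
        then show "2 * \<delta>0 \<le> \<delta>" using \<delta> by (simp add: \<delta>0_def)
      qed (use d0 K2 in auto)
      also have "\<dots> \<le> K3 * \<delta> ^ m" using K3 \<delta> by (intro mult_right_mono) auto
      finally show ?thesis .
    next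
      case False
      define B where "B = (if l = 0 then 1 else exp (- \<mu> * r ^ l))"
      have B0: "B > 0" by (simp add: B_def)
      have cB: "\<bar>c (n - int j)\<bar> \<le> B" if j: "j \<le> m" for j
      proof (cases l)
        case 0
        then show ?thesis using c0 cb[of "n - int j" 0] b01[of 0 "n - int j"] by (simp add: B_def)
      next
        case (Suc l')
        \<comment> \<open>Halving the distance may drop one power of \<open>k\<close>, hence
          \<open>l'\<close>. Nothing is lost, since \<open>decay\<close> at \<open>l'\<close> has
          the exponent \<open>r ^ Suc l' = r ^ l\<close>.\<close>
        have "2 * k ^ l' \<le> k ^ l" using k by (simp add: Suc)
        then have "2 * k ^ l' \<le> Suc i" using l(1) by linarith
        then have "int i + 1 \<ge> 2 * int (k ^ l')" by linarith
        moreover have "int i \<le> 2 * \<bar>n - int j\<bar>" using n j False by auto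
        moreover have "2 * x \<le> y + 1 \<Longrightarrow> y \<le> 2 * z \<Longrightarrow> x \<le> z" for x y z :: int by presburger
        ultimately have "int (k ^ l') \<le> \<bar>n - int j\<bar>" by blast
        then have "c (n - int j) \<le> exp (- \<mu> * r ^ Suc l')" by (intro decay) simp
        then show ?thesis using c0 by (simp add: B_def Suc)
      qed
      have bd2: "\<bar>bdiff m c n\<bar> \<le> 2 ^ m * B" by (rule bdiff_bound_support) (rule cB)
      \<comment> \<open>The geometric mean of the smoothness bound and the decay bound. Half of the
        decay, \<open>sqrt B\<close>, still beats the weight because \<open>K1\<close> was taken for
        \<open>\<mu> / 2\<close>.\<close>
      have "\<bar>bdiff m c n\<bar> ^ 2 = \<bar>bdiff m c n\<bar> * \<bar>bdiff m c n\<bar>" by (simp add: power2_eq_square)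
      also have "\<dots> \<le> \<delta>0 ^ m * (2 ^ m * B)" using bd1 bd2 d0 by (intro mult_mono) auto
      also have "\<dots> = (2 * \<delta>0) ^ m * B" by (simp add: power_mult_distrib)
      also have "\<dots> \<le> (\<delta> ^ 2) ^ m * B"
        using B0 d0 \<delta> by (intro mult_right_mono power_mono) (auto simp: \<delta>0_def)
      also have "\<dots> = (\<delta> ^ m * sqrt B) ^ 2" using B0 by (simp add: power_mult_distrib flip: power_mult) (simp add: mult.commute)
      finally have bd3: "\<bar>bdiff m c n\<bar> \<le> \<delta> ^ m * sqrt B"
        by (rule power2_le_imp_le) (use \<delta> B0 in auto)
      have "sqrt B * exp (\<mu> / 2 * r ^ l) \<le> exp (\<mu> / 2)"
      proof (cases "l = 0")
        case False
        have "(exp (- \<mu> / 2 * r ^ l)) ^ 2 = B" using False by (simp add: B_def flip: exp_double)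
        then have "sqrt B = exp (- \<mu> / 2 * r ^ l)" by (intro real_sqrt_unique) auto
        then show ?thesis using mu by (simp flip: exp_add)
      qed (simp add: B_def)
      then have SB: "sqrt B * (K1 * exp (\<mu> / 2 * r ^ l)) \<le> K3"
        using K3(1) K1(1) by (metis (no_types, lifting) mult.left_commute mult_left_mono less_imp_le order_trans)
      have "\<bar>bdiff m c n\<bar> * Z \<le> (\<delta> ^ m * sqrt B) * (K1 * exp (\<mu> / 2 * r ^ l))"
        by (rule mult_mono[OF bd3 K1(2)[of l, folded Z_def]]) (use Z0 \<delta> B0 in auto)
      also have "\<dots> = \<delta> ^ m * (sqrt B * (K1 * exp (\<mu> / 2 * r ^ l)))" by simp
      also have "\<dots> \<le> \<delta> ^ m * K3" using SB \<delta> by (intro mult_left_mono) auto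
      finally show ?thesis by (simp add: mult.commute)
    qed
    have "\<bar>bdiff m c n\<bar> * exp (E * s ^ Suc l) * real (Suc i) ^ 2
        \<le> \<bar>bdiff m c n\<bar> * exp (E * s ^ Suc l) * (real k ^ 2 * real k ^ (2 * l))"
      using i2 by (intro mult_left_mono) auto
    also have "\<dots> = real k ^ 2 * (\<bar>bdiff m c n\<bar> * Z)" by (simp add: Z_def mult_ac)
    also have "\<dots> \<le> real k ^ 2 * (K3 * \<delta> ^ m)" using main by (intro mult_left_mono) auto
    finally have "\<bar>bdiff m c n\<bar> * exp (E * s ^ Suc l) * real (Suc i) ^ 2 \<le> K * \<delta> ^ m"
      by (simp add: K_def mult.assoc)
    then have "\<bar>bdiff m c n\<bar> * exp (E * s ^ Suc l) \<le> K * \<delta> ^ m / real (Suc i) ^ 2"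
      by (subst pos_le_divide_eq) auto
    then show ?thesis using l(2) by blast
  qed
  show thesis using that[OF K c0 c1 main] .
qed

section \<open>Elements localized near a point of the spectrum\<close>

context banach_cstar_pair
begin

text \<open>If \<open>Y \<equiv> 1 - \<kappa> + t\<close> modulo \<open>I\<close> had norm \<open>N Y < r\<close>, then \<open>(1 + t)^n g \<equiv> (Y + \<kappa>)^n g\<close> would be of size
  \<open>(r + \<rho>)^n\<close> modulo \<open>I\<close>.\<close>
lemma norm_lower_bound_mod_ideal:
  assumes I: "I \<subseteq> S" "0 \<in> I" "\<And>x y. x \<in> I \<Longrightarrow> y \<in> I \<Longrightarrow> x + y \<in> I"
      "\<And>a x. a \<in> S \<Longrightarrow> x \<in> I \<Longrightarrow> a * x \<in> I \<and> x * a \<in> I"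
    and closed: "\<And>f x. (\<And>n. f n \<in> I) \<Longrightarrow> x \<in> S \<Longrightarrow> tends f x \<Longrightarrow> x \<in> I"
    and \<kappa>: "\<kappa> \<in> S" and g: "g \<in> S" "g \<notin> I" and bound: "\<And>m. \<alpha> (\<kappa> ^ m * g) \<le> K * \<rho> ^ m"
    and \<rho>: "0 \<le> \<rho>" "\<rho> < 1" and t: "t \<ge> 0" and y: "y \<in> I"
  shows "(1 - \<rho>) + t \<le> N ((1 - \<kappa>) + R t + y)"
proof (rule ccontr)
  assume "\<not> ?thesis"
  then have less: "N ((1 - \<kappa>) + R t + y) < (1 - \<rho>) + t" by simp
  define Y where "Y = (1 - \<kappa>) + R t + y"
  have yS: "y \<in> S" using y I by blast
  have YS: "Y \<in> S" using \<kappa> yS by (simp add: Y_def)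
  have neg: "- x \<in> I" if "x \<in> I" for x using I(4)[of "- 1" x] that by simp
  define r where "r = (N Y + (1 - \<rho>) + t) / 2"
  have r: "N Y < r" "r < (1 - \<rho>) + t" using less by (simp_all add: r_def Y_def)
  have r0: "0 < r" using r N_nonneg'[OF YS] by linarith
  obtain K1 where K1: "K1 > 0" "\<And>n. \<alpha> (Y ^ n) \<le> K1 * r ^ n" using power_bound[OF YS r(1)] by blast
  have K0: "K \<ge> 0" using bound[of 0] \<alpha>_nonneg[OF g(1)] by simp
  \<comment> \<open>\<open>Y\<close> and \<open>\<kappa>\<close> may fail to commute. Each factor
    \<open>1 + t\<close> is inserted between \<open>Y ^ i\<close> and
    \<open>\<kappa> ^ m * g\<close>, where replacing it by \<open>Y + \<kappa> - y\<close> preserves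
    the ordered form and leaves an error in \<open>I\<close>.\<close>
  have "\<exists>z\<in>I. \<alpha> (R ((1 + t) ^ n) * (Y ^ i * \<kappa> ^ m * g) + z) \<le> K1 * K * r ^ i * \<rho> ^ m * (r + \<rho>) ^ n" for n i m
  proof (induction n arbitrary: i m)
    case 0
    have "\<alpha> (Y ^ i * \<kappa> ^ m * g) = \<alpha> (Y ^ i * (\<kappa> ^ m * g))" by (simp add: mult.assoc)
    also have "\<dots> \<le> \<alpha> (Y ^ i) * \<alpha> (\<kappa> ^ m * g)" using YS \<kappa> g by (intro \<alpha>_mult) auto
    also have "\<dots> \<le> (K1 * r ^ i) * (K * \<rho> ^ m)" using YS \<kappa> g K1 bound r0 by (intro mult_mono) auto
    finally have "\<alpha> (R ((1 + t) ^ 0) * (Y ^ i * \<kappa> ^ m * g) + 0) \<le> K1 * K * r ^ i * \<rho> ^ m * (r + \<rho>) ^ 0"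
      by (simp add: mult_ac)
    then show ?case using I(2) by blast
  next
    case (Suc n)
    obtain z1 where z1: "z1 \<in> I" "\<alpha> (R ((1 + t) ^ n) * (Y ^ Suc i * \<kappa> ^ m * g) + z1)
        \<le> K1 * K * r ^ Suc i * \<rho> ^ m * (r + \<rho>) ^ n" using Suc.IH[of "Suc i" m] by blast
    obtain z2 where z2: "z2 \<in> I" "\<alpha> (R ((1 + t) ^ n) * (Y ^ i * \<kappa> ^ Suc m * g) + z2)
        \<le> K1 * K * r ^ i * \<rho> ^ Suc m * (r + \<rho>) ^ n" using Suc.IH[of i "Suc m"] by blast
    define Q where "Q = R ((1 + t) ^ n)"
    define G where "G = \<kappa> ^ m * g"
    have GS: "G \<in> S" "Q \<in> S" "Y ^ i \<in> S" using \<kappa> g YS by (simp_all add: G_def Q_def)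
    define z3 where "z3 = Q * (Y ^ i * (y * G))"
    have z3: "z3 \<in> I" unfolding z3_def using I(4) y GS by blast
    have one: "R (1 + t) = Y + \<kappa> - y" by (simp add: Y_def R_add)
    have "R ((1 + t) ^ Suc n) * (Y ^ i * \<kappa> ^ m * g) = Q * (Y ^ i * (R (1 + t) * G))"
      by (simp add: Q_def G_def central[OF GS(3)] R_R mult.assoc) (simp add: mult.commute)
    also have "\<dots> = Q * (Y ^ Suc i * \<kappa> ^ m * g) + Q * (Y ^ i * \<kappa> ^ Suc m * g) - z3"
    proof -
      have a: "Y ^ i * (Y * G) = Y ^ Suc i * \<kappa> ^ m * g" by (simp only: G_def power_Suc2 mult.assoc)
      have b: "Y ^ i * (\<kappa> * G) = Y ^ i * \<kappa> ^ Suc m * g" by (simp only: G_def power_Suc mult.assoc)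
      show ?thesis unfolding one z3_def by (simp only: distrib_left distrib_right left_diff_distrib right_diff_distrib a b)
    qed
    finally have eq: "R ((1 + t) ^ Suc n) * (Y ^ i * \<kappa> ^ m * g) + (z1 + z2 + z3)
       = (Q * (Y ^ Suc i * \<kappa> ^ m * g) + z1) + (Q * (Y ^ i * \<kappa> ^ Suc m * g) + z2)"
      by (simp add: algebra_simps)
    have zS: "z1 \<in> S" "z2 \<in> S" using z1 z2 I by auto
    have "\<alpha> (R ((1 + t) ^ Suc n) * (Y ^ i * \<kappa> ^ m * g) + (z1 + z2 + z3))
      \<le> \<alpha> (Q * (Y ^ Suc i * \<kappa> ^ m * g) + z1) + \<alpha> (Q * (Y ^ i * \<kappa> ^ Suc m * g) + z2)"
      unfolding eq using zS YS \<kappa> g by (intro \<alpha>_triangle) (auto simp: Q_def)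
    also have "\<dots> \<le> K1 * K * r ^ Suc i * \<rho> ^ m * (r + \<rho>) ^ n + K1 * K * r ^ i * \<rho> ^ Suc m * (r + \<rho>) ^ n"
      using z1 z2 unfolding Q_def by linarith
    also have "\<dots> = K1 * K * r ^ i * \<rho> ^ m * (r + \<rho>) ^ Suc n" by (simp add: algebra_simps)
    finally show ?case using I(3) z1 z2 z3 by blast
  qed
  from this[of _ 0 0] have "\<exists>z\<in>I. \<alpha> (R ((1 + t) ^ n) * g + z) \<le> K1 * K * (r + \<rho>) ^ n" for n by simp
  then obtain z where z: "\<And>n. z n \<in> I" "\<And>n. \<alpha> (R ((1 + t) ^ n) * g + z n) \<le> K1 * K * (r + \<rho>) ^ n" by metis
  \<comment> \<open>These members of \<open>I\<close> approach \<open>g\<close>: dividing by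
    \<open>(1 + t) ^ n\<close> leaves a distance of order
    \<open>((r + \<rho>) / (1 + t)) ^ n\<close>, and \<open>r + \<rho> < 1 + t\<close>.\<close>
  define h where "h n = R (- 1 / (1 + t) ^ n) * z n" for n
  have hI: "h n \<in> I" for n unfolding h_def using I(4) z(1) by blast
  have "\<alpha> (h n - g) \<le> K1 * K * ((r + \<rho>) / (1 + t)) ^ n" for n
  proof -
    define q where "q = (1 + t) ^ n"
    have q: "q > 0" using t by (simp add: q_def)
    have zS: "z n \<in> S" using z(1) I by blast
    have "h n - g = R (- 1 / q) * (R q * g + z n)"
      using q by (simp add: h_def q_def[symmetric] distrib_left R_R R_minus)
    then have "\<alpha> (h n - g) \<le> \<bar>- 1 / q\<bar> * \<alpha> (R q * g + z n)"
      using \<alpha>_R_mult[of "R q * g + z n" "- 1 / q"] zS g by simp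
    also have "\<dots> \<le> 1 / q * (K1 * K * (r + \<rho>) ^ n)"
      using z(2)[of n] q by (intro mult_mono) (auto simp: q_def zS g \<open>z n \<in> S\<close>)
    finally show ?thesis by (simp add: q_def power_divide)
  qed
  moreover have "(\<lambda>n. K1 * K * ((r + \<rho>) / (1 + t)) ^ n) \<longlonglongrightarrow> K1 * K * 0"
    using r r0 \<rho> t by (intro tendsto_mult_left LIMSEQ_power_zero) auto
  moreover have "h n \<in> S" for n using hI I by blast
  moreover have "tends (\<lambda>n. h n - g) 0" if "\<And>n. h n - g \<in> S"
    using that calculation(1,2) by (intro tends_null) simp_all
  ultimately have "tends h g" using g by (simp add: tends_def)
  then show False using closed[of h g] hI g by blast
qed

text \<open>\<open>v\<close> is meant to be the inverse of \<open>w\<close>. The window of exponents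
  runs from \<open>- n\<close> to \<open>n - 1\<close>, with \<open>i\<close> paired with
  \<open>- i - 1\<close>.\<close>

definition laurent :: "'u \<Rightarrow> 'u \<Rightarrow> (int \<Rightarrow> real) \<Rightarrow> nat \<Rightarrow> 'u" where
  "laurent w v d n = (\<Sum>i<n. R (d (int i)) * w ^ i + R (d (- int i - 1)) * v ^ Suc i)"

lemma laurent_closed [simp]: "w \<in> S \<Longrightarrow> v \<in> S \<Longrightarrow> laurent w v d n \<in> S"
  unfolding laurent_def by (intro sum_closed) auto

text \<open>Summation by parts; the last bracket holds the boundary terms of the window.\<close>

lemma laurent_mult:
  assumes w: "w \<in> S" and v: "v \<in> S" and wv: "w * v = 1"
  shows "(w - 1) * laurent w v d n = laurent w v (\<lambda>i. d (i - 1) - d i) n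
     + (R (d (int n - 1)) * w ^ n - R (d (- int n - 1)) * v ^ n)"
proof (induction n)
  case (Suc n)
  let ?t = "R (d (int n)) * w ^ n + R (d (- int n - 1)) * v ^ Suc n"
  have "w * (w * x) = w ^ 2 * x" "w * (v * x) = x" for x
    using wv by (simp_all add: power2_eq_square mult.assoc[symmetric])
  then have "(w - 1) * ?t = R (d (int n)) * w ^ Suc n + R (d (- int n - 1)) * v ^ n - ?t"
    by (simp add: left_diff_distrib distrib_left central[OF w])
  moreover have "laurent w v d (Suc n) = laurent w v d n + ?t" by (simp add: laurent_def)
  moreover have "laurent w v (\<lambda>i. d (i - 1) - d i) (Suc n) = laurent w v (\<lambda>i. d (i - 1) - d i) n
      + ((R (d (int n - 1)) - R (d (int n))) * w ^ n + (R (d (- int n - 1 - 1)) - R (d (- int n - 1))) * v ^ Suc n)"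
    by (simp add: laurent_def R_diff)
  ultimately show ?case using Suc by (simp add: distrib_left left_diff_distrib)
qed (simp add: laurent_def)

lemma summable_inverse_squares: "summable (\<lambda>i. c / real (Suc i) ^ 2)"
proof -
  have "summable (\<lambda>n. inverse (real n ^ 2))" using inverse_power_summable[of 2, where 'a = real] by simp
  then have "summable (\<lambda>n. inverse (real (Suc n) ^ 2))" by (subst summable_Suc_iff)
  then show ?thesis using summable_mult[of _ c] by (simp add: divide_inverse)
qed


lemma tends_bound:
  assumes "tends f x" "\<And>n. f n \<in> S" "x \<in> S" "\<And>n. n \<ge> n0 \<Longrightarrow> \<alpha> (f n - y) \<le> B" "y \<in> S"
  shows "\<alpha> (x - y) \<le> B"
proof -
  have "(\<lambda>n. B + \<alpha> (f n - x)) \<longlonglongrightarrow> B + 0"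
    using assms(1) by (intro tendsto_add tendsto_const) (simp add: tends_def)
  moreover have "\<alpha> (x - y) \<le> B + \<alpha> (f n - x)" if "n \<ge> n0" for n
    using \<alpha>_diff[of "f n - y" "f n - x"] assms(2,3,5) assms(4)[OF that] by simp
  ultimately have "\<alpha> (x - y) \<le> B + 0" by (intro LIMSEQ_le_const) auto
  then show ?thesis by simp
qed

lemma sum_shifted_le_suminf:
  fixes z :: "nat \<Rightarrow> real"
  assumes "summable z" "\<And>i. 0 \<le> z i" "m \<le> n"
  shows "sum z {m..<n} \<le> suminf z - sum z {..<m}"
proof -
  have "sum z {..<m} + sum z {m..<n} = sum z {..<n}"
    using assms(3) by (metis lessThan_atLeast0 sum.atLeastLessThan_concat zero_le)
  moreover have "sum z {..<n} \<le> suminf z" using assms by (intro sum_le_suminf) auto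
  ultimately show ?thesis by linarith
qed

text \<open>\<open>f\<close> is the Laurent series of \<open>w\<close> with the coefficients from
  \<open>localized_coefficients\<close>. Multiplying by \<open>(w - 1) ^ m\<close> differences the
  coefficients, which gains \<open>\<delta> ^ m\<close>. If \<open>w * b\<close> is close to
  \<open>b\<close>, so are the products of \<open>b\<close> with the powers of \<open>w\<close> that
  matter, and \<open>f * b\<close> is close to \<open>C\<close> times \<open>b\<close>, with
  \<open>C\<close> the sum of the coefficients. \<open>C\<close> and \<open>K\<close> are fixed
  before \<open>b\<close> and \<open>\<epsilon>\<close>; only \<open>\<eta>\<close> depends on
  these.\<close>

theorem localized_elements:
  assumes M: "M \<ge> 1" and \<delta>: "0 < \<delta>" "\<delta> \<le> 1"
  obtains C K :: real where "C \<noteq> 0"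
    "\<And>b \<epsilon>. b \<in> S \<Longrightarrow> \<epsilon> > 0 \<Longrightarrow> \<exists>\<eta>>0. \<forall>w\<in>S. \<forall>v\<in>S. w * v = 1 \<longrightarrow> v * w = 1 \<longrightarrow> N w \<le> 1 \<longrightarrow> N v \<le> 1 \<longrightarrow>
       \<alpha> w \<le> M \<longrightarrow> \<alpha> v \<le> M \<longrightarrow> \<alpha> (w * b - b) \<le> \<eta> \<longrightarrow>
       (\<exists>f\<in>S. (\<forall>m. \<alpha> ((w - 1) ^ m * f) \<le> K * \<delta> ^ m) \<and> \<alpha> (f * b - R C * b) < \<epsilon>)"
proof -
  obtain E where E: "E \<ge> 0" "\<And>x n l. x \<in> S \<Longrightarrow> N x \<le> 1 \<Longrightarrow> \<alpha> x \<le> M \<Longrightarrow> n < k ^ l \<Longrightarrow> \<alpha> (x ^ n) \<le> exp (E * s ^ l)"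
    using growth_bound[of M] M by auto
  obtain c :: "int \<Rightarrow> real" and K0 where K0: "K0 > 0" and c: "\<And>n. 0 \<le> c n" "c 0 = 1"
    and cb: "\<And>m i n. n = int i \<or> n = - int i - 1 \<Longrightarrow>
       \<exists>l. Suc i < k ^ l \<and> \<bar>bdiff m c n\<bar> * exp (E * s ^ l) \<le> K0 * \<delta> ^ m / real (Suc i) ^ 2"
    using localized_coefficients[OF k2 s1 sk E(1) \<delta>] by metis
  define z where "z i = 2 * K0 / real (Suc i) ^ 2" for i
  have z: "summable z" "\<And>i. 0 \<le> z i"
    unfolding z_def[abs_def] using summable_inverse_squares[of "2 * K0"] K0 by auto
  define K where "K = suminf z"
  \<comment> \<open>\<open>j \<le> Suc i\<close> covers \<open>w ^ i\<close>,
    \<open>v ^ Suc i\<close> and the boundary terms. Half of \<open>z i\<close> is spent on each of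
    the two coefficients with index \<open>i\<close>.\<close>
  have termb: "\<bar>bdiff m c n\<bar> * \<alpha> (x ^ j) \<le> \<delta> ^ m * (z i / 2)"
    if x: "x \<in> S" "N x \<le> 1" "\<alpha> x \<le> M" and n: "n = int i \<or> n = - int i - 1" and j: "j \<le> Suc i" for m n i j x
  proof -
    obtain l where l: "Suc i < k ^ l" "\<bar>bdiff m c n\<bar> * exp (E * s ^ l) \<le> K0 * \<delta> ^ m / real (Suc i) ^ 2"
      using cb[OF n] by blast
    have "\<alpha> (x ^ j) \<le> exp (E * s ^ l)" using x j l(1) by (intro E(2)) auto
    then have "\<bar>bdiff m c n\<bar> * \<alpha> (x ^ j) \<le> \<bar>bdiff m c n\<bar> * exp (E * s ^ l)" by (intro mult_left_mono) auto
    also note l(2)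
    also have "K0 * \<delta> ^ m / real (Suc i) ^ 2 = \<delta> ^ m * (z i / 2)" by (simp add: z_def)
    finally show ?thesis .
  qed
  define ct where "ct i = c (int i) + c (- int i - 1)" for i
  have ct: "0 \<le> ct i" "ct i \<le> z i" for i
  proof -
    show "0 \<le> ct i" using c by (simp add: ct_def)
    have "\<bar>bdiff 0 c n\<bar> * \<alpha> (1 ^ 0) \<le> \<delta> ^ 0 * (z i / 2)" if "n = int i \<or> n = - int i - 1" for n
      using that M by (intro termb) (auto simp: N_iota'[of 1, simplified])
    from this[of "int i"] this[of "- int i - 1"] show "ct i \<le> z i" using c by (simp add: ct_def)
  qed
  have cts: "summable ct" using ct z(1) by (intro summable_comparison_test'[of z 0 ct]) auto
  define C where "C = suminf ct"
  have "ct 0 \<le> C" unfolding C_def using sum_le_suminf[OF cts, of "{0}"] ct by auto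
  moreover have "ct 0 \<ge> 1" using c by (simp add: ct_def)
  ultimately have C: "C \<noteq> 0" by linarith
  show thesis
  proof (rule that[OF C, of K])
    fix b \<epsilon> assume b: "b \<in> S" and \<epsilon>: "(\<epsilon> :: real) > 0"
    have quarter: "x / (4 * y) * y = x / 4" if "y \<noteq> 0" for x y :: real using that by simp
    define \<epsilon>1 where "\<epsilon>1 = \<epsilon> / (4 * (\<alpha> b + 1))"
    have ab: "\<alpha> b \<ge> 0" using b by simp
    have e1: "\<epsilon>1 > 0" using \<epsilon> ab by (simp add: \<epsilon>1_def)
    have e1b: "\<epsilon>1 * \<alpha> b \<le> \<epsilon> / 4"
    proof -
      have "\<epsilon>1 * \<alpha> b \<le> \<epsilon>1 * (\<alpha> b + 1)" using e1 by (intro mult_left_mono) auto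
      also have "\<dots> = \<epsilon> / 4" unfolding \<epsilon>1_def using ab by (intro quarter) simp
      finally show ?thesis .
    qed
    have "(\<lambda>n. sum z {..<n}) \<longlonglongrightarrow> suminf z" by (rule summable_LIMSEQ[OF z(1)])
    then have "eventually (\<lambda>n. suminf z - \<epsilon>1 < sum z {..<n}) sequentially"
      using e1 by (intro order_tendstoD) auto
    then obtain n0 where n0: "suminf z - sum z {..<n0} < \<epsilon>1" by (auto simp: eventually_sequentially algebra_simps)
    \<comment> \<open>Below the cut-off \<open>n0\<close>, the norm of \<open>x ^ j * b - b\<close>
      is at most \<open>j * M ^ j\<close> times that of \<open>x * b - b\<close>, and passing from
      \<open>w\<close> to \<open>v\<close> costs one more factor \<open>M\<close>. The choice of
      \<open>\<eta>\<close> then keeps this part below \<open>\<epsilon> / 4\<close>, like the two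
      tails.\<close>
    define D where "D = (\<Sum>i<n0. ct i * (real (Suc i) * M ^ Suc i))"
    have D0: "D \<ge> 0" unfolding D_def using ct M by (intro sum_nonneg) auto
    define \<eta> where "\<eta> = \<epsilon> / (4 * (D + 1)) / M"
    have eta: "\<eta> > 0" using \<epsilon> D0 M by (simp add: \<eta>_def)
    have "\<exists>f\<in>S. (\<forall>m. \<alpha> ((w - 1) ^ m * f) \<le> K * \<delta> ^ m) \<and> \<alpha> (f * b - R C * b) < \<epsilon>"
      if w: "w \<in> S" "v \<in> S" "w * v = 1" "v * w = 1" "N w \<le> 1" "N v \<le> 1" "\<alpha> w \<le> M" "\<alpha> v \<le> M"
        and wb: "\<alpha> (w * b - b) \<le> \<eta>" for w v
    proof -
      define T where "T m i = R (bdiff m c (int i)) * w ^ i + R (bdiff m c (- int i - 1)) * v ^ Suc i" for m i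
      have TS: "T m i \<in> S" for m i using w by (simp add: T_def)
      have Tb: "\<alpha> (T m i) \<le> \<delta> ^ m * z i" for m i
      proof -
        have "\<alpha> (T m i) \<le> \<alpha> (R (bdiff m c (int i)) * w ^ i) + \<alpha> (R (bdiff m c (- int i - 1)) * v ^ Suc i)"
          unfolding T_def using w by (intro \<alpha>_triangle) auto
        also have "\<dots> \<le> \<bar>bdiff m c (int i)\<bar> * \<alpha> (w ^ i) + \<bar>bdiff m c (- int i - 1)\<bar> * \<alpha> (v ^ Suc i)"
          using w by (intro add_mono \<alpha>_R_mult power_closed)
        also have "\<dots> \<le> \<delta> ^ m * (z i / 2) + \<delta> ^ m * (z i / 2)"
          using w by (intro add_mono termb) auto
        also have "\<dots> = \<delta> ^ m * z i" by simp
        finally show ?thesis .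
      qed
      have L: "laurent w v (bdiff m c) n = (\<Sum>i<n. T m i)" for m n by (simp add: laurent_def T_def)
      have "\<exists>f\<in>S. tends (\<lambda>n. \<Sum>i<n. T m i) f" for m
        using series_converges[of "T m" "\<lambda>i. \<delta> ^ m * z i", OF TS Tb summable_mult[OF z(1)]] by blast
      then obtain f where f: "\<And>m. f m \<in> S" "\<And>m. tends (\<lambda>n. \<Sum>i<n. T m i) (f m)" by metis
      have SS: "(\<Sum>i<n. T m i) \<in> S" for m n using TS by (intro sum_closed)
      \<comment> \<open>The series \<open>f m\<close> are summed separately for each
        \<open>m\<close>; multiplication by \<open>w - 1\<close> links them, since the boundary
        terms vanish in the limit.\<close>
      have step: "(w - 1) * f m = f (Suc m)" for m
      proof -
        have bd: "tends (\<lambda>n. R (bdiff m c (int n - 1)) * w ^ n - R (bdiff m c (- int n - 1)) * v ^ n) 0"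
        proof (rule tends_null)
          fix n
          show "R (bdiff m c (int n - 1)) * w ^ n - R (bdiff m c (- int n - 1)) * v ^ n \<in> S" using w by simp
          have 1: "\<bar>bdiff m c (int n - 1)\<bar> * \<alpha> (w ^ n) \<le> \<delta> ^ m * (z (n - 1) / 2)"
          proof (cases n)
            case 0
            have "\<bar>bdiff m c (int n - 1)\<bar> * \<alpha> (w ^ n) \<le> \<delta> ^ m * (z 0 / 2)" using w 0 by (intro termb) auto
            then show ?thesis using 0 by simp
          next
            case (Suc n')
            have "\<bar>bdiff m c (int n - 1)\<bar> * \<alpha> (w ^ n) \<le> \<delta> ^ m * (z n' / 2)" using w Suc by (intro termb) auto
            then show ?thesis using Suc by simp
          qed
          have 2: "\<bar>bdiff m c (- int n - 1)\<bar> * \<alpha> (v ^ n) \<le> \<delta> ^ m * (z n / 2)" using w by (intro termb) auto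
          have "\<alpha> (R (bdiff m c (int n - 1)) * w ^ n - R (bdiff m c (- int n - 1)) * v ^ n)
             \<le> \<alpha> (R (bdiff m c (int n - 1)) * w ^ n) + \<alpha> (R (bdiff m c (- int n - 1)) * v ^ n)"
            using w by (intro \<alpha>_diff) auto
          also have "\<dots> \<le> \<bar>bdiff m c (int n - 1)\<bar> * \<alpha> (w ^ n) + \<bar>bdiff m c (- int n - 1)\<bar> * \<alpha> (v ^ n)"
            using w by (intro add_mono \<alpha>_R_mult power_closed)
          finally show "\<alpha> (R (bdiff m c (int n - 1)) * w ^ n - R (bdiff m c (- int n - 1)) * v ^ n)
             \<le> \<delta> ^ m * (z (n - 1) / 2) + \<delta> ^ m * (z n / 2)" using 1 2 by linarith
        next
          have z0: "z \<longlonglongrightarrow> 0" by (rule summable_LIMSEQ_zero[OF z(1)])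
          have "(\<lambda>n. z (Suc n - 1)) \<longlonglongrightarrow> 0" using z0 by simp
          then have "(\<lambda>n. z (n - 1)) \<longlonglongrightarrow> 0" by (rule LIMSEQ_imp_Suc)
          then have "(\<lambda>n. \<delta> ^ m * (z (n - 1) / 2) + \<delta> ^ m * (z n / 2)) \<longlonglongrightarrow> \<delta> ^ m * (0 / 2) + \<delta> ^ m * (0 / 2)"
            using z0 by (intro tendsto_add tendsto_mult_left tendsto_divide tendsto_const) auto
          then show "(\<lambda>n. \<delta> ^ m * (z (n - 1) / 2) + \<delta> ^ m * (z n / 2)) \<longlonglongrightarrow> 0" by simp
        qed
        have "laurent w v (\<lambda>i. bdiff m c (i - 1) - bdiff m c i) n = laurent w v (bdiff (Suc m) c) n" for n
          unfolding laurent_def by (simp only: bdiff_Suc)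
        then have eq: "(w - 1) * (\<Sum>i<n. T m i) = (\<Sum>i<n. T (Suc m) i)
           + (R (bdiff m c (int n - 1)) * w ^ n - R (bdiff m c (- int n - 1)) * v ^ n)" for n
          using laurent_mult[OF w(1,2,3), of "bdiff m c" n] unfolding L by simp
        have "tends (\<lambda>n. (w - 1) * (\<Sum>i<n. T m i)) (f (Suc m) + 0)"
          unfolding eq using w by (intro tends_add f bd SS) auto
        moreover have "tends (\<lambda>n. (w - 1) * (\<Sum>i<n. T m i)) ((w - 1) * f m)"
          using w by (intro tends_mult_left f SS) auto
        moreover have "(w - 1) * (\<Sum>i<n. T m i) \<in> S" for n using SS w by simp
        moreover have "f (Suc m) + 0 \<in> S" "(w - 1) * f m \<in> S" using f(1) w by auto
        ultimately have "f (Suc m) + 0 = (w - 1) * f m" by (rule tends_unique)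
        then show ?thesis by simp
      qed
      have pw: "(w - 1) ^ m * f 0 = f m" for m
      proof (induction m)
        case (Suc m)
        then show ?case using step[of m] by (simp add: mult.assoc)
      qed simp
      have partial: "\<alpha> (\<Sum>i\<in>B. T m i) \<le> \<delta> ^ m * sum z B" for m B
      proof -
        have "\<alpha> (\<Sum>i\<in>B. T m i) \<le> (\<Sum>i\<in>B. \<alpha> (T m i))" using TS by (intro \<alpha>_sum)
        also have "\<dots> \<le> (\<Sum>i\<in>B. \<delta> ^ m * z i)" using Tb by (intro sum_mono)
        finally show ?thesis by (simp add: sum_distrib_left)
      qed
      have fK: "\<alpha> (f m) \<le> K * \<delta> ^ m" for m
      proof -
        have "\<alpha> ((\<Sum>i<n. T m i) - 0) \<le> K * \<delta> ^ m" for n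
        proof -
          have "sum z {..<n} \<le> K" unfolding K_def using z by (intro sum_le_suminf) auto
          then have "\<delta> ^ m * sum z {..<n} \<le> \<delta> ^ m * K" using \<delta> by (intro mult_left_mono) auto
          then show ?thesis using partial[of m "{..<n}"] by (simp add: mult.commute)
        qed
        then have "\<alpha> (f m - 0) \<le> K * \<delta> ^ m" using tends_bound[OF f(2) SS f(1)] by blast
        then show ?thesis by simp
      qed
      have "\<alpha> (f 0 * b - R C * b) < \<epsilon>"
      proof -
        define F where "F = (\<Sum>i<n0. T 0 i)"
        define C0 where "C0 = (\<Sum>i<n0. ct i)"
        have FS: "F \<in> S" using SS by (simp add: F_def)
        have tail: "\<alpha> (f 0 - F) \<le> \<epsilon>1"
        proof (rule tends_bound[OF f(2) SS f(1) _ FS])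
          fix n assume n: "n \<ge> n0"
          have "(\<Sum>i<n. T 0 i) - F = (\<Sum>i\<in>{n0..<n}. T 0 i)"
            unfolding F_def using n by (metis sum_diff_nat_ivl lessThan_atLeast0 zero_le)
          then have "\<alpha> ((\<Sum>i<n. T 0 i) - F) \<le> sum z {n0..<n}" using partial[of 0 "{n0..<n}"] by simp
          also have "\<dots> \<le> suminf z - sum z {..<n0}" using z n by (intro sum_shifted_le_suminf)
          finally show "\<alpha> ((\<Sum>i<n. T 0 i) - F) \<le> \<epsilon>1" using n0 by linarith
        qed
        have ctail: "\<bar>C0 - C\<bar> \<le> \<epsilon>1"
        proof -
          have "sum ct {n0..<n} \<le> \<epsilon>1" for n
          proof (cases "n0 \<le> n")
            case True
            have "sum ct {n0..<n} \<le> sum z {n0..<n}" using ct by (intro sum_mono)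
            also have "\<dots> \<le> suminf z - sum z {..<n0}" using z True by (intro sum_shifted_le_suminf)
            finally show ?thesis using n0 by linarith
          qed (use e1 in simp)
          then have "sum ct {..<n} \<le> C0 + \<epsilon>1" for n
          proof (cases "n0 \<le> n")
            case True
            then have "sum ct {..<n} = C0 + sum ct {n0..<n}"
              unfolding C0_def by (metis lessThan_atLeast0 sum.atLeastLessThan_concat zero_le)
            then show ?thesis using \<open>\<And>n. sum ct {n0..<n} \<le> \<epsilon>1\<close>[of n] by linarith
          next
            case False
            then have "sum ct {..<n} \<le> C0" unfolding C0_def using ct by (intro sum_mono2) auto
            then show ?thesis using e1 by linarith
          qed
          then have "C \<le> C0 + \<epsilon>1" unfolding C_def by (intro suminf_le_const cts)
          moreover have "C0 \<le> C" unfolding C_def C0_def using ct cts by (intro sum_le_suminf) auto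
          ultimately show ?thesis by linarith
        qed
        have pb: "\<alpha> (x ^ i * b - b) \<le> real i * M ^ i * \<alpha> (x * b - b)" if x: "x \<in> S" "\<alpha> x \<le> M" for x i
        proof (induction i)
          case (Suc i)
          have eq: "x ^ Suc i * b - b = x ^ i * (x * b - b) + (x ^ i * b - b)"
            by (simp only: power_Suc2) (simp add: right_diff_distrib mult.assoc)
          have "\<alpha> (x ^ Suc i * b - b) \<le> \<alpha> (x ^ i * (x * b - b)) + \<alpha> (x ^ i * b - b)"
            unfolding eq using x b by (intro \<alpha>_triangle) auto
          also have "\<alpha> (x ^ i * (x * b - b)) \<le> \<alpha> (x ^ i) * \<alpha> (x * b - b)" using x b by (intro \<alpha>_mult) auto
          also have "\<dots> \<le> M ^ Suc i * \<alpha> (x * b - b)"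
          proof (rule mult_right_mono)
            have "\<alpha> (x ^ i) \<le> \<alpha> x ^ i" by (rule \<alpha>_power[OF x(1)])
            also have "\<dots> \<le> M ^ i" using x by (intro power_mono) auto
            also have "\<dots> \<le> M ^ Suc i" using M by (intro power_increasing) auto
            finally show "\<alpha> (x ^ i) \<le> M ^ Suc i" .
          qed (use x b in auto)
          also note Suc
          also have "real i * M ^ i * \<alpha> (x * b - b) \<le> real i * M ^ Suc i * \<alpha> (x * b - b)"
            using M x b by (intro mult_right_mono mult_left_mono power_increasing) auto
          finally show ?case by (simp add: algebra_simps)
        qed simp
        have vb: "\<alpha> (v * b - b) \<le> M * \<eta>"
        proof -
          have "v * b - b = v * (b - w * b)" using w(4) by (simp add: right_diff_distrib mult.assoc[symmetric])
          then have "\<alpha> (v * b - b) \<le> \<alpha> v * \<alpha> (b - w * b)" using \<alpha>_mult[of v "b - w * b"] w b by simp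
          also have "\<dots> = \<alpha> v * \<alpha> (w * b - b)" using \<alpha>_diff_commute[of b "w * b"] w b by simp
          also have "\<dots> \<le> M * \<eta>" using w wb b M by (intro mult_mono) auto
          finally show ?thesis .
        qed
        have "\<alpha> (F * b - R C0 * b) \<le> (\<Sum>i<n0. ct i * (real (Suc i) * M ^ Suc i) * (M * \<eta>))"
        proof -
          have "F * b - R C0 * b = (\<Sum>i<n0. T 0 i * b - R (ct i) * b)"
            by (simp add: F_def C0_def R_sum sum_distrib_right sum_subtractf)
          also have "\<alpha> \<dots> \<le> (\<Sum>i<n0. \<alpha> (T 0 i * b - R (ct i) * b))"
            using TS b by (intro \<alpha>_sum) auto
          also have "\<dots> \<le> (\<Sum>i<n0. ct i * (real (Suc i) * M ^ Suc i) * (M * \<eta>))"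
          proof (rule sum_mono)
            fix i
            let ?B = "real (Suc i) * M ^ Suc i * (M * \<eta>)"
            have eq: "T 0 i * b - R (ct i) * b = R (c (int i)) * (w ^ i * b - b) + R (c (- int i - 1)) * (v ^ Suc i * b - b)"
              by (simp add: T_def ct_def R_add algebra_simps)
            have 1: "\<alpha> (w ^ i * b - b) \<le> ?B"
            proof -
              have "\<alpha> (w ^ i * b - b) \<le> real i * M ^ i * \<alpha> (w * b - b)" using pb w by blast
              also have "\<dots> \<le> real (Suc i) * M ^ Suc i * (M * \<eta>)"
              proof (intro mult_mono power_increasing)
                have "1 * \<eta> \<le> M * \<eta>" using M eta by (intro mult_right_mono) auto
                then show "\<alpha> (w * b - b) \<le> M * \<eta>" using wb by linarith
              qed (use M w b in auto)
              finally show ?thesis .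
            qed
            have 2: "\<alpha> (v ^ Suc i * b - b) \<le> ?B"
            proof -
              have "\<alpha> (v ^ Suc i * b - b) \<le> real (Suc i) * M ^ Suc i * \<alpha> (v * b - b)" using pb w by blast
              also have "\<dots> \<le> ?B" using vb M by (intro mult_left_mono) auto
              finally show ?thesis .
            qed
            have "\<alpha> (T 0 i * b - R (ct i) * b) \<le> \<alpha> (R (c (int i)) * (w ^ i * b - b)) + \<alpha> (R (c (- int i - 1)) * (v ^ Suc i * b - b))"
              unfolding eq using w b by (intro \<alpha>_triangle) auto
            also have "\<dots> \<le> \<bar>c (int i)\<bar> * \<alpha> (w ^ i * b - b) + \<bar>c (- int i - 1)\<bar> * \<alpha> (v ^ Suc i * b - b)"
              using w b by (intro add_mono \<alpha>_R_mult) auto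
            also have "\<dots> \<le> c (int i) * ?B + c (- int i - 1) * ?B"
              using 1 2 c by (intro add_mono) (auto intro: mult_left_mono)
            also have "\<dots> = ct i * (real (Suc i) * M ^ Suc i) * (M * \<eta>)" by (simp add: ct_def algebra_simps)
            finally show "\<alpha> (T 0 i * b - R (ct i) * b) \<le> ct i * (real (Suc i) * M ^ Suc i) * (M * \<eta>)" .
          qed
          finally show ?thesis .
        qed
        also have "\<dots> = D * (M * \<eta>)" by (simp add: D_def sum_distrib_right)
        finally have mid: "\<alpha> (F * b - R C0 * b) \<le> D * (M * \<eta>)" .
        have "M * \<eta> = \<epsilon> / (4 * (D + 1))" using M by (simp add: \<eta>_def)
        moreover have "D * (\<epsilon> / (4 * (D + 1))) \<le> \<epsilon> / 4"
        proof -
          have "D * (\<epsilon> / (4 * (D + 1))) \<le> (D + 1) * (\<epsilon> / (4 * (D + 1)))"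
            using \<epsilon> D0 by (intro mult_right_mono) auto
          also have "\<dots> = \<epsilon> / 4" using quarter[of "D + 1" \<epsilon>] D0 by (simp only: mult.commute)
          finally show ?thesis .
        qed
        ultimately have mid': "\<alpha> (F * b - R C0 * b) \<le> \<epsilon> / 4" using mid by (metis order_trans)
        have eq: "f 0 * b - R C * b = (f 0 - F) * b + ((F * b - R C0 * b) + R (C0 - C) * b)"
          by (simp add: left_diff_distrib R_diff)
        have "\<alpha> (f 0 * b - R C * b) \<le> \<alpha> ((f 0 - F) * b) + (\<alpha> (F * b - R C0 * b) + \<alpha> (R (C0 - C) * b))"
          unfolding eq using f(1) FS b
          by (intro order_trans[OF \<alpha>_triangle add_left_mono[OF \<alpha>_triangle]]) auto
        moreover have "\<alpha> ((f 0 - F) * b) \<le> \<epsilon> / 4"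
        proof -
          have "\<alpha> ((f 0 - F) * b) \<le> \<alpha> (f 0 - F) * \<alpha> b" using f(1) FS b by (intro \<alpha>_mult) auto
          also have "\<dots> \<le> \<epsilon>1 * \<alpha> b" using tail ab by (intro mult_right_mono)
          finally show ?thesis using e1b by linarith
        qed
        moreover have "\<alpha> (R (C0 - C) * b) \<le> \<epsilon> / 4"
        proof -
          have "\<alpha> (R (C0 - C) * b) \<le> \<bar>C0 - C\<bar> * \<alpha> b" using b by (intro \<alpha>_R_mult)
          also have "\<dots> \<le> \<epsilon>1 * \<alpha> b" using ctail ab by (intro mult_right_mono)
          finally show ?thesis using e1b by linarith
        qed
        ultimately show ?thesis using mid' \<epsilon> by linarith
      qed
      moreover have "\<forall>m. \<alpha> ((w - 1) ^ m * f 0) \<le> K * \<delta> ^ m" unfolding pw using fK by blast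
      ultimately show ?thesis using f(1) by blast
    qed
    then show "\<exists>\<eta>>0. \<forall>w\<in>S. \<forall>v\<in>S. w * v = 1 \<longrightarrow> v * w = 1 \<longrightarrow> N w \<le> 1 \<longrightarrow> N v \<le> 1 \<longrightarrow>
       \<alpha> w \<le> M \<longrightarrow> \<alpha> v \<le> M \<longrightarrow> \<alpha> (w * b - b) \<le> \<eta> \<longrightarrow>
       (\<exists>f\<in>S. (\<forall>m. \<alpha> ((w - 1) ^ m * f) \<le> K * \<delta> ^ m) \<and> \<alpha> (f * b - R C * b) < \<epsilon>)"
      using eta by blast
  qed
qed

end

section \<open>The Cayley transform and the separating element\<close>

context banach_cstar_pair
begin

text \<open>\<open>1 + x\<close> is inverted by \<open>1 - x\<close> times the inverse of
  \<open>1 - x * x\<close>, and the latter is \<open>1 + h * h \<ge> 1\<close> with \<open>h\<close>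
  self-adjoint. The scale \<open>\<tau>\<close> gives \<open>\<alpha> x \<le> 1 / 2\<close>, so that
  \<open>q = 1 - x * q\<close> yields \<open>\<alpha> q \<le> 2\<close>, whatever the member
  \<open>e\<close> of norm at most \<open>M\<close>.\<close>

lemma cayley_transform:
  assumes e: "sa e" "\<alpha> e \<le> M" and M: "M \<ge> 0"
  defines "\<tau> \<equiv> 1 / (2 * (M + 1))"
  defines "x \<equiv> \<iota> (\<i> * of_real \<tau>) * e"
  obtains q u where "q \<in> S" "u \<in> S" "(1 + x) * q = 1" "q * (1 + x) = 1" "u = (1 - x) * q" "\<alpha> q \<le> 2"
    "star u * u = 1" "u * star u = 1" "\<alpha> u \<le> 3" "\<alpha> (star u) \<le> 3"
proof -
  have eS: "e \<in> S" "star e = e" using e by (auto simp: sa_def)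
  have xS: "x \<in> S" using eS by (simp add: x_def)
  have \<tau>: "\<tau> > 0" using M by (simp add: \<tau>_def)
  have sx: "star x = - x"
    using eS iota_minus[of "\<i> * of_real \<tau>"] by (simp add: x_def central[OF eS(1)])
  have ax: "\<alpha> x \<le> 1 / 2"
  proof -
    have "\<alpha> x \<le> cmod (\<i> * of_real \<tau>) * \<alpha> e" unfolding x_def by (rule \<alpha>_iota_mult[OF eS(1)])
    also have "\<dots> \<le> \<tau> * M" using e \<tau> by (simp add: norm_mult)
    also have "\<dots> \<le> \<tau> * (M + 1)" using \<tau> by simp
    also have "\<dots> = 1 / 2" using M by (simp add: \<tau>_def)
    finally show ?thesis .
  qed
  define h where "h = R \<tau> * e"
  have h: "sa h" using e by (auto simp: h_def)
  have "x = \<iota> \<i> * h" by (simp add: x_def h_def R_def iota_mult mult.assoc)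
  then have "x * x = - (h * h)"
    using central[OF sa_closed[OF h]] by (simp add: mult.assoc iota_simps iota_minus)
  then have hx: "1 - x * x = 1 + h * h" by simp
  define w where "w = 1 - x * x"
  have w: "sa w" "pos (w - R 1)" using h by (auto simp: w_def hx)
  have wS: "w \<in> S" using w sa_closed by blast
  obtain r where r: "r \<in> S" "r * w = 1" "w * r = 1" using pos_inverse[OF w(1) _ w(2)] by auto
  have xw: "x * w = w * x" by (simp add: w_def algebra_simps)
  have rx: "r * x = x * r"
  proof -
    have "r * x = r * (x * w) * r" using r by (simp add: mult.assoc)
    also have "\<dots> = (r * w) * x * r" by (simp only: xw mult.assoc)
    finally show ?thesis using r by simp
  qed
  have rx': "r * (x * y) = x * (r * y)" for y using rx by (simp add: mult.assoc[symmetric])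
  have sr: "star r = r" using sa_inverse[OF w(1) r] by (simp add: sa_def)
  define q where "q = (1 - x) * r"
  define p where "p = (1 + x) * r"
  have S: "q \<in> S" "p \<in> S" using xS r by (simp_all add: q_def p_def)
  have wr: "r - x * (x * r) = 1" using r(3) by (simp add: w_def left_diff_distrib mult.assoc)
  have q1: "(1 + x) * q = 1" and q2: "q * (1 + x) = 1" and p1: "(1 - x) * p = 1" and p2: "p * (1 - x) = 1"
    using wr by (simp_all add: q_def p_def distrib_left distrib_right left_diff_distrib right_diff_distrib
        mult.assoc rx rx')
  have sq: "star q = p"
    using xS r(1) rx by (simp add: q_def p_def sx sr distrib_left distrib_right)
  define u where "u = (1 - x) * q"
  have uS: "u \<in> S" using xS S by (simp add: u_def)
  have xq: "x * q = q * x" and xp: "x * p = p * x"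
    by (simp_all add: q_def p_def distrib_left distrib_right left_diff_distrib right_diff_distrib mult.assoc rx rx')
  have su: "star u = (1 + x) * p"
    using xS S xp by (simp add: u_def sx sq distrib_left distrib_right)
  have uq: "u = q * (1 - x)" using xq by (simp add: u_def left_diff_distrib right_diff_distrib)
  have "star u * u = 1"
  proof -
    have "star u * u = (1 + x) * (p * (1 - x)) * q" by (subst su) (simp only: u_def mult.assoc)
    then show ?thesis using p2 q1 by simp
  qed
  moreover have "u * star u = 1"
  proof -
    have "u * star u = (1 - x) * (q * (1 + x)) * p" by (subst su) (simp only: u_def mult.assoc)
    then show ?thesis using q2 p1 by simp
  qed
  moreover have aq: "\<alpha> y \<le> 2" if y: "y \<in> S" "y = 1 + z" "\<alpha> z \<le> 1 / 2 * \<alpha> y" "z \<in> S" for y z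
  proof -
    have "\<alpha> y \<le> 1 + \<alpha> z" using \<alpha>_triangle[of 1 z] y by simp
    then show ?thesis using y(3) by linarith
  qed
  have half: "\<alpha> (x * y) \<le> 1 / 2 * \<alpha> y" if "y \<in> S" for y
    using \<alpha>_mult[OF xS that] mult_right_mono[OF ax \<alpha>_nonneg[OF that]] by linarith
  have aq: "\<alpha> q \<le> 2"
  proof (rule aq[of q "- (x * q)"])
    show "q = 1 + - (x * q)" using q1 by (simp add: distrib_right algebra_simps)
  qed (use S xS half in auto)
  moreover have ap: "\<alpha> p \<le> 2"
  proof -
    have "p = 1 + x * p" using p1 by (simp add: left_diff_distrib algebra_simps)
    then have "\<alpha> p \<le> 1 + \<alpha> (x * p)" using \<alpha>_triangle[of 1 "x * p"] S xS by simp
    then show ?thesis using half[OF S(2)] by linarith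
  qed
  moreover have "\<alpha> u \<le> 3"
  proof -
    have "\<alpha> u \<le> \<alpha> (1 - x) * \<alpha> q" unfolding u_def using xS S by (intro \<alpha>_mult) auto
    also have "\<dots> \<le> (3 / 2) * 2" using aq ax \<alpha>_diff[of 1 x] xS S by (intro mult_mono) auto
    finally show ?thesis by simp
  qed
  moreover have "\<alpha> (star u) \<le> 3"
  proof -
    have "\<alpha> (star u) \<le> \<alpha> (1 + x) * \<alpha> p" unfolding su using xS S by (intro \<alpha>_mult) auto
    also have "\<dots> \<le> (3 / 2) * 2" using ap ax \<alpha>_triangle[of 1 x] xS S by (intro mult_mono) auto
    finally show ?thesis by simp
  qed
  ultimately show thesis using that[of q u] S uS q1 q2 u_def by blast
qed

text \<open>Read everything as functions of \<open>e\<close>. Then \<open>w\<close> is 1 at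
  \<open>e = 1\<close> and \<open>cnj \<zeta>\<close> at \<open>e = 0\<close>; \<open>f\<close>
  lives near the first point; \<open>\<kappa>\<close> is 0 at the first and 1 at the second. Hence
  \<open>1 - \<kappa>\<close> vanishes at \<open>e = 0\<close>, which puts it into the ideal
  \<open>B\<close>, while \<open>\<kappa>\<close> is small on the support of
  \<open>f\<close>.\<close>

theorem separating_element_exists:
  assumes I: "I \<subseteq> S" "0 \<in> I" "\<And>x y. x \<in> I \<Longrightarrow> y \<in> I \<Longrightarrow> x + y \<in> I"
      "\<And>a x. a \<in> S \<Longrightarrow> x \<in> I \<Longrightarrow> a * x \<in> I \<and> x * a \<in> I"
    and closed: "\<And>f x. (\<And>n. f n \<in> I) \<Longrightarrow> x \<in> S \<Longrightarrow> tends f x \<Longrightarrow> x \<in> I"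
    and B: "B \<subseteq> S" "\<And>a x. a \<in> S \<Longrightarrow> x \<in> B \<Longrightarrow> a * x \<in> B \<and> x * a \<in> B"
    and b: "b \<in> B" "b \<notin> I" and M: "M \<ge> 0"
    and approx: "\<And>\<epsilon>. \<epsilon> > 0 \<Longrightarrow> \<exists>e\<in>B. sa e \<and> \<alpha> e \<le> M \<and> \<alpha> (e * b - b) < \<epsilon>"
  shows "\<exists>v\<in>B. \<exists>c>0. \<forall>t\<ge>0. \<forall>y\<in>I. c + t \<le> N (v + R t + y)"
proof -
  have bS: "b \<in> S" using b B by blast
  define \<tau> where "\<tau> = 1 / (2 * (M + 1))"
  have \<tau>: "0 < \<tau>" "\<tau> \<le> 1 / 2" using M by (simp_all add: \<tau>_def divide_le_eq)
  define it where "it = \<i> * complex_of_real \<tau>"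
  have nz: "1 + it \<noteq> 0" by (simp add: it_def complex_eq_iff)
  \<comment> \<open>The value of the Cayley transform at \<open>e = 1\<close>; dividing by it moves
    the point of interest to 1.\<close>
  define \<zeta> where "\<zeta> = (1 - it) / (1 + it)"
  have cj: "cnj (1 + it) = 1 - it" by (simp add: it_def)
  have z1: "cmod \<zeta> = 1"
    unfolding \<zeta>_def norm_divide cj[symmetric] complex_mod_cnj using nz by simp
  have zz: "\<zeta> * cnj \<zeta> = 1" using complex_norm_square[of \<zeta>] z1 by simp
  have zit: "1 - \<zeta> = (1 + \<zeta>) * it" using nz by (simp add: \<zeta>_def field_simps)
  have zn1: "\<zeta> \<noteq> 1"
  proof
    assume "\<zeta> = 1"
    then have "2 * it = 0" using zit by simp
    then show False using \<tau> by (simp add: it_def)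
  qed
  define d where "d = cmod (cnj \<zeta> - 1)"
  have cz: "cnj \<zeta> - 1 \<noteq> 0" using zn1 by (metis complex_cnj_one complex_cnj_cancel_iff eq_iff_diff_eq_0)
  have d: "d > 0" using cz by (simp add: d_def)
  \<comment> \<open>\<open>d\<close> separates the points of \<open>e = 1\<close> and
    \<open>e = 0\<close>, and a support of half that size makes \<open>\<rho> = \<delta> / d\<close>
    at most 1/2.\<close>
  define \<delta> where "\<delta> = min 1 (d / 2)"
  have \<delta>: "0 < \<delta>" "\<delta> \<le> 1" "\<delta> \<le> d / 2" using d by (simp_all add: \<delta>_def)
  obtain C K where C: "C \<noteq> 0" and loc: "\<And>b \<epsilon>. b \<in> S \<Longrightarrow> \<epsilon> > 0 \<Longrightarrow> \<exists>\<eta>>0. \<forall>w\<in>S. \<forall>v\<in>S. w * v = 1 \<longrightarrow> v * w = 1 \<longrightarrow> N w \<le> 1 \<longrightarrow> N v \<le> 1 \<longrightarrow>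
       \<alpha> w \<le> 3 \<longrightarrow> \<alpha> v \<le> 3 \<longrightarrow> \<alpha> (w * b - b) \<le> \<eta> \<longrightarrow>
       (\<exists>f\<in>S. (\<forall>m. \<alpha> ((w - 1) ^ m * f) \<le> K * \<delta> ^ m) \<and> \<alpha> (f * b - R C * b) < \<epsilon>)"
    by (rule localized_elements[OF _ \<delta>(1,2), of 3]) (simp, blast)
  \<comment> \<open>As \<open>I\<close> is closed and does not contain \<open>R C * b\<close>, it
    has positive distance from it; any \<open>f * b\<close> within that distance is outside
    \<open>I\<close>.\<close>
  have "\<exists>\<epsilon>>0. \<forall>f\<in>I. \<epsilon> \<le> \<alpha> (f - R C * b)"
  proof (rule ccontr)
    assume no: "\<not> ?thesis"
    have "\<exists>f\<in>I. \<alpha> (f - R C * b) < 1 / real (Suc n)" for n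
      using no by (metis not_le of_nat_0_less_iff zero_less_Suc zero_less_divide_1_iff)
    then obtain f where f: "\<And>n. f n \<in> I" "\<And>n. \<alpha> (f n - R C * b) < 1 / real (Suc n)" by metis
    have "tends (\<lambda>n. f n - R C * b) 0"
    proof (rule tends_null)
      show "f n - R C * b \<in> S" for n using f(1) I bS by blast
      show "\<alpha> (f n - R C * b) \<le> 1 / real (Suc n)" for n using f(2) by (rule less_imp_le)
      show "(\<lambda>n. 1 / real (Suc n)) \<longlonglongrightarrow> 0" using LIMSEQ_inverse_real_of_nat by (simp add: inverse_eq_divide)
    qed
    then have "tends f (R C * b)" by (simp add: tends_def)
    then have "R C * b \<in> I" using closed[of f "R C * b"] f bS by simp
    then have "R (1 / C) * (R C * b) \<in> I" using I(4)[of "R (1 / C)"] by blast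
    then show False using C b by (simp add: R_R)
  qed
  then obtain \<epsilon> where \<epsilon>: "\<epsilon> > 0" "\<And>f. f \<in> I \<Longrightarrow> \<epsilon> \<le> \<alpha> (f - R C * b)" by blast
  obtain \<eta> where eta: "\<eta> > 0" and loc': "\<And>w v. w \<in> S \<Longrightarrow> v \<in> S \<Longrightarrow> w * v = 1 \<Longrightarrow> v * w = 1 \<Longrightarrow> N w \<le> 1 \<Longrightarrow> N v \<le> 1 \<Longrightarrow>
       \<alpha> w \<le> 3 \<Longrightarrow> \<alpha> v \<le> 3 \<Longrightarrow> \<alpha> (w * b - b) \<le> \<eta> \<Longrightarrow>
       \<exists>f\<in>S. (\<forall>m. \<alpha> ((w - 1) ^ m * f) \<le> K * \<delta> ^ m) \<and> \<alpha> (f * b - R C * b) < \<epsilon>"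
    using loc[OF bS \<epsilon>(1)] by blast
  \<comment> \<open>\<open>\<eta> / 2\<close> because the estimate of \<open>w * b - b\<close> loses
    a factor 2: \<open>\<alpha> q \<le> 2\<close>, the modulus of \<open>1 + \<zeta>\<close> is at
    most 2, and \<open>\<tau> \<le> 1 / 2\<close>.\<close>
  obtain e where e: "e \<in> B" "sa e" "\<alpha> e \<le> M" "\<alpha> (e * b - b) < \<eta> / 2" using approx[of "\<eta> / 2"] eta by auto
  have eS: "e \<in> S" using e B by blast
  define x where "x = \<iota> it * e"
  have xS: "x \<in> S" using eS by (simp add: x_def)
  have "\<exists>q u. q \<in> S \<and> u \<in> S \<and> (1 + x) * q = 1 \<and> q * (1 + x) = 1 \<and> u = (1 - x) * q \<and> \<alpha> q \<le> 2 \<and>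
    star u * u = 1 \<and> u * star u = 1 \<and> \<alpha> u \<le> 3 \<and> \<alpha> (star u) \<le> 3"
    using cayley_transform[OF e(2,3) M] unfolding x_def it_def \<tau>_def by metis
  then obtain q u where q: "q \<in> S" "(1 + x) * q = 1" "q * (1 + x) = 1" "\<alpha> q \<le> 2"
    and u: "u \<in> S" "u = (1 - x) * q" "star u * u = 1" "u * star u = 1" "\<alpha> u \<le> 3" "\<alpha> (star u) \<le> 3"
    by blast
  have "N u ^ 2 = 1" using N_cstar[OF u(1)] u(3) by simp
  then have Nu: "N u = 1" using N_nonneg[OF u(1)] by (simp add: power2_eq_1_iff)
  define w where "w = \<iota> (cnj \<zeta>) * u"
  define v where "v = \<iota> \<zeta> * star u"
  have wS: "w \<in> S" "v \<in> S" using u by (simp_all add: w_def v_def)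
  have suS: "star u \<in> S" using u by simp
  have wv: "w * v = 1" "v * w = 1"
    using u(3,4) zz by (simp_all add: w_def v_def mult.assoc central[OF u(1)] central[OF suS] iota_simps mult.commute)
  have N: "N w \<le> 1" "N v \<le> 1" using Nu u z1 by (simp_all add: w_def v_def N_scale)
  have \<alpha>wv: "\<alpha> w \<le> 3" "\<alpha> v \<le> 3"
    using \<alpha>_iota_mult[OF u(1), of "cnj \<zeta>"] \<alpha>_iota_mult[OF suS, of \<zeta>] u z1 by (simp_all add: w_def v_def)
  have "\<alpha> (w * b - b) \<le> \<eta>"
  proof -
    have qx: "q * x = 1 - q" using q(3) by (simp add: distrib_left algebra_simps)
    have xq: "x * q = 1 - q" using q(2) by (simp add: distrib_right algebra_simps)
    have uu: "u = q - q * x" using xq qx by (simp add: u(2) left_diff_distrib)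
    have zb: "\<iota> (1 - \<zeta>) * y = \<iota> (1 + \<zeta>) * (\<iota> it * y)" for y by (simp add: zit iota_left_mult)
    \<comment> \<open>\<open>u - \<zeta>\<close> vanishes at \<open>e = 1\<close>: up to scalars it
      is \<open>q * (1 - e)\<close>.\<close>
    have "u * b - \<iota> \<zeta> * b = q * (\<iota> (1 + \<zeta>) * (\<iota> it * (b - e * b)))"
    proof -
      have qq: "\<iota> \<zeta> * b = q * ((1 + x) * (\<iota> \<zeta> * b))" using q(3) by (simp add: mult.assoc[symmetric])
      have "u * b - \<iota> \<zeta> * b = q * ((1 - x) * b - (1 + x) * (\<iota> \<zeta> * b))"
        by (subst qq) (simp add: uu left_diff_distrib right_diff_distrib distrib_left distrib_right mult.assoc)
      also have "(1 - x) * b - (1 + x) * (\<iota> \<zeta> * b) = \<iota> (1 - \<zeta>) * b - \<iota> (1 + \<zeta>) * (x * b)"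
        using bS by (simp add: iota_diff iota_add left_diff_distrib distrib_right central[OF xS])
      also have "\<dots> = \<iota> (1 + \<zeta>) * (\<iota> it * (b - e * b))"
        unfolding zb by (simp add: x_def right_diff_distrib mult.assoc)
      finally show ?thesis .
    qed
    moreover have "w * b - b = \<iota> (cnj \<zeta>) * (u * b - \<iota> \<zeta> * b)"
      using zz by (simp add: w_def right_diff_distrib mult.assoc iota_simps mult.commute)
    ultimately have "\<alpha> (w * b - b) \<le> cmod (cnj \<zeta>) * \<alpha> (q * (\<iota> (1 + \<zeta>) * (\<iota> it * (b - e * b))))"
      using \<alpha>_iota_mult[of "q * (\<iota> (1 + \<zeta>) * (\<iota> it * (b - e * b)))" "cnj \<zeta>"] q bS eS by simp
    also have "\<dots> \<le> \<alpha> q * \<alpha> (\<iota> (1 + \<zeta>) * (\<iota> it * (b - e * b)))"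
      using z1 \<alpha>_mult[of q "\<iota> (1 + \<zeta>) * (\<iota> it * (b - e * b))"] q bS eS by simp
    also have "\<dots> \<le> 2 * (2 * (1 / 2 * \<alpha> (b - e * b)))"
    proof (rule mult_mono)
      have bb: "b - e * b \<in> S" using bS eS by simp
      have "\<alpha> (\<iota> (1 + \<zeta>) * (\<iota> it * (b - e * b))) \<le> cmod (1 + \<zeta>) * \<alpha> (\<iota> it * (b - e * b))"
        using bb by (intro \<alpha>_iota_mult) auto
      also have "\<dots> \<le> 2 * (1 / 2 * \<alpha> (b - e * b))"
      proof (rule mult_mono)
        show "cmod (1 + \<zeta>) \<le> 2" using norm_triangle_ineq[of 1 \<zeta>] z1 by simp
        have "\<alpha> (\<iota> it * (b - e * b)) \<le> cmod it * \<alpha> (b - e * b)" using bb by (rule \<alpha>_iota_mult)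
        also have "\<dots> \<le> 1 / 2 * \<alpha> (b - e * b)" using \<tau> bb by (intro mult_right_mono) (auto simp: it_def norm_mult)
        finally show "\<alpha> (\<iota> it * (b - e * b)) \<le> 1 / 2 * \<alpha> (b - e * b)" .
      qed (use bb in auto)
      finally show "\<alpha> (\<iota> (1 + \<zeta>) * (\<iota> it * (b - e * b))) \<le> 2 * (1 / 2 * \<alpha> (b - e * b))" .
    qed (use q bS eS in auto)
    also have "\<alpha> (b - e * b) = \<alpha> (e * b - b)" using bS eS by (intro \<alpha>_diff_commute) auto
    finally show ?thesis using e(4) by simp
  qed
  from loc'[OF wS wv N \<alpha>wv this] obtain f where f: "f \<in> S" "\<And>m. \<alpha> ((w - 1) ^ m * f) \<le> K * \<delta> ^ m" "\<alpha> (f * b - R C * b) < \<epsilon>"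
    by blast
  have fb: "f * b \<notin> I" using \<epsilon>(2)[of "f * b"] f(3) by auto
  define a where "a = 1 / (cnj \<zeta> - 1)"
  define \<kappa> where "\<kappa> = \<iota> a * (w - 1)"
  have w1: "w - 1 \<in> S" using wS by simp
  have kS: "\<kappa> \<in> S" using wS by (simp add: \<kappa>_def)
  have kp: "\<kappa> ^ m = \<iota> (a ^ m) * (w - 1) ^ m" for m
  proof (induction m)
    case (Suc m)
    then show ?case by (simp add: \<kappa>_def mult.assoc central[OF w1] iota_simps)
  qed simp
  define \<rho> where "\<rho> = \<delta> / d"
  have \<rho>: "0 \<le> \<rho>" "\<rho> < 1" using \<delta> d by (simp_all add: \<rho>_def field_simps)
  have bound: "\<alpha> (\<kappa> ^ m * (f * b)) \<le> (K * \<alpha> b) * \<rho> ^ m" for m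
  proof -
    have ws: "(w - 1) ^ m \<in> S" using w1 by simp
    have "\<alpha> (\<kappa> ^ m * (f * b)) = \<alpha> (\<iota> (a ^ m) * (((w - 1) ^ m * f) * b))" by (simp add: kp mult.assoc)
    also have "\<dots> \<le> cmod (a ^ m) * \<alpha> (((w - 1) ^ m * f) * b)" using ws f bS by (intro \<alpha>_iota_mult) auto
    also have "\<dots> \<le> cmod (a ^ m) * (\<alpha> ((w - 1) ^ m * f) * \<alpha> b)"
      using ws f bS by (intro mult_left_mono \<alpha>_mult) auto
    also have "\<dots> \<le> cmod (a ^ m) * (K * \<delta> ^ m * \<alpha> b)"
      using f(2) bS by (intro mult_left_mono mult_right_mono) auto
    also have "cmod (a ^ m) = 1 / d ^ m" by (simp add: a_def d_def norm_power norm_divide power_one_over)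
    finally show ?thesis by (simp add: \<rho>_def power_divide mult_ac)
  qed
  \<comment> \<open>The factor \<open>x\<close>, a multiple of \<open>e\<close>, exhibits
    \<open>1 - \<kappa>\<close> as a member of the ideal \<open>B\<close>.\<close>
  have v: "1 - \<kappa> = \<iota> (a * cnj \<zeta>) * (\<iota> 2 * (x * q))"
  proof -
    have a1: "\<iota> (a * cnj \<zeta>) - \<iota> a = 1"
    proof -
      have "a * cnj \<zeta> - a = 1" using cz by (simp add: a_def flip: right_diff_distrib diff_divide_distrib)
      then show ?thesis by (simp flip: iota_diff)
    qed
    have "1 - \<kappa> = (\<iota> (a * cnj \<zeta>) - \<iota> a) - \<iota> a * (w - 1)" by (simp add: a1 \<kappa>_def)
    also have "\<dots> = \<iota> (a * cnj \<zeta>) * (1 - u)"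
      by (simp add: w_def right_diff_distrib iota_left_mult)
    also have "1 - u = (1 + x) * q - (1 - x) * q" by (simp add: q(2) u(2))
    also have "\<dots> = \<iota> 2 * (x * q)"
      using iota_add[of 1 1] by (simp add: distrib_right left_diff_distrib mult_2)
    finally show ?thesis .
  qed
  have "x \<in> B" unfolding x_def using B(2)[OF iota_closed e(1)] by blast
  then have "x * q \<in> B" using B(2)[OF q(1)] by blast
  then have "1 - \<kappa> \<in> B" unfolding v using B(2) iota_closed by blast
  moreover have "\<forall>t\<ge>0. \<forall>y\<in>I. (1 - \<rho>) + t \<le> N ((1 - \<kappa>) + R t + y)"
  proof (intro allI ballI impI)
    fix t y assume t: "(0 :: real) \<le> t" and y: "y \<in> I"
    have fbS: "f * b \<in> S" using f bS by simp
    show "(1 - \<rho>) + t \<le> N ((1 - \<kappa>) + R t + y)"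
      by (rule norm_lower_bound_mod_ideal[where I = I and g = "f * b" and K = "K * \<alpha> b"]; fact)
  qed
  moreover have "1 - \<rho> > 0" using \<rho> by simp
  ultimately show ?thesis by blast
qed

end

section \<open>The unitization\<close>

text \<open>A ring type that hosts the unitization \<open>\<complex> \<oplus> A\<close> for every scalar multiplication \<open>sm\<close> at once: the element
  \<open>c + a\<close> is represented by \<open>c\<close> together with the operator \<open>x \<mapsto> c x + a x\<close>. The first component keeps
  the representation faithful when \<open>A\<close> has a unit.\<close>
typedef (overloaded) 'b scalar_endo =
  "{cf :: complex \<times> ('b::ab_group_add \<Rightarrow> 'b). \<forall>x y. snd cf (x + y) = snd cf x + snd cf y}"
  by (rule exI[of _ "(0, \<lambda>x. x)"]) simp

setup_lifting type_definition_scalar_endo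

lift_definition scal :: "'b::ab_group_add scalar_endo \<Rightarrow> complex" is fst .

lift_definition endo :: "'b::ab_group_add scalar_endo \<Rightarrow> 'b \<Rightarrow> 'b" is snd .

lemma scalar_endo_eqI: "scal u = scal v \<Longrightarrow> (\<And>x. endo u x = endo v x) \<Longrightarrow> u = v"
  by transfer (auto simp: prod_eq_iff)

lemma endo_add_arg: "endo u (x + y) = endo u x + endo u y"
  by transfer simp

instantiation scalar_endo :: (ab_group_add) ring_1
begin

lift_definition zero_scalar_endo :: "'a scalar_endo" is "(0, \<lambda>x. 0)" by simp
lift_definition one_scalar_endo :: "'a scalar_endo" is "(1, \<lambda>x. x)" by simp
lift_definition plus_scalar_endo :: "'a scalar_endo \<Rightarrow> 'a scalar_endo \<Rightarrow> 'a scalar_endo"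
  is "\<lambda>u v. (fst u + fst v, \<lambda>x. snd u x + snd v x)" by simp
lift_definition minus_scalar_endo :: "'a scalar_endo \<Rightarrow> 'a scalar_endo \<Rightarrow> 'a scalar_endo"
  is "\<lambda>u v. (fst u - fst v, \<lambda>x. snd u x - snd v x)" by simp
lift_definition uminus_scalar_endo :: "'a scalar_endo \<Rightarrow> 'a scalar_endo"
  is "\<lambda>u. (- fst u, \<lambda>x. - snd u x)" by simp
lift_definition times_scalar_endo :: "'a scalar_endo \<Rightarrow> 'a scalar_endo \<Rightarrow> 'a scalar_endo"
  is "\<lambda>u v. (fst u * fst v, \<lambda>x. snd u (snd v x))" by simp

instance
  by standard (transfer; auto simp: prod_eq_iff fun_eq_iff algebra_simps)+

end

lemma scal_simps [simp]:
  "scal (u + v) = scal u + scal v" "scal (u - v) = scal u - scal v" "scal (u * v) = scal u * scal v"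
  "scal 0 = 0" "scal 1 = 1"
  by (transfer, simp)+

lemma endo_simps [simp]:
  "endo (u + v) x = endo u x + endo v x" "endo (u - v) x = endo u x - endo v x"
  "endo (u * v) x = endo u (endo v x)" "endo 0 x = 0" "endo 1 x = x"
  by (transfer, simp)+

section \<open>The unitization of a differential subalgebra\<close>

locale differential_setting =
  fixes k :: nat and p q :: real and A :: "'b::ring set" and sm :: "complex \<Rightarrow> 'b \<Rightarrow> 'b" and st :: "'b \<Rightarrow> 'b"
    and nA nB :: "'b \<Rightarrow> real"
  assumes differential: "differential_subalgebra k p q A sm st nA nB"
begin

lemma cstar_parts:
  "complex_algebra sm" "is_norm_on UNIV sm nB" "\<forall>x y. nB (x * y) \<le> nB x * nB y"
  "involution_on UNIV sm st" "\<forall>x. nB (st x * x) = nB x ^ 2"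
  using differential unfolding differential_subalgebra_def cstar_algebra_def by - (elim conjE, assumption)+

lemma algebra_parts:
  "\<forall>c x y. sm c (x + y) = sm c x + sm c y" "\<forall>c d x. sm (c + d) x = sm c x + sm d x"
  "\<forall>c d x. sm c (sm d x) = sm (c * d) x" "\<forall>x. sm 1 x = x"
  "\<forall>c x y. sm c (x * y) = sm c x * y" "\<forall>c x y. sm c (x * y) = x * sm c y"
  using cstar_parts(1) unfolding complex_algebra_def by - (elim conjE, assumption)+

lemmas sm_add = algebra_parts(1)[rule_format]
  and sm_add_left = algebra_parts(2)[rule_format]
  and sm_sm = algebra_parts(3)[rule_format]
  and sm_one [simp] = algebra_parts(4)[rule_format]
  and sm_mult_left = algebra_parts(5)[rule_format, symmetric]
  and sm_mult_right = algebra_parts(6)[rule_format, symmetric]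

lemma nB_nonneg [simp]: "0 \<le> nB x"
  and nB_eq_zero: "nB x = 0 \<longleftrightarrow> x = 0"
  and nB_triangle: "nB (x + y) \<le> nB x + nB y"
  and nB_scale: "nB (sm c x) = cmod c * nB x"
  and nB_mult: "nB (x * y) \<le> nB x * nB y"
  and nB_cstar: "nB (st x * x) = nB x ^ 2"
  using cstar_parts(2,3,5) unfolding is_norm_on_def by simp_all

lemma st_add: "st (x + y) = st x + st y"
  and st_scale: "st (sm c x) = sm (cnj c) (st x)"
  and st_mult: "st (x * y) = st y * st x"
  and st_st [simp]: "st (st x) = x"
  using cstar_parts(4) unfolding involution_on_def by simp_all

lemma A_zero [simp]: "0 \<in> A"
  and A_add [simp]: "x \<in> A \<Longrightarrow> y \<in> A \<Longrightarrow> x + y \<in> A"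
  and A_mult [simp]: "x \<in> A \<Longrightarrow> y \<in> A \<Longrightarrow> x * y \<in> A"
  and A_scale [simp]: "x \<in> A \<Longrightarrow> sm c x \<in> A"
  and A_star [simp]: "x \<in> A \<Longrightarrow> st x \<in> A"
  using differential unfolding differential_subalgebra_def banach_star_algebra_def star_subalgebra_def by blast+

lemma banach_parts:
  "star_subalgebra A sm st" "is_norm_on A sm nA" "\<forall>x\<in>A. \<forall>y\<in>A. nA (x * y) \<le> nA x * nA y"
  "complete_wrt A (\<lambda>x y. nA (x - y))" "\<exists>C. \<forall>x\<in>A. nA (st x) \<le> C * nA x"
  using differential unfolding differential_subalgebra_def banach_star_algebra_def by - (elim conjE, assumption)+

lemma nA_nonneg [simp]: "x \<in> A \<Longrightarrow> 0 \<le> nA x"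
  and nA_eq_zero: "x \<in> A \<Longrightarrow> nA x = 0 \<longleftrightarrow> x = 0"
  and nA_triangle: "x \<in> A \<Longrightarrow> y \<in> A \<Longrightarrow> nA (x + y) \<le> nA x + nA y"
  and nA_scale: "x \<in> A \<Longrightarrow> nA (sm c x) = cmod c * nA x"
  and nA_mult: "x \<in> A \<Longrightarrow> y \<in> A \<Longrightarrow> nA (x * y) \<le> nA x * nA y"
  and nA_complete: "complete_wrt A (\<lambda>x y. nA (x - y))"
  and nA_star: "\<exists>C. \<forall>x\<in>A. nA (st x) \<le> C * nA x"
  using banach_parts(2-) unfolding is_norm_on_def by simp_all

lemma kpq: "k \<ge> 2" "p > 0" "q > 0" "p + q = real k"
  and ineq: "\<exists>C>0. \<forall>a\<in>A. nA (mpow a (k - 1)) \<le> C * nA a powr p * nB a powr q"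
  using differential unfolding differential_subalgebra_def by blast+

lemma sm_zero_left [simp]: "sm 0 x = 0"
  using sm_add_left[of 0 0 x] by simp

lemma sm_zero_right [simp]: "sm c 0 = 0"
  using sm_add[of c 0 0] by simp

lemma sm_minus_left: "sm (- c) x = - sm c x"
  using sm_add_left[of c "- c" x] by (simp add: eq_neg_iff_add_eq_0 add.commute)

lemma A_minus [simp]: "x \<in> A \<Longrightarrow> - x \<in> A"
  using A_scale[of x "- 1"] by (simp add: sm_minus_left)

lemma A_diff [simp]: "x \<in> A \<Longrightarrow> y \<in> A \<Longrightarrow> x - y \<in> A"
  using A_add[of x "- y"] by simp

lemma nA_zero [simp]: "nA 0 = 0"
  using nA_eq_zero[of 0] by simp

lemma nB_st [simp]: "nB (st x) = nB x"
proof -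
  have le: "nB x \<le> nB (st x)" for x
  proof (cases "nB x = 0")
    case False
    then have "nB x > 0" using nB_nonneg[of x] by linarith
    moreover have "nB x * nB x \<le> nB (st x) * nB x" using nB_cstar[of x] nB_mult[of "st x" x] by (simp add: power2_eq_square)
    ultimately show ?thesis by simp
  qed simp
  show ?thesis using le[of x] le[of "st x"] by simp
qed

text \<open>Test on \<open>st (a - b)\<close> and apply the C*-identity. This makes the algebra part
  of \<open>U c a\<close> recoverable from its operator.\<close>

lemma left_faithful:
  fixes a b :: 'b
  assumes "\<And>x. a * x = b * x" shows "a = b"
proof -
  have "nB (st (a - b)) ^ 2 = nB ((a - b) * st (a - b))" using nB_cstar[of "st (a - b)"] by simp
  also have "(a - b) * st (a - b) = 0" using assms by (simp add: left_diff_distrib)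
  finally have "nB (a - b) = 0" using nB_eq_zero[of 0] by simp
  then show ?thesis using nB_eq_zero by simp
qed

definition U :: "complex \<Rightarrow> 'b \<Rightarrow> 'b scalar_endo" where
  "U c a = Abs_scalar_endo (c, \<lambda>x. sm c x + a * x)"

lemma U_rep: "Rep_scalar_endo (U c a) = (c, \<lambda>x. sm c x + a * x)"
  unfolding U_def by (rule Abs_scalar_endo_inverse) (simp add: sm_add distrib_left add_ac)

lemma scal_U [simp]: "scal (U c a) = c"
  and endo_U [simp]: "endo (U c a) x = sm c x + a * x"
  by (simp_all add: scal.rep_eq endo.rep_eq U_rep)

lemma U_add: "U c a + U d b = U (c + d) (a + b)"
  by (rule scalar_endo_eqI) (simp_all add: sm_add_left distrib_right add_ac)

lemma U_diff: "U c a - U d b = U (c - d) (a - b)"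
  using U_add[of "c - d" "a - b" d b] by (simp add: diff_eq_eq)

lemma U_mult: "U c a * U d b = U (c * d) (sm c b + sm d a + a * b)"
  by (rule scalar_endo_eqI)
    (simp_all add: sm_add sm_sm distrib_left distrib_right sm_mult_left sm_mult_right mult.assoc add_ac)

lemma U_eq_iff: "U c a = U d b \<longleftrightarrow> c = d \<and> a = b"
proof
  assume eq: "U c a = U d b"
  have cd: "c = d" using arg_cong[OF eq, of scal] by simp
  have "a * x = b * x" for x using arg_cong[OF eq, of "\<lambda>u. endo u x"] cd by simp
  then show "c = d \<and> a = b" using cd left_faithful by blast
qed simp

definition S :: "'b scalar_endo set" where "S = {U c a | c a. a \<in> A}"

definition part :: "'b scalar_endo \<Rightarrow> 'b" where "part u = (THE a. u = U (scal u) a)"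

lemma part_U [simp]: "part (U c a) = a"
  unfolding part_def by (rule the_equality) (auto simp: U_eq_iff)

definition star :: "'b scalar_endo \<Rightarrow> 'b scalar_endo" where
  "star u = U (cnj (scal u)) (st (part u))"

definition iota :: "complex \<Rightarrow> 'b scalar_endo" where "iota c = U c 0"

definition opn :: "'b scalar_endo \<Rightarrow> real" where
  "opn u = Inf {K. 0 \<le> K \<and> (\<forall>x. nB (endo u x) \<le> K * nB x)}"

text \<open>The larger of the C*-seminorms of two representations, the character \<open>scal\<close>
  and left multiplication on the C*-algebra. The character keeps the scalar part under control:
  \<open>N u \<le> 1\<close> bounds \<open>c\<close> by 1 and then \<open>nB a\<close> by 2.\<close>

definition N :: "'b scalar_endo \<Rightarrow> real" where "N u = max (cmod (scal u)) (opn u)"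

definition \<alpha> :: "'b scalar_endo \<Rightarrow> real" where "\<alpha> u = cmod (scal u) + nA (part u)"

text \<open>\<open>p\<close> comes from the differential inequality, \<open>k - 1\<close> from the
  mixed terms between the scalar and \<open>a\<close> in a \<open>k\<close>-th power, and
  \<open>3 / 2\<close> ensures an exponent above 1. All three are below \<open>k\<close>, since
  \<open>p = k - q\<close> and \<open>k \<ge> 2\<close>.\<close>

definition growth_exp :: real where "growth_exp = max (max p (real (k - 1))) (3 / 2)"

lemma S_cases: assumes "u \<in> S" obtains c a where "u = U c a" "a \<in> A"
  using assms by (auto simp: S_def)

lemma U_S [simp, intro]: "a \<in> A \<Longrightarrow> U c a \<in> S"
  by (auto simp: S_def)

lemma star_U [simp]: "star (U c a) = U (cnj c) (st a)"
  by (simp add: star_def)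

lemma st_zero [simp]: "st 0 = 0"
  using st_add[of 0 0] by simp

lemma \<alpha>_U [simp]: "\<alpha> (U c a) = cmod c + nA a"
  by (simp add: \<alpha>_def)

lemma opn_le: assumes "0 \<le> K" "\<And>x. nB (endo u x) \<le> K * nB x" shows "opn u \<le> K"
  unfolding opn_def using assms by (intro cInf_lower bdd_belowI[of _ 0]) auto

lemma U_bounded: "nB (endo (U c a) x) \<le> (cmod c + nB a) * nB x"
  using nB_triangle[of "sm c x" "a * x"] nB_mult[of a x] by (simp add: nB_scale distrib_right)

lemma opn_nonneg: assumes "u \<in> S" shows "0 \<le> opn u"
proof -
  obtain c a where "u = U c a" using assms by (auto elim: S_cases)
  then have "{K. 0 \<le> K \<and> (\<forall>x. nB (endo u x) \<le> K * nB x)} \<noteq> {}"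
    using U_bounded[of c a] by (auto intro!: exI[of _ "cmod c + nB a"] simp del: endo_U)
  then show ?thesis unfolding opn_def by (intro cInf_greatest) auto
qed

lemma opn_bound: assumes "u \<in> S" shows "nB (endo u x) \<le> opn u * nB x"
proof (cases "nB x = 0")
  case True
  then have "x = 0" by (simp add: nB_eq_zero)
  moreover have "endo u 0 = 0" using endo_add_arg[of u 0 0] by simp
  ultimately show ?thesis using nB_eq_zero[of 0] by simp
next
  case False
  then have x: "nB x > 0" using nB_nonneg[of x] by linarith
  obtain c a where "u = U c a" using assms by (auto elim: S_cases)
  then have "{K. 0 \<le> K \<and> (\<forall>x. nB (endo u x) \<le> K * nB x)} \<noteq> {}"
    using U_bounded[of c a] by (auto intro!: exI[of _ "cmod c + nB a"] simp del: endo_U)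
  then have "nB (endo u x) / nB x \<le> opn u"
    unfolding opn_def using x by (intro cInf_greatest) (auto simp: pos_divide_le_eq)
  then show ?thesis using x by (simp add: pos_divide_le_eq)
qed

lemma opn_add: assumes "u \<in> S" "v \<in> S" shows "opn (u + v) \<le> opn u + opn v"
proof (rule opn_le)
  show "nB (endo (u + v) x) \<le> (opn u + opn v) * nB x" for x
    using nB_triangle[of "endo u x" "endo v x"] opn_bound[OF assms(1), of x] opn_bound[OF assms(2), of x]
    by (simp add: distrib_right)
qed (use assms opn_nonneg in simp)

lemma opn_mult: assumes "u \<in> S" "v \<in> S" shows "opn (u * v) \<le> opn u * opn v"
proof (rule opn_le)
  show "nB (endo (u * v) x) \<le> opn u * opn v * nB x" for x
    using opn_bound[OF assms(1), of "endo v x"] mult_left_mono[OF opn_bound[OF assms(2), of x] opn_nonneg[OF assms(1)]]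
    by (simp add: mult.assoc)
qed (use assms opn_nonneg in simp)

lemma opn_iota: "opn (iota c) \<le> cmod c"
  by (rule opn_le) (auto simp: iota_def nB_scale)

lemma nB_le_opn: "a \<in> A \<Longrightarrow> nB a \<le> opn (U 0 a)"
proof -
  assume a: "a \<in> A"
  show ?thesis
  proof (cases "nB a = 0")
    case False
    then have pos: "nB a > 0" using nB_nonneg[of a] by linarith
    have "nB a * nB a = nB (a * st a)" using nB_cstar[of "st a"] by (simp add: power2_eq_square)
    also have "\<dots> \<le> opn (U 0 a) * nB a" using opn_bound[of "U 0 a" "st a"] a by simp
    finally show ?thesis using pos by simp
  qed (use a opn_nonneg[of "U 0 a"] in auto)
qed

lemma star_S [simp, intro]: "u \<in> S \<Longrightarrow> star u \<in> S"
  by (auto elim!: S_cases)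

lemma mult_S [simp, intro]: "u \<in> S \<Longrightarrow> v \<in> S \<Longrightarrow> u * v \<in> S"
  by (auto elim!: S_cases simp: U_mult)

text \<open>If \<open>y\<close> is the image of \<open>x\<close> under \<open>u\<close>, then
  \<open>st y * y\<close> is \<open>st x\<close> times the image of \<open>x\<close> under
  \<open>star u * u\<close>. The C*-identity of \<open>nB\<close> thus bounds
  \<open>nB y ^ 2\<close> by \<open>opn (star u * u) * nB x ^ 2\<close>.\<close>

lemma opn_cstar: assumes u: "u \<in> S" shows "opn (star u * u) = opn u ^ 2"
proof -
  have sq: "opn u ^ 2 \<le> opn (star u * u)" if u: "u \<in> S" for u
  proof -
    obtain c a where ca: "u = U c a" "a \<in> A" using u by (rule S_cases)
    have o: "0 \<le> opn (star u * u)" using u by (intro opn_nonneg) auto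
    have "opn u \<le> sqrt (opn (star u * u))"
    proof (rule opn_le)
      fix x
      have "st (endo u x) * endo u x = st x * endo (star u * u) x"
        unfolding ca by (simp add: st_add st_scale st_mult sm_add sm_sm distrib_left distrib_right
            sm_mult_left sm_mult_right mult.assoc mult.commute[of "cnj c" c])
      then have "nB (endo u x) ^ 2 = nB (st x * endo (star u * u) x)" using nB_cstar[of "endo u x"] by simp
      also have "\<dots> \<le> nB x * nB (endo (star u * u) x)" using nB_mult[of "st x"] by simp
      also have "\<dots> \<le> nB x * (opn (star u * u) * nB x)"
        using u by (intro mult_left_mono opn_bound) auto
      also have "\<dots> = (sqrt (opn (star u * u)) * nB x) ^ 2"
        using o by (simp add: power_mult_distrib power2_eq_square[of "nB x"])
      finally show "nB (endo u x) \<le> sqrt (opn (star u * u)) * nB x"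
        by (rule power2_le_imp_le) (use o in simp)
    qed (use o in simp)
    then have "opn u ^ 2 \<le> sqrt (opn (star u * u)) ^ 2" using opn_nonneg[OF u] by (intro power_mono)
    then show ?thesis using o by simp
  qed
  have le: "opn u \<le> opn (star u)" if u: "u \<in> S" for u
  proof (cases "opn u = 0")
    case True then show ?thesis using opn_nonneg[of "star u"] u by simp
  next
    case False
    then have "opn u > 0" using opn_nonneg[OF u] by linarith
    moreover have "opn u * opn u \<le> opn (star u) * opn u"
      using sq[OF u] opn_mult[of "star u" u] u by (simp add: power2_eq_square)
    ultimately show ?thesis by simp
  qed
  have "star (star u) = u" using u by (auto elim!: S_cases)
  then have "opn (star u) = opn u" using le[OF u] le[of "star u"] u by simp
  then show ?thesis using sq[OF u] opn_mult[of "star u" u] u by (simp add: power2_eq_square)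
qed

lemma mpow_U: "a \<in> A \<Longrightarrow> U 0 a ^ Suc n = U 0 (mpow a n)"
  by (induction n) (simp_all add: U_mult)

lemma \<alpha>_S_nonneg: "u \<in> S \<Longrightarrow> 0 \<le> \<alpha> u"
  by (auto elim!: S_cases)

lemma \<alpha>_S_add: "u \<in> S \<Longrightarrow> v \<in> S \<Longrightarrow> \<alpha> (u + v) \<le> \<alpha> u + \<alpha> v"
proof (elim S_cases)
  fix c a d b assume "u = U c a" "a \<in> A" "v = U d b" "b \<in> A"
  then show ?thesis using norm_triangle_ineq[of c d] nA_triangle[of a b] by (simp add: U_add)
qed

lemma \<alpha>_S_mult: "u \<in> S \<Longrightarrow> v \<in> S \<Longrightarrow> \<alpha> (u * v) \<le> \<alpha> u * \<alpha> v"
proof (elim S_cases)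
  fix c a d b assume A: "u = U c a" "a \<in> A" "v = U d b" "b \<in> A"
  have "nA (sm c b + sm d a + a * b) \<le> nA (sm c b) + nA (sm d a) + nA (a * b)"
    using nA_triangle[of "sm c b + sm d a" "a * b"] nA_triangle[of "sm c b" "sm d a"] A by simp
  also have "\<dots> \<le> cmod c * nA b + cmod d * nA a + nA a * nA b"
    using nA_mult[of a b] A by (simp add: nA_scale)
  finally show ?thesis using A by (simp add: U_mult norm_mult algebra_simps)
qed

lemma power_S: "u \<in> S \<Longrightarrow> u ^ n \<in> S"
proof (induction n)
  case 0
  have "1 = U 1 0" by (rule scalar_endo_eqI) simp_all
  then show ?case using U_S[OF A_zero, of 1] by simp
qed simp

lemma \<alpha>_power_S: "u \<in> S \<Longrightarrow> \<alpha> (u ^ Suc n) \<le> \<alpha> u ^ Suc n"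
proof (induction n)
  case (Suc n)
  have "\<alpha> (u * u ^ Suc n) \<le> \<alpha> u * \<alpha> (u ^ Suc n)" using Suc.prems power_S by (intro \<alpha>_S_mult)
  also have "\<dots> \<le> \<alpha> u * \<alpha> u ^ Suc n" using Suc by (intro mult_left_mono \<alpha>_S_nonneg) auto
  finally show ?case by simp
qed simp

text \<open>Telescoping: the two bases differ by the scalar \<open>c\<close>, of modulus at most 1,
  so every term has one factor fewer than the powers themselves.\<close>

lemma power_difference:
  assumes a: "a \<in> A" and c: "cmod c \<le> 1"
  shows "\<alpha> (U c a ^ Suc n - U 0 a ^ Suc n) \<le> real (Suc n) * max 1 (\<alpha> (U c a)) ^ n"
proof (induction n)
  case 0
  then show ?case using c by (simp add: U_diff)
next
  case (Suc n)
  define x y m where "x = U c a" and "y = U 0 a" and "m = max 1 (\<alpha> x)"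
  have S: "x \<in> S" "y \<in> S" "x ^ Suc n \<in> S" "y ^ Suc n \<in> S" "x - y \<in> S"
    using a by (auto simp: x_def y_def U_diff intro: power_S simp del: power_Suc)
  have d: "x ^ Suc n - y ^ Suc n \<in> S"
    using S(3,4) by (elim S_cases) (auto simp: U_diff)
  have m: "m \<ge> 1" "\<alpha> x \<le> m" "\<alpha> y \<le> m" by (auto simp: m_def x_def y_def intro!: max.coboundedI2)
  have xy: "\<alpha> (x - y) \<le> 1" using c by (simp add: x_def y_def U_diff)
  have "x ^ Suc (Suc n) - y ^ Suc (Suc n) = x * (x ^ Suc n - y ^ Suc n) + (x - y) * y ^ Suc n"
    by (simp add: right_diff_distrib left_diff_distrib)
  then have "\<alpha> (x ^ Suc (Suc n) - y ^ Suc (Suc n)) \<le> \<alpha> (x * (x ^ Suc n - y ^ Suc n)) + \<alpha> ((x - y) * y ^ Suc n)"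
    using S d by (metis \<alpha>_S_add mult_S)
  also have "\<dots> \<le> \<alpha> x * \<alpha> (x ^ Suc n - y ^ Suc n) + \<alpha> (x - y) * \<alpha> (y ^ Suc n)"
    using S d by (intro add_mono \<alpha>_S_mult)
  also have "\<dots> \<le> m * (real (Suc n) * m ^ n) + 1 * m ^ Suc n"
  proof (intro add_mono mult_mono)
    show "\<alpha> (x ^ Suc n - y ^ Suc n) \<le> real (Suc n) * m ^ n" using Suc unfolding x_def y_def m_def .
    have "\<alpha> (y ^ Suc n) \<le> \<alpha> y ^ Suc n" by (rule \<alpha>_power_S[OF S(2)])
    also have "\<dots> \<le> m ^ Suc n" using m S by (intro power_mono \<alpha>_S_nonneg)
    finally show "\<alpha> (y ^ Suc n) \<le> m ^ Suc n" .
  qed (use m xy S d \<alpha>_S_nonneg in auto)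
  also have "\<dots> = real (Suc (Suc n)) * m ^ Suc n" by (simp add: algebra_simps)
  finally show ?case unfolding x_def y_def m_def .
qed

text \<open>Removing the scalar part costs a term of degree \<open>k - 1\<close>; what remains is a
  power of \<open>a\<close>, where the differential inequality applies with
  \<open>nB a \<le> 2\<close>.\<close>

lemma growth_S: "\<exists>K. \<forall>u\<in>S. N u \<le> 1 \<longrightarrow> \<alpha> (u ^ k) \<le> K * max 1 (\<alpha> u) powr growth_exp"
proof -
  obtain C where C: "C > 0" "\<And>a. a \<in> A \<Longrightarrow> nA (mpow a (k - 1)) \<le> C * nA a powr p * nB a powr q"
    using ineq by blast
  have k1: "k = Suc (k - 1)" using kpq by simp
  have "\<alpha> (u ^ k) \<le> (C * 2 powr q + real k) * max 1 (\<alpha> u) powr growth_exp" if u: "u \<in> S" "N u \<le> 1" for u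
  proof -
    obtain c a where ca: "u = U c a" "a \<in> A" using u(1) by (rule S_cases)
    define m where "m = max 1 (\<alpha> u)"
    have m: "m \<ge> 1" "nA a \<le> m" by (auto simp: m_def ca intro!: max.coboundedI2)
    have c: "cmod c \<le> 1" "opn u \<le> 1" using u(2) by (auto simp: N_def ca)
    have "nB a \<le> opn (U 0 a)" by (rule nB_le_opn[OF ca(2)])
    also have "U 0 a = u + iota (- c)" by (simp add: ca iota_def U_add)
    also have "opn \<dots> \<le> opn u + opn (iota (- c))" using u by (intro opn_add) (auto simp: iota_def)
    also have "\<dots> \<le> 2" using c opn_iota[of "- c"] by simp
    finally have nb: "nB a \<le> 2" .
    have main: "\<alpha> (U 0 a ^ k) \<le> C * 2 powr q * m powr growth_exp"
    proof -
      have "U 0 a ^ k = U 0 (mpow a (k - 1))" using mpow_U[OF ca(2), of "k - 1"] k1 by simp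
      then have "\<alpha> (U 0 a ^ k) \<le> C * nA a powr p * nB a powr q" using C(2)[OF ca(2)] by simp
      also have "\<dots> \<le> C * m powr p * 2 powr q"
        using C(1) m nb kpq ca by (intro mult_mono powr_mono2) auto
      also have "\<dots> \<le> C * m powr growth_exp * 2 powr q"
        using C(1) m by (intro mult_right_mono mult_left_mono powr_mono) (auto simp: growth_exp_def)
      finally show ?thesis by (simp add: mult_ac)
    qed
    have rest: "\<alpha> (u ^ k - U 0 a ^ k) \<le> real k * m powr growth_exp"
    proof -
      have "\<alpha> (u ^ k - U 0 a ^ k) \<le> real k * m ^ (k - 1)"
        using power_difference[OF ca(2) c(1), of "k - 1"] k1 by (simp add: ca m_def)
      also have "m ^ (k - 1) = m powr real (k - 1)" using m by (simp add: powr_realpow)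
      also have "real k * m powr real (k - 1) \<le> real k * m powr growth_exp"
        using m by (intro mult_left_mono powr_mono) (auto simp: growth_exp_def)
      finally show ?thesis .
    qed
    have S: "u ^ k \<in> S" "U 0 a ^ k \<in> S" using u ca by (auto intro: power_S)
    then have "u ^ k - U 0 a ^ k \<in> S" by (elim S_cases) (auto simp: U_diff)
    then have "\<alpha> (u ^ k) \<le> \<alpha> (u ^ k - U 0 a ^ k) + \<alpha> (U 0 a ^ k)"
      using \<alpha>_S_add[of "u ^ k - U 0 a ^ k" "U 0 a ^ k"] S by simp
    then show ?thesis using main rest unfolding m_def[symmetric] by (simp add: distrib_right)
  qed
  then show ?thesis by blast
qed

lemma complete_S: "complete_wrt S (\<lambda>u v. \<alpha> (u - v))"
  unfolding complete_wrt_def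
proof (intro allI impI)
  fix f :: "nat \<Rightarrow> 'b scalar_endo" assume f: "\<forall>m. f m \<in> S" and C: "\<forall>\<epsilon>>0. \<exists>M. \<forall>m\<ge>M. \<forall>n\<ge>M. \<alpha> (f m - f n) < \<epsilon>"
  have "\<forall>m. \<exists>c a. f m = U c a \<and> a \<in> A" using f by (metis S_cases)
  then obtain c a where ca: "\<And>m. f m = U (c m) (a m)" "\<And>m. a m \<in> A" by metis
  have eq: "\<alpha> (f m - f n) = cmod (c m - c n) + nA (a m - a n)" for m n by (simp add: ca U_diff)
  have "Cauchy c"
  proof (rule CauchyI)
    fix e :: real assume "e > 0"
    then obtain M where "\<And>m n. m \<ge> M \<Longrightarrow> n \<ge> M \<Longrightarrow> \<alpha> (f m - f n) < e" using C by blast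
    moreover have "cmod (c m - c n) \<le> \<alpha> (f m - f n)" for m n
      unfolding eq using ca(2) by simp
    ultimately show "\<exists>M. \<forall>m\<ge>M. \<forall>n\<ge>M. norm (c m - c n) < e" by (meson le_less_trans)
  qed
  then obtain c0 where c0: "c \<longlonglongrightarrow> c0" using Cauchy_convergent convergent_def by blast
  have "\<exists>a0\<in>A. (\<lambda>m. nA (a m - a0)) \<longlonglongrightarrow> 0"
  proof (rule nA_complete[unfolded complete_wrt_def, rule_format])
    show "a m \<in> A" for m by (rule ca)
    fix e :: real assume "e > 0"
    then obtain M where "\<And>m n. m \<ge> M \<Longrightarrow> n \<ge> M \<Longrightarrow> \<alpha> (f m - f n) < e" using C by blast
    moreover have "nA (a m - a n) \<le> \<alpha> (f m - f n)" for m n by (simp add: eq)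
    ultimately show "\<exists>M. \<forall>m\<ge>M. \<forall>n\<ge>M. nA (a m - a n) < e" by (meson le_less_trans)
  qed
  then obtain a0 where a0: "a0 \<in> A" "(\<lambda>m. nA (a m - a0)) \<longlonglongrightarrow> 0" by blast
  have "(\<lambda>m. cmod (c m - c0)) \<longlonglongrightarrow> 0" using c0 by (metis LIM_zero tendsto_norm_zero)
  then have "(\<lambda>m. cmod (c m - c0) + nA (a m - a0)) \<longlonglongrightarrow> 0 + 0" using a0 by (intro tendsto_add)
  then have "(\<lambda>m. \<alpha> (f m - U c0 a0)) \<longlonglongrightarrow> 0" by (simp add: ca U_diff)
  then show "\<exists>u\<in>S. (\<lambda>m. \<alpha> (f m - u)) \<longlonglongrightarrow> 0" using a0 by blast
qed

sublocale pair: banach_cstar_pair S iota star N \<alpha> k growth_exp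
proof unfold_locales
  show "x + y \<in> S" if "x \<in> S" "y \<in> S" for x y using that by (auto elim!: S_cases simp: U_add)
  show "iota c \<in> S" for c by (simp add: iota_def)
  show "iota (c + d) = iota c + iota d" "iota (c * d) = iota c * iota d" for c d
    by (simp_all add: iota_def U_add U_mult)
  show "iota 1 = 1" by (rule scalar_endo_eqI) (simp_all add: iota_def)
  show "x * iota c = iota c * x" if "x \<in> S" for x c
    using that by (auto elim!: S_cases simp: iota_def U_mult mult.commute)
  show "star (x + y) = star x + star y" "star (x * y) = star y * star x" if "x \<in> S" "y \<in> S" for x y
    using that by (auto elim!: S_cases simp: U_add U_mult st_add st_mult st_scale add_ac mult.commute)
  show "star (star x) = x" if "x \<in> S" for x using that by (auto elim!: S_cases)
  show "star (iota c) = iota (cnj c)" for c by (simp add: iota_def)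
  show "0 \<le> N x" for x by (simp add: N_def le_max_iff_disj)
  show "N (x + y) \<le> N x + N y" if "x \<in> S" "y \<in> S" for x y
    using norm_triangle_ineq[of "scal x" "scal y"] opn_add[OF that] by (auto simp: N_def)
  show "N (x * y) \<le> N x * N y" if "x \<in> S" "y \<in> S" for x y
  proof -
    have "cmod (scal x) * cmod (scal y) \<le> N x * N y"
      unfolding N_def by (intro mult_mono) (auto simp: le_max_iff_disj)
    moreover have "opn x * opn y \<le> N x * N y"
      unfolding N_def using opn_nonneg that by (intro mult_mono) (auto simp: le_max_iff_disj)
    ultimately show ?thesis using opn_mult[OF that] unfolding N_def[of "x * y"] by (simp add: norm_mult)
  qed
  show "N (iota c) = cmod c" for c using opn_iota[of c] by (simp add: N_def iota_def)
  show "N (star x * x) = N x ^ 2" if "x \<in> S" for x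
  proof -
    have "scal (star x) = cnj (scal x)" using that by (auto elim!: S_cases)
    then have "N (star x * x) = max (cmod (scal x) ^ 2) (opn x ^ 2)"
      by (simp add: N_def opn_cstar[OF that] norm_mult power2_eq_square)
    also have "\<dots> = N x ^ 2" unfolding N_def using opn_nonneg[OF that]
      by (metis max_absorb1 max_absorb2 linear norm_ge_zero power_mono)
    finally show ?thesis .
  qed
  show "0 \<le> \<alpha> x" if "x \<in> S" for x by (rule \<alpha>_S_nonneg[OF that])
  show "x = 0" if x: "x \<in> S" "\<alpha> x = 0" for x
  proof -
    obtain c a where ca: "x = U c a" "a \<in> A" using x(1) by (rule S_cases)
    then have "c = 0" "nA a = 0" using x(2) nA_nonneg[of a] by (auto simp: add_nonneg_eq_0_iff)
    then have "x = U 0 0" using ca nA_eq_zero by simp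
    also have "\<dots> = 0" by (rule scalar_endo_eqI) simp_all
    finally show ?thesis .
  qed
  show "\<alpha> (x + y) \<le> \<alpha> x + \<alpha> y" "\<alpha> (x * y) \<le> \<alpha> x * \<alpha> y" if "x \<in> S" "y \<in> S" for x y
    using that by (rule \<alpha>_S_add, rule \<alpha>_S_mult)
  show "\<alpha> (iota c) = cmod c" for c by (simp add: iota_def)
  show "\<exists>B. \<forall>x\<in>S. \<alpha> (star x) \<le> B * \<alpha> x"
  proof -
    obtain C where C: "\<And>a. a \<in> A \<Longrightarrow> nA (st a) \<le> C * nA a" using nA_star by blast
    have "\<alpha> (star x) \<le> (\<bar>C\<bar> + 1) * \<alpha> x" if x: "x \<in> S" for x
    proof -
      obtain c a where ca: "x = U c a" "a \<in> A" using x by (rule S_cases)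
      have "C * nA a \<le> (\<bar>C\<bar> + 1) * nA a" using ca by (intro mult_right_mono) auto
      moreover have "1 * cmod c \<le> (\<bar>C\<bar> + 1) * cmod c" by (intro mult_right_mono) auto
      ultimately show ?thesis using C[OF ca(2)] by (simp add: ca distrib_left)
    qed
    then show ?thesis by blast
  qed
  show "complete_wrt S (\<lambda>u v. \<alpha> (u - v))" by (rule complete_S)
  show "2 \<le> k" "1 < growth_exp" "growth_exp < real k" using kpq by (auto simp: growth_exp_def)
  show "\<exists>K. \<forall>u\<in>S. N u \<le> 1 \<longrightarrow> \<alpha> (u ^ k) \<le> K * max 1 (\<alpha> u) powr growth_exp" by (rule growth_S)
qed auto

theorem wiener:
  assumes approx: "sa_bounded_approx_identity A st nA D le e"
  shows "wiener_property A sm st nA"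
  unfolding wiener_property_def
proof (intro allI impI)
  fix I assume ideal: "closed_ideal I A sm nA" and proper: "I \<noteq> A"
  have IA: "I \<subseteq> A" and I0: "0 \<in> I" and Iadd: "\<And>x y. x \<in> I \<Longrightarrow> y \<in> I \<Longrightarrow> x + y \<in> I"
    and Isc: "\<And>c x. x \<in> I \<Longrightarrow> sm c x \<in> I" and Imult: "\<And>a x. a \<in> A \<Longrightarrow> x \<in> I \<Longrightarrow> a * x \<in> I \<and> x * a \<in> I"
    and Icl: "closed_in_wrt I A (\<lambda>x y. nA (x - y))"
    using ideal unfolding closed_ideal_def by blast+
  obtain b where b: "b \<in> A" "b \<notin> I" using IA proper by blast
  define J where "J = U 0 ` I"
  define B where "B = U 0 ` A"
  have zero: "0 = U 0 0" by (rule scalar_endo_eqI) simp_all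
  have J: "J \<subseteq> S" "0 \<in> J" "\<And>x y. x \<in> J \<Longrightarrow> y \<in> J \<Longrightarrow> x + y \<in> J"
    using IA I0 Iadd by (auto simp: J_def zero U_add)
  have Jm: "a * x \<in> J \<and> x * a \<in> J" if "a \<in> S" "x \<in> J" for a x
    using that Iadd Isc Imult by (auto simp: J_def U_mult elim!: S_cases)
  have B: "B \<subseteq> S" "\<And>x. x \<in> B \<Longrightarrow> star x \<in> B" by (auto simp: B_def)
  have Bm: "a * x \<in> B \<and> x * a \<in> B" if "a \<in> S" "x \<in> B" for a x
    using that by (auto simp: B_def U_mult elim!: S_cases)
  have Jcl: "x \<in> J" if f: "\<And>n. f n \<in> J" and x: "x \<in> S" and l: "pair.tends f x" for f x
  proof -
    obtain c a where ca: "x = U c a" "a \<in> A" using x by (rule S_cases)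
    have "\<forall>n. \<exists>y. y \<in> I \<and> f n = U 0 y" using f by (auto simp: J_def)
    then obtain y where y: "\<And>n. y n \<in> I" "\<And>n. f n = U 0 (y n)" by metis
    have lim: "(\<lambda>n. cmod c + nA (y n - a)) \<longlonglongrightarrow> 0"
      using l unfolding pair.tends_def by (simp add: y ca U_diff)
    have yA: "y n - a \<in> A" for n by (rule A_diff[OF subsetD[OF IA y(1)] ca(2)])
    have "(\<lambda>n. nA (y n - a)) \<longlonglongrightarrow> 0"
      by (rule tendsto_sandwich[OF _ _ tendsto_const lim]) (use yA in auto)
    then have aI: "a \<in> I" using Icl y(1) ca(2) unfolding closed_in_wrt_def by blast
    have "cmod c \<le> 0" by (rule LIMSEQ_le_const[OF lim]) (use yA in auto)
    then show ?thesis using aI ca by (simp add: J_def)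
  qed
  obtain M0 where M0: "\<And>i. i \<in> D \<Longrightarrow> nA (e i) \<le> M0"
    using approx unfolding sa_bounded_approx_identity_def by blast
  have eA: "e i \<in> A" "st (e i) = e i" if "i \<in> D" for i
    using approx that unfolding sa_bounded_approx_identity_def by blast+
  have app: "\<exists>u\<in>B. pair.sa u \<and> \<alpha> u \<le> max M0 0 \<and> \<alpha> (u * U 0 b - U 0 b) < \<epsilon>" if e: "\<epsilon> > 0" for \<epsilon>
  proof -
    have "\<exists>i0\<in>D. \<forall>i\<in>D. le i0 i \<longrightarrow> nA (e i * b - b) < \<epsilon> \<and> nA (b * e i - b) < \<epsilon>"
      using approx b(1) e unfolding sa_bounded_approx_identity_def by blast
    \<comment> \<open>By reflexivity of \<open>le\<close> the index \<open>i0\<close> itself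
      serves.\<close>
    then obtain i where i: "i \<in> D" "le i i \<longrightarrow> nA (e i * b - b) < \<epsilon>" by blast
    have "le i i" using approx i(1) unfolding sa_bounded_approx_identity_def by blast
    then have "nA (e i * b - b) < \<epsilon>" using i(2) by blast
    moreover have "pair.sa (U 0 (e i))" using eA[OF i(1)] by (simp add: pair.sa_def)
    ultimately show ?thesis using eA[OF i(1)] M0[OF i(1)]
      by (intro bexI[of _ "U 0 (e i)"]) (auto simp: U_mult U_diff B_def)
  qed
  have bB: "U 0 b \<in> B" "U 0 b \<notin> J" using b by (auto simp: B_def J_def U_eq_iff)
  have "\<exists>v\<in>B. \<exists>c>0. \<forall>t\<ge>0. \<forall>y\<in>J. c + t \<le> N (v + pair.R t + y)"
    by (rule pair.separating_element_exists[OF J Jm Jcl B(1) Bm bB _ app]) auto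
  then obtain v c where v: "v \<in> B" "c > 0" "\<And>t y. t \<ge> 0 \<Longrightarrow> y \<in> J \<Longrightarrow> c + t \<le> N (v + pair.R t + y)" by blast
  have Bl: "a * x \<in> B" if "a \<in> S" "x \<in> B" for a x using Bm that by blast
  have "\<exists>(H :: ('b scalar_endo \<Rightarrow> complex) set) hs ip rep.
      top_irreducible_rep S (\<lambda>c x. iota c * x) star H (+) 0 hs ip rep \<and>
      (\<forall>x\<in>J. \<forall>F\<in>H. rep x F = 0) \<and> (\<exists>F\<in>H. rep v F \<noteq> 0) \<and> (\<forall>c. \<forall>F\<in>H. rep (iota c) F = hs c F) \<and>
      hs = (\<lambda>c F z. c * F z) \<and>
      (\<forall>F\<in>H. (\<forall>b\<in>B. F b = 0) \<longrightarrow> F = 0) \<and> (\<forall>F\<in>H. \<forall>c. \<forall>z\<in>S. F (iota c * z) = cnj c * F z)"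
    by (rule pair.irreducible_representation_exists[OF J Jm B(1,2) Bl v])
  then obtain H :: "('b scalar_endo \<Rightarrow> complex) set" and hs ip and rep
    where T: "top_irreducible_rep S (\<lambda>c x. iota c * x) star H (+) 0 hs ip rep"
      and kill: "\<forall>x\<in>J. \<forall>F\<in>H. rep x F = 0" and nz: "\<exists>F\<in>H. rep v F \<noteq> 0"
      and ri: "\<forall>c. \<forall>F\<in>H. rep (iota c) F = hs c F" and hs: "hs = (\<lambda>c F z. c * F z)"
      and inj: "\<forall>F\<in>H. (\<forall>b\<in>B. F b = 0) \<longrightarrow> F = 0"
      and lin: "\<forall>F\<in>H. \<forall>c. \<forall>z\<in>S. F (iota c * z) = cnj c * F z"
    by (elim exE conjE) (rule that; assumption)
  have H: "hilbert_space H (+) 0 hs ip"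
    using T unfolding top_irreducible_rep_def star_representation_def by blast
  obtain a0 where a0: "a0 \<in> A" "v = U 0 a0" using v(1) by (auto simp: B_def)
  have T': "top_irreducible_rep A sm st H (+) 0 hs ip (\<lambda>a. rep (U 0 a))"
  proof (rule top_irreducible_rep_restrict[OF T])
    show "\<exists>c. \<exists>a\<in>A. u = iota c + U 0 a" if "u \<in> S" for u
    proof -
      obtain c a where "u = U c a" "a \<in> A" using \<open>u \<in> S\<close> by (rule S_cases)
      then have "u = iota c + U 0 a" by (simp add: iota_def U_add)
      then show ?thesis using \<open>a \<in> A\<close> by blast
    qed
    show "\<exists>a\<in>A. \<exists>x\<in>H. rep (U 0 a) x \<noteq> 0" using nz a0 by blast
    show "rep (iota c) x = hs c x" if "x \<in> H" for c x using ri that by blast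
  qed (auto simp: U_add U_mult iota_def)
  \<comment> \<open>A linear functional is determined by its level set at 1, which is a vector of the required type.\<close>
  define E where "E F = {a \<in> A. F (U 0 a) = 1}" for F :: "'b scalar_endo \<Rightarrow> complex"
  have val: "F (U 0 a) = G (U 0 a)" if F: "F \<in> H" and G: "G \<in> H" and eq: "E F = E G" and a: "a \<in> A" and nz: "F (U 0 a) \<noteq> 0" for F G a
  proof -
    \<comment> \<open>\<open>F\<close> is conjugate-homogeneous, so this multiple of
      \<open>a\<close> lies in the level set \<open>E F\<close>, which is
      \<open>E G\<close>.\<close>
    define z where "z = cnj (1 / F (U 0 a))"
    have za: "iota z * U 0 a = U 0 (sm z a)" by (simp add: iota_def U_mult)
    have "F (iota z * U 0 a) = cnj z * F (U 0 a)" using lin F U_S[OF a] by blast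
    then have "F (U 0 (sm z a)) = 1" using nz unfolding za by (simp add: z_def)
    then have "sm z a \<in> E F" using a by (simp add: E_def)
    then have "G (U 0 (sm z a)) = 1" unfolding eq by (simp add: E_def)
    moreover have "G (iota z * U 0 a) = cnj z * G (U 0 a)" using lin G U_S[OF a] by blast
    ultimately have "cnj z * G (U 0 a) = 1" unfolding za by simp
    then show ?thesis using nz by (simp add: z_def field_simps)
  qed
  have "inj_on E H"
  proof (rule inj_onI)
    fix F G assume F: "F \<in> H" and G: "G \<in> H" and eq: "E F = E G"
    have eqA: "F (U 0 a) = G (U 0 a)" if "a \<in> A" for a
      \<comment> \<open>Where \<open>F\<close> vanishes, the symmetric use of \<open>val\<close>
        shows that \<open>G\<close> vanishes too.\<close>
      using val[OF F G eq that] val[OF G F eq[symmetric] that] by force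
    have "\<forall>x\<in>H. \<forall>y\<in>H. x + y \<in> H" "\<forall>c. \<forall>x\<in>H. hs c x \<in> H"
      using H unfolding hilbert_space_def by - (elim conjE, assumption)+
    then have "F + hs (- 1) G \<in> H" using F G by blast
    moreover have "F + hs (- 1) G = F - G" by (auto simp: hs)
    ultimately have "F - G \<in> H" by simp
    moreover have "\<forall>b\<in>B. (F - G) b = 0" using eqA by (auto simp: B_def)
    ultimately have "F - G = 0" using inj by blast
    then show "F = G" by simp
  qed
  then have DE: "inv_into H E (E F) = F" if "F \<in> H" for F using that by (rule inv_into_f_f)
  note T'' = top_irreducible_rep_transport[of A sm st H "(+)" 0 hs ip "\<lambda>a. rep (U 0 a)" "inv_into H E" E, OF T' DE A_star]
  have "\<forall>x\<in>I. \<forall>X\<in>E ` H. E (rep (U 0 x) (inv_into H E X)) = E 0"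
    using kill DE by (auto simp: J_def)
  with T'' show "\<exists>(H :: 'b set set) ad z hs ip Pi. top_irreducible_rep A sm st H ad z hs ip Pi \<and>
      (\<forall>x\<in>I. \<forall>v\<in>H. Pi x v = z)"
    by blast
qed

end

theorem theorem3p23:
  fixes A :: "'b::ring set"
    and sm :: "complex \<Rightarrow> 'b \<Rightarrow> 'b" and st :: "'b \<Rightarrow> 'b"
    and nA nB :: "'b \<Rightarrow> real"
    and k :: nat and p q :: real
    and D :: "'i set" and le :: "'i \<Rightarrow> 'i \<Rightarrow> bool" and e :: "'i \<Rightarrow> 'b"
  assumes "differential_subalgebra k p q A sm st nA nB"
    and "sa_bounded_approx_identity A st nA D le e"
  shows "wiener_property A sm st nA"
proof -
  interpret differential_setting k p q A sm st nA nB using assms(1) by unfold_locales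
  show ?thesis by (rule wiener[OF assms(2)])
qed

end
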